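(* Let $d\in\mathbb N$, $r>0$ and $\varepsilon>0$. Then $$K(r,\varepsilon)\ \ge\ \frac{6\varepsilon}{(16d^2-24d+11)\,r^2}.$$ Explicitly: for every $0<\tau<\frac{6\varepsilon}{(16d^2-24d+11)r^2}$ and every compact set $\mathcal A$ of real $d\times d$ matrices, each having only real eigenvalues, with $\max_{A\in\mathcal A}\rho(A)\le r$, the inequality $\rho(I+\tau\mathcal A)\ge1$ implies $\sigma(\mathcal A)\ge-\varepsilon$.
   Context: For a compact set $\mathcal A$ of real $d\times d$ matrices, a trajectory of the associated linear switching system is an absolutely continuous $x:[0,\infty)\to\mathbb R^d$ with $\dot x(t)=A(t)x(t)$ for almost every $t$, where $A(\cdot)$ is any Lebesgue measurable function from $[0,\infty)$ to $\mathcal A$. The (worst-case) Lyapunov exponent $\sigma(\mathcal A)$ is the infimum of all $\alpha\in\mathbb R$ such that for every trajectory $x$ there is a constant $C$ with $\|x(t)\|\le Ce^{\alpha t}$ for all $t\ge0$. For a bounded set of matrices $\mathcal M$, the joint spectral radius is $\rho(\mathcal M)=\lim_{k\to\infty}\sup_{M_1,\dots,M_k\in\mathcal M}\|M_1\cdots M_k\|^{1/k}$; for a single matrix, $\rho(A)$ is its spectral radius. $I+\tau\mathcal A=\{I+\tau A: A\in\mathcal A\}$. $K(r,\varepsilon)$ denotes the largest number such that for every $\tau\in(0,K(r,\varepsilon))$ and every compact set $\mathcal A$ of real $d\times d$ matrices with only real eigenvalues and $\max_{A\in\mathcal A}\rho(A)\le r$, the inequality $\rho(I+\tau\mathcal A)\ge1$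 implies $\sigma(\mathcal A)\ge-\varepsilon$. *)

theory Defs
  imports "HOL-Analysis.Analysis"
begin

text \<open>Complexification of a real square matrix.\<close>
definition cmat :: "real^'n^'n \<Rightarrow> complex^'n^'n" where
  "cmat A = (\<chi> i j. complex_of_real (A $ i $ j))"

text \<open>(Complex) eigenvalues of a real square matrix.\<close>
definition mat_eigenvalue :: "real^'n^'n \<Rightarrow> complex \<Rightarrow> bool" where
  "mat_eigenvalue A c \<longleftrightarrow> (\<exists>v::complex^'n. v \<noteq> 0 \<and> cmat A *v v = c *s v)"

text \<open>A matrix has only real eigenvalues.\<close>
definition only_real_eigenvalues :: "real^'n^'n \<Rightarrow> bool" where
  "only_real_eigenvalues A \<longleftrightarrow> (\<forall>c. mat_eigenvalue A c \<longrightarrow> Im c = 0)"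

text \<open>Spectral radius of a single matrix: largest modulus of an eigenvalue.\<close>
definition spec_rad :: "real^'n^'n \<Rightarrow> real" where
  "spec_rad A = Sup {cmod c | c. mat_eigenvalue A c}"

text \<open>Joint spectral radius of a bounded set of matrices
  (lim_{k} sup_{M_1..M_k} ||M_1 ... M_k||^(1/k)).\<close>
definition jsr :: "(real^'n^'n) set \<Rightarrow> real" where
  "jsr \<M> = lim (\<lambda>k::nat.
      (SUP ps \<in> {ps. length ps = k \<and> set ps \<subseteq> \<M>}. norm (foldr (**) ps (mat 1)))
        powr (1 / real k))"

text \<open>Absolute continuity of a function on a set of reals.\<close>
definition abs_cont_on :: "real set \<Rightarrow> (real \<Rightarrow> 'a::real_normed_vector) \<Rightarrow> bool" where
  "abs_cont_on S f \<longleftrightarrow>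
     (\<forall>e>0. \<exists>\<delta>>0. \<forall>(n::nat) (a::nat \<Rightarrow> real) b.
        (\<forall>i<n. a i \<le> b i \<and> {a i..b i} \<subseteq> S) \<and>
        (\<forall>i<n. \<forall>j<n. i \<noteq> j \<longrightarrow> b i \<le> a j \<or> b j \<le> a i) \<and>
        (\<Sum>i<n. b i - a i) < \<delta>
        \<longrightarrow> (\<Sum>i<n. norm (f (b i) - f (a i))) < e)"

text \<open>Trajectories of the linear switching system x' = A(t) x, A(t) in \<A>.\<close>
definition trajectory :: "(real^'n^'n) set \<Rightarrow> (real \<Rightarrow> real^'n) \<Rightarrow> bool" where
  "trajectory \<A> x \<longleftrightarrow>
     (\<forall>T\<ge>0. abs_cont_on {0..T} x) \<and>
     (\<exists>A :: real \<Rightarrow> real^'n^'n.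
        A \<in> borel_measurable (lebesgue_on {0..}) \<and>
        (\<forall>t\<ge>0. A t \<in> \<A>) \<and>
        (AE t in lebesgue_on {0..}. (x has_vector_derivative (A t *v x t)) (at t)))"

text \<open>Worst-case Lyapunov exponent (as an extended real, to be safe).\<close>
definition lyap_exp :: "(real^'n^'n) set \<Rightarrow> ereal" where
  "lyap_exp \<A> = Inf (ereal ` {\<alpha>. \<forall>x. trajectory \<A> x \<longrightarrow>
       (\<exists>C. \<forall>t\<ge>0. norm (x t) \<le> C * exp (\<alpha> * t))})"

end

theory Submission
  imports Defs "HOL-Computational_Algebra.Fundamental_Theorem_Algebra"
begin

text \<open>
If the Lyapunov exponent is below \<open>- \<epsilon>\<close>, all trajectories decay at some rate \<open>a < - \<epsilon>\<close>, and
the largest rescaled norm reachable by piecewise constant switching is a norm \<open>v\<close> with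
\<open>v (exp (t A) x) \<le> exp (a t) v x\<close>. It suffices that \<open>I + \<tau> A\<close> contracts \<open>v\<close> uniformly. For a
functional \<open>w\<close> of dual norm one and \<open>a < \<alpha> < 0\<close>, the function \<open>exp (- \<alpha> t) w (exp (t A) x)\<close> is bounded
by \<open>v x\<close> and is an exponential sum with \<open>d\<close> exponents in \<open>[- (r + \<alpha>), 0)\<close>; Taylor's formula reduces the
contraction to a bound on its second derivative.

This bound is a Markov inequality. Among exponential sums bounded by one, exchanging exponents one at a
time shows that the confluent case \<open>P (\<rho> t) exp (- \<rho> t)\<close> with \<open>degree P = d - 1\<close> is the worst. There the
Hermite function \<open>H\<^bsub>2d-2\<^esub>(y) exp (- y\<^sup>2 / 2)\<close>, with \<open>\<rho> t = y\<^sup>2 / 2\<close> and normalised at \<open>0\<close>, serves as a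
comparison function: the moduli of its successive extrema increase. Its second derivative in \<open>t\<close> at \<open>0\<close>
is \<open>(16 d\<^sup>2 - 24 d + 11) \<rho>\<^sup>2 / 3\<close>.
\<close>

subsection \<open>Linear differential equations with constant coefficients\<close>

text \<open>Real exponents enter through Rolle's theorem: for real \<mu> the operator
  \<open>D - \<mu>\<close> is differentiation up to positive factors, so zeros and signs can be
  traced through a product of such operators. Strictly negative exponents make infinity act as one
  more zero, which is why the shift \<alpha> lies strictly above \<open>a\<close>.

  An optimal comparison function would equioscillate and need not be explicit. The comparison asks
  only for alternating values of modulus at least one at \<open>d\<close> points beginning with 0,
  and the Hermite function supplies them with a second derivative at 0 that its differential
  equation determines.

  The Lyapunov exponent provides one constant per trajectory, whereas a norm requires a bound over
  all switching signals at once. Uniformity is gained by concatenating ever worse finite signals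
  into a single trajectory.

  Dimension one is treated apart: there the bound on \<tau> yields only
  \<open>\<tau> * r < 2\<close>, so \<open>1 + \<alpha> * \<tau>\<close> may fail to be positive and
  the Taylor argument has no evaluation point.\<close>

text \<open>\<open>lde [\<mu>\<^sub>1, \<dots>, \<mu>\<^sub>n] f k\<close> encodes \<open>(D - \<mu>\<^sub>n) \<cdots> (D - \<mu>\<^sub>1) f = k\<close>, where \<open>D\<close> is differentiation;
  for \<open>k = 0\<close> the solutions are the exponential sums with exponents \<open>\<mu>\<^sub>i\<close>.\<close>
primrec lde :: "real list \<Rightarrow> (real \<Rightarrow> real) \<Rightarrow> (real \<Rightarrow> real) \<Rightarrow> bool" where
  "lde [] f k \<longleftrightarrow> f = k"
| "lde (\<mu> # ls) f k \<longleftrightarrow>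
    (\<exists>h. (\<forall>t. (f has_real_derivative \<mu> * f t + h t) (at t)) \<and> lde ls h k)"

lemma lde_linear:
  assumes "lde ls f k" "lde ls g m"
  shows "lde ls (\<lambda>t. a * f t + b * g t) (\<lambda>t. a * k t + b * m t)"
  using assms
proof (induction ls arbitrary: f g)
  case Nil
  then show ?case by simp
next
  case (Cons \<mu> ls)
  obtain h where h: "\<And>t. (f has_real_derivative \<mu> * f t + h t) (at t)" "lde ls h k"
    using Cons.prems(1) by auto
  obtain i where i: "\<And>t. (g has_real_derivative \<mu> * g t + i t) (at t)" "lde ls i m"
    using Cons.prems(2) by auto
  have "((\<lambda>t. a * f t + b * g t) has_real_derivative
      \<mu> * (a * f t + b * g t) + (a * h t + b * i t)) (at t)" for t
    by (rule derivative_eq_intros h(1) i(1) refl | simp add: algebra_simps)+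
  with Cons.IH[OF h(2) i(2)] show ?case
    by (auto intro!: exI[of _ "\<lambda>t. a * h t + b * i t"])
qed

lemma lde_diff:
  "lde ls f k \<Longrightarrow> lde ls g m \<Longrightarrow> lde ls (\<lambda>t. f t - g t) (\<lambda>t. k t - m t)"
  using lde_linear[of ls f k g m 1 "-1"] by simp

lemma lde_cmult: "lde ls f k \<Longrightarrow> lde ls (\<lambda>t. c * f t) (\<lambda>t. c * k t)"
  using lde_linear[of ls f k f k c 0] by simp

lemma lde_snoc:
  "lde (ls @ [\<mu>]) f k \<longleftrightarrow>
    (\<exists>m. lde ls f m \<and> (\<forall>t. (m has_real_derivative \<mu> * m t + k t) (at t)))"
  by (induction ls arbitrary: f) auto

text \<open>The factors commute: in the induction step \<open>g\<close> is
  \<open>(D - \<nu>) f\<close>. Rotation brings the exponent that is to be exchanged to the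
  outermost position, where \<open>lde_snoc_0\<close> isolates it.\<close>

lemma lde_rotate: "lde (\<mu> # ls) f k \<Longrightarrow> lde (ls @ [\<mu>]) f k"
proof (induction ls arbitrary: f)
  case Nil
  then show ?case by simp
next
  case (Cons \<nu> ls)
  obtain h h2 where h: "\<And>t. (f has_real_derivative \<mu> * f t + h t) (at t)"
      "\<And>t. (h has_real_derivative \<nu> * h t + h2 t) (at t)" and h2: "lde ls h2 k"
    using Cons.prems by auto
  define g where "g t = (\<mu> - \<nu>) * f t + h t" for t
  have "(g has_real_derivative \<mu> * g t + h2 t) (at t)" for t
    unfolding g_def by (rule derivative_eq_intros h refl | simp add: algebra_simps)+
  then have "lde (ls @ [\<mu>]) g k"
    using h2 by (intro Cons.IH) auto
  moreover have "(f has_real_derivative \<nu> * f t + g t) (at t)" for t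
    using h(1)[of t] by (simp add: g_def algebra_simps)
  ultimately show ?case by auto
qed

lemma exp_ode_unique:
  assumes "\<And>t. (m has_real_derivative \<mu> * m t) (at t)"
  shows "m = (\<lambda>t. m 0 * exp (\<mu> * t))"
proof
  fix t
  have "((\<lambda>t. m t * exp (- \<mu> * t)) has_real_derivative 0) (at t)" for t
    by (rule derivative_eq_intros assms refl | simp add: algebra_simps)+
  then have "m t * exp (- \<mu> * t) = m 0 * exp (- \<mu> * 0)"
    using DERIV_isconst_all by blast
  then show "m t = m 0 * exp (\<mu> * t)"
    by (simp add: exp_minus field_simps)
qed

text \<open>With the last factor solved, Rolle steps through the remaining ones end at a pure
  exponential, which has no zeros and whose coefficient \<open>a\<close> carries a sign.\<close>

lemma lde_snoc_0:
  "lde (ls @ [\<mu>]) f (\<lambda>_. 0) \<longleftrightarrow> (\<exists>a. lde ls f (\<lambda>t. a * exp (\<mu> * t)))"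
proof
  assume "lde (ls @ [\<mu>]) f (\<lambda>_. 0)"
  then obtain m where m: "lde ls f m" "\<And>t. (m has_real_derivative \<mu> * m t) (at t)"
    by (auto simp: lde_snoc)
  show "\<exists>a. lde ls f (\<lambda>t. a * exp (\<mu> * t))"
    using m(1) exp_ode_unique[OF m(2)] by metis
next
  assume "\<exists>a. lde ls f (\<lambda>t. a * exp (\<mu> * t))"
  then obtain a where a: "lde ls f (\<lambda>t. a * exp (\<mu> * t))" ..
  have "((\<lambda>t. a * exp (\<mu> * t)) has_real_derivative \<mu> * (a * exp (\<mu> * t)) + 0) (at t)" for t
    by (rule derivative_eq_intros refl | simp)+
  with a show "lde (ls @ [\<mu>]) f (\<lambda>_. 0)"
    unfolding lde_snoc by blast
qed

lemma lde_deriv: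
  assumes "lde ls f k" "\<And>t. (k has_real_derivative k' t) (at t)"
  shows "\<exists>f'. (\<forall>t. (f has_real_derivative f' t) (at t)) \<and> lde ls f' k'"
  using assms(1)
proof (induction ls arbitrary: f)
  case Nil
  then show ?case using assms(2) by auto
next
  case (Cons \<mu> ls)
  obtain h where h: "\<And>t. (f has_real_derivative \<mu> * f t + h t) (at t)" "lde ls h k"
    using Cons.prems by auto
  obtain h' where h': "\<And>t. (h has_real_derivative h' t) (at t)" "lde ls h' k'"
    using Cons.IH[OF h(2)] by auto
  have "((\<lambda>t. \<mu> * f t + h t) has_real_derivative \<mu> * (\<mu> * f t + h t) + h' t) (at t)" for t
    by (rule derivative_eq_intros h(1) h'(1) refl | simp add: algebra_simps)+
  then show ?case using h(1) h'(2) by (intro exI[of _ "\<lambda>t. \<mu> * f t + h t"]) auto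
qed

lemma lde_deriv2:
  assumes "lde ls f k" "\<And>t. (k has_real_derivative k' t) (at t)"
    "\<And>t. (k' has_real_derivative k'' t) (at t)"
  shows "\<And>t. (f has_real_derivative deriv f t) (at t)" "lde ls (deriv f) k'"
    "\<And>t. (deriv f has_real_derivative deriv (deriv f) t) (at t)"
    "lde ls (deriv (deriv f)) k''"
proof -
  obtain f' where f': "\<And>t. (f has_real_derivative f' t) (at t)" "lde ls f' k'"
    using lde_deriv[OF assms(1,2)] by auto
  have 1: "deriv f = f'" using f'(1) DERIV_imp_deriv by blast
  obtain f'' where f'': "\<And>t. (f' has_real_derivative f'' t) (at t)" "lde ls f'' k''"
    using lde_deriv[OF f'(2) assms(3)] by auto
  have 2: "deriv f' = f''" using f''(1) DERIV_imp_deriv by blast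
  show "\<And>t. (f has_real_derivative deriv f t) (at t)" "lde ls (deriv f) k'"
    "\<And>t. (deriv f has_real_derivative deriv (deriv f) t) (at t)"
    "lde ls (deriv (deriv f)) k''"
    using f' f'' by (simp_all add: 1 2)
qed

lemma DERIV_exp_lin: "((\<lambda>t. c * exp (\<mu> * t)) has_real_derivative (c * \<mu>) * exp (\<mu> * t)) (at t)"
  by (rule derivative_eq_intros refl | simp)+

lemma antiderivative_real:
  fixes f :: "real \<Rightarrow> 'a::euclidean_space"
  assumes "\<And>t. isCont f t"
  obtains F where "\<And>t. (F has_vector_derivative f t) (at t)"
  using einterval_antiderivative[of "-\<infinity>" \<infinity> f] assms by auto

lemma linear_ode_exists:
  fixes k :: "real \<Rightarrow> 'a::euclidean_space"
  assumes "\<And>t. isCont k t"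
  obtains f where "f 0 = x" "\<And>t. (f has_vector_derivative \<mu> *\<^sub>R f t + k t) (at t)"
proof -
  obtain F where F: "\<And>t. (F has_vector_derivative exp (- \<mu> * t) *\<^sub>R k t) (at t)"
    using antiderivative_real[of "\<lambda>t. exp (- \<mu> * t) *\<^sub>R k t"] assms by (auto intro!: continuous_intros)
  define f where "f t = exp (\<mu> * t) *\<^sub>R (x + F t - F 0)" for t
  have 1: "((\<lambda>t. exp (\<mu> * t)) has_real_derivative \<mu> * exp (\<mu> * t)) (at t)" for t
    by (rule derivative_eq_intros refl | simp)+
  have "(f has_vector_derivative \<mu> *\<^sub>R f t + k t) (at t)" for t
    unfolding f_def
    by (rule derivative_eq_intros F 1 refl | simp add: algebra_simps flip: exp_add)+
  moreover have "f 0 = x" by (simp add: f_def)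
  ultimately show ?thesis using that by blast
qed

lemma lde_exists:
  assumes "\<And>t. isCont k t"
  obtains f where "lde ls f k"
proof -
  have "\<exists>f. lde ls f k \<and> (\<forall>t. isCont f t)"
  proof (induction ls)
    case Nil
    then show ?case using assms by auto
  next
    case (Cons \<mu> ls)
    then obtain h where h: "lde ls h k" "\<And>t. isCont h t" by auto
    obtain f :: "real \<Rightarrow> real" where "\<And>t. (f has_vector_derivative \<mu> *\<^sub>R f t + h t) (at t)"
      using linear_ode_exists[OF h(2)] by blast
    then have f: "\<And>t. (f has_real_derivative \<mu> * f t + h t) (at t)"
      by (simp add: has_real_derivative_iff_has_vector_derivative)
    then show ?case using h(1) DERIV_isCont by (intro exI[of _ f]) auto
  qed
  then show ?thesis using that by auto
qed

text \<open>L'Hospital applied to \<open>f\<close> as the quotient of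
  \<open>exp (- \<mu> * t) * f t\<close> and \<open>exp (- \<mu> * t)\<close>: the quotient of the
  derivatives is \<open>h / (- \<mu>)\<close>, so decay passes from \<open>h\<close> to
  \<open>f\<close>.\<close>

lemma lde_tendsto_0:
  assumes "lde ls f k" "\<And>\<mu>. \<mu> \<in> set ls \<Longrightarrow> \<mu> < 0" "(k \<longlongrightarrow> 0) at_top"
  shows "(f \<longlongrightarrow> 0) at_top"
  using assms(1,2)
proof (induction ls arbitrary: f)
  case Nil
  then show ?case using assms(3) by simp
next
  case (Cons \<mu> ls)
  obtain h where h: "\<And>t. (f has_real_derivative \<mu> * f t + h t) (at t)" "lde ls h k"
    using Cons.prems by auto
  have h0: "(h \<longlongrightarrow> 0) at_top" using Cons h by auto
  have neg: "\<mu> < 0" using Cons.prems by simp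
  have "((\<lambda>t. (exp (- \<mu> * t) * f t) / exp (- \<mu> * t)) \<longlongrightarrow> 0) at_top"
  proof (rule lhospital_at_top_at_top)
    show "filterlim (\<lambda>t. exp (- \<mu> * t)) at_top at_top"
      using neg by (intro filterlim_compose[OF exp_at_top] filterlim_tendsto_pos_mult_at_top[OF tendsto_const _ filterlim_ident]) auto
    show "\<forall>\<^sub>F t in at_top. - \<mu> * exp (- \<mu> * t) \<noteq> 0" using neg by simp
    show "\<forall>\<^sub>F t in at_top. ((\<lambda>t. exp (- \<mu> * t) * f t) has_real_derivative exp (- \<mu> * t) * h t) (at t)"
      by (rule always_eventually allI derivative_eq_intros h(1) refl | simp add: algebra_simps)+
    show "\<forall>\<^sub>F t in at_top. ((\<lambda>t. exp (- \<mu> * t)) has_real_derivative - \<mu> * exp (- \<mu> * t)) (at t)"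
      by (rule always_eventually allI derivative_eq_intros refl | simp)+
    have "((\<lambda>t. h t / (- \<mu>)) \<longlongrightarrow> 0) at_top" using tendsto_divide[OF h0 tendsto_const, of "-\<mu>"] neg by simp
    then show "((\<lambda>t. exp (- \<mu> * t) * h t / (- \<mu> * exp (- \<mu> * t))) \<longlongrightarrow> 0) at_top"
      by (simp add: field_simps)
  qed
  then show ?case by simp
qed

lemma lde_shift: "lde ls f k \<Longrightarrow> lde ls (\<lambda>t. f (t + c)) (\<lambda>t. k (t + c))"
proof (induction ls arbitrary: f)
  case Nil
  then show ?case by simp
next
  case (Cons \<mu> ls)
  then obtain h where h: "\<And>t. (f has_real_derivative \<mu> * f t + h t) (at t)" "lde ls h k"
    by auto
  have "((\<lambda>t. f (t + c)) has_real_derivative \<mu> * f (t + c) + h (t + c)) (at t)" for t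
    using h(1)[of "t + c"] DERIV_shift by blast
  with Cons.IH[OF h(2)] show ?case
    by (auto intro!: exI[of _ "\<lambda>t. h (t + c)"])
qed

lemma lde_exp_mult:
  "lde ls f k \<Longrightarrow> lde (map (\<lambda>\<mu>. \<mu> + c) ls) (\<lambda>t. exp (c * t) * f t) (\<lambda>t. exp (c * t) * k t)"
proof (induction ls arbitrary: f)
  case Nil
  then show ?case by simp
next
  case (Cons \<mu> ls)
  then obtain h where h: "\<And>t. (f has_real_derivative \<mu> * f t + h t) (at t)" "lde ls h k"
    by auto
  have "((\<lambda>t. exp (c * t) * f t) has_real_derivative
      (\<mu> + c) * (exp (c * t) * f t) + exp (c * t) * h t) (at t)" for t
    by (rule derivative_eq_intros h(1) refl | simp add: algebra_simps)+
  with Cons.IH[OF h(2)] show ?case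
    by (auto intro!: exI[of _ "\<lambda>t. exp (c * t) * h t"])
qed

subsection \<open>Rolle arguments and exchange of exponents\<close>

text \<open>Nodes are kept as infinite increasing sequences of which only an initial segment
  matters. Where \<open>Q\<close> fails, any point of the gap is taken, so that monotonicity holds
  throughout.\<close>

lemma strict_mono_between:
  fixes t :: "nat \<Rightarrow> real"
  assumes "strict_mono t" "\<And>i. Q i \<Longrightarrow> \<exists>\<xi>. t i < \<xi> \<and> \<xi> < t (Suc i) \<and> P i \<xi>"
  obtains \<xi> where "strict_mono \<xi>" "\<And>i. t i < \<xi> i" "\<And>i. \<xi> i < t (Suc i)" "\<And>i. Q i \<Longrightarrow> P i (\<xi> i)"
proof -
  have "\<exists>\<xi>. t i < \<xi> \<and> \<xi> < t (Suc i) \<and> (Q i \<longrightarrow> P i \<xi>)" for i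
    using assms(2)[of i] dense[of "t i" "t (Suc i)"] assms(1) by (metis strict_mono_Suc_iff)
  then obtain \<xi> where \<xi>: "\<And>i. t i < \<xi> i" "\<And>i. \<xi> i < t (Suc i)" "\<And>i. Q i \<Longrightarrow> P i (\<xi> i)"
    by metis
  moreover have "strict_mono \<xi>"
    unfolding strict_mono_Suc_iff using \<xi> by (meson less_trans)
  ultimately show ?thesis using that by blast
qed

lemma exp_mvt:
  fixes f :: "real \<Rightarrow> real"
  assumes "a < b" "\<And>t. (f has_real_derivative \<mu> * f t + h t) (at t)"
  shows "\<exists>\<xi>. a < \<xi> \<and> \<xi> < b \<and>
    f b = exp (\<mu> * (b - a)) * f a + (b - a) * exp (\<mu> * (b - \<xi>)) * h \<xi>"
proof -
  have "((\<lambda>t. exp (\<mu> * (b - t)) * f t) has_real_derivative exp (\<mu> * (b - t)) * h t) (at t)" for t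
    by (rule derivative_eq_intros assms(2) refl | simp add: algebra_simps)+
  from MVT2[OF assms(1) this] show ?thesis by (auto simp: algebra_simps)
qed

lemma rolle_step_zero:
  fixes f :: "real \<Rightarrow> real"
  assumes "a < b" "\<And>t. (f has_real_derivative \<mu> * f t + h t) (at t)" "f a = 0" "f b = 0"
  shows "\<exists>\<xi>. a < \<xi> \<and> \<xi> < b \<and> h \<xi> = 0"
  using exp_mvt[OF assms(1,2)] assms by force

lemma rolle_step_pos:
  fixes f :: "real \<Rightarrow> real"
  assumes "a < b" "\<And>t. (f has_real_derivative \<mu> * f t + h t) (at t)"
    "\<sigma> * f a \<le> 0" "\<sigma> * f b \<ge> 0" "f a \<noteq> 0 \<or> f b \<noteq> 0" "\<sigma> \<noteq> 0"
  shows "\<exists>\<xi>. a < \<xi> \<and> \<xi> < b \<and> \<sigma> * h \<xi> > 0"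
proof -
  obtain \<xi> where \<xi>: "a < \<xi>" "\<xi> < b"
    "f b = exp (\<mu> * (b - a)) * f a + (b - a) * exp (\<mu> * (b - \<xi>)) * h \<xi>"
    using exp_mvt[OF assms(1,2)] by blast
  have "\<sigma> * f b = exp (\<mu> * (b - a)) * (\<sigma> * f a) + (b - a) * exp (\<mu> * (b - \<xi>)) * (\<sigma> * h \<xi>)"
    by (subst \<xi>(3)) (simp add: algebra_simps)
  moreover have "exp (\<mu> * (b - a)) * (\<sigma> * f a) \<le> 0"
    using assms(3) by (simp add: mult_nonneg_nonpos)
  moreover have "\<sigma> * f b > 0 \<or> exp (\<mu> * (b - a)) * (\<sigma> * f a) < 0"
  proof (cases "f b = 0")
    case True
    then have "\<sigma> * f a < 0" using assms by (simp add: order_less_le)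
    then show ?thesis by (simp add: mult_pos_neg)
  next
    case False
    then show ?thesis using assms by (simp add: order_less_le)
  qed
  ultimately have "(b - a) * exp (\<mu> * (b - \<xi>)) * (\<sigma> * h \<xi>) > 0" using assms(4) by linarith
  then have "\<sigma> * h \<xi> > 0" 
    by (rule zero_less_mult_pos) (simp add: \<open>a < b\<close>)
  with \<xi> show ?thesis by blast
qed

text \<open>Each factor costs one zero. Read contrapositively, a zero-free right-hand side allows at
  most \<open>length ls\<close> zeros of \<open>f\<close>, the Chebyshev property behind
  interpolation.\<close>

lemma lde_zeros:
  assumes "lde ls f k" "strict_mono t" "\<And>i. i \<le> length ls \<Longrightarrow> f (t i) = 0"
  shows "\<exists>\<xi>. k \<xi> = 0"
  using assms
proof (induction ls arbitrary: f t)
  case Nil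
  then show ?case by auto
next
  case (Cons \<mu> ls)
  obtain h where h: "\<And>t. (f has_real_derivative \<mu> * f t + h t) (at t)" "lde ls h k"
    using Cons.prems by auto
  have "\<exists>\<xi>. t i < \<xi> \<and> \<xi> < t (Suc i) \<and> h \<xi> = 0" if "i \<le> length ls" for i
    using that Cons.prems(2,3) by (intro rolle_step_zero[OF _ h(1)]) (auto simp: strict_mono_Suc_iff)
  then obtain \<xi> where "strict_mono \<xi>" "\<And>i. i \<le> length ls \<Longrightarrow> h (\<xi> i) = 0"
    using strict_mono_between[OF Cons.prems(2), of "\<lambda>i. i \<le> length ls" "\<lambda>i \<xi>. h \<xi> = 0"] by metis
  with Cons.IH[OF h(2)] show ?case by auto
qed

text \<open>Each factor shortens the alternating pattern by one point and flips its first sign. With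
  an exponential on the right this determines the sign of its coefficient.\<close>

lemma lde_alternation:
  assumes "lde ls f k" "strict_mono t" "\<And>i. i \<le> length ls \<Longrightarrow> (-1) ^ i * \<sigma> * f (t i) > 0"
  shows "\<exists>\<xi>. (-1) ^ length ls * \<sigma> * k \<xi> > 0"
  using assms
proof (induction ls arbitrary: f t \<sigma>)
  case Nil
  then show ?case by auto
next
  case (Cons \<mu> ls)
  obtain h where h: "\<And>t. (f has_real_derivative \<mu> * f t + h t) (at t)" "lde ls h k"
    using Cons.prems by auto
  have "\<exists>\<xi>. t i < \<xi> \<and> \<xi> < t (Suc i) \<and> (-1) ^ i * (- \<sigma>) * h \<xi> > 0" if "i \<le> length ls" for i
  proof (rule rolle_step_pos[OF _ h(1)])
    show "t i < t (Suc i)" using Cons.prems(2) by (auto simp: strict_mono_Suc_iff)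
    show "(-1) ^ i * (- \<sigma>) * f (t i) \<le> 0" "(-1) ^ i * (- \<sigma>) * f (t (Suc i)) \<ge> 0"
      "f (t i) \<noteq> 0 \<or> f (t (Suc i)) \<noteq> 0" "(-1) ^ i * (- \<sigma>) \<noteq> 0"
      using Cons.prems(3)[of i] Cons.prems(3)[of "Suc i"] that by auto
  qed
  then obtain \<xi> where "strict_mono \<xi>" "\<And>i. i \<le> length ls \<Longrightarrow> (-1) ^ i * (- \<sigma>) * h (\<xi> i) > 0"
    using strict_mono_between[OF Cons.prems(2), of "\<lambda>i. i \<le> length ls" "\<lambda>i \<xi>. (-1) ^ i * (- \<sigma>) * h \<xi> > 0"]
    by metis
  with Cons.IH[OF h(2), of \<xi> "-\<sigma>"] show ?case by auto
qed

text \<open>A sign at one point followed by zeros survives Rolle steps: each step flips the sign and costs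
  one zero.\<close>
lemma lde_signed_zeros:
  assumes "lde ls f k" "strict_mono t" "\<sigma> * f (t 0) > 0"
    "\<And>i. 1 \<le> i \<Longrightarrow> i \<le> length ls + M \<Longrightarrow> f (t i) = 0"
  shows "\<exists>t'. strict_mono t' \<and> (-1) ^ length ls * \<sigma> * k (t' 0) > 0 \<and>
    (\<forall>i. 1 \<le> i \<longrightarrow> i \<le> M \<longrightarrow> k (t' i) = 0)"
  using assms
proof (induction ls arbitrary: f t \<sigma>)
  case Nil
  then show ?case by auto
next
  case (Cons \<mu> ls)
  obtain h where h: "\<And>t. (f has_real_derivative \<mu> * f t + h t) (at t)" "lde ls h k"
    using Cons.prems by auto
  have "\<exists>\<xi>. t i < \<xi> \<and> \<xi> < t (Suc i) \<and> (if i = 0 then (- \<sigma>) * h \<xi> > 0 else h \<xi> = 0)"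
    if "i \<le> length ls + M" for i
  proof (cases "i = 0")
    case True
    have "\<exists>\<xi>. t 0 < \<xi> \<and> \<xi> < t (Suc 0) \<and> (- \<sigma>) * h \<xi> > 0"
      using Cons.prems(2,3) Cons.prems(4)[of 1]
      by (intro rolle_step_pos[OF _ h(1)]) (auto simp: strict_mono_Suc_iff)
    then show ?thesis using True by simp
  next
    case False
    then have "\<exists>\<xi>. t i < \<xi> \<and> \<xi> < t (Suc i) \<and> h \<xi> = 0"
      using Cons.prems(2,4) that by (intro rolle_step_zero[OF _ h(1)]) (auto simp: strict_mono_Suc_iff)
    then show ?thesis using False by simp
  qed
  then obtain \<xi> where \<xi>: "strict_mono \<xi>"
    "\<And>i. i \<le> length ls + M \<Longrightarrow> (if i = 0 then (- \<sigma>) * h (\<xi> i) > 0 else h (\<xi> i) = 0)"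
    using strict_mono_between[OF Cons.prems(2), of "\<lambda>i. i \<le> length ls + M" "\<lambda>i \<xi>. (if i = 0 then (- \<sigma>) * h \<xi> > 0 else h \<xi> = 0)"]
    by metis
  have "(- \<sigma>) * h (\<xi> 0) > 0" "\<And>i. 1 \<le> i \<Longrightarrow> i \<le> length ls + M \<Longrightarrow> h (\<xi> i) = 0"
    using \<xi>(2)[of 0] \<xi>(2) by fastforce+
  with Cons.IH[OF h(2) \<xi>(1), of "-\<sigma>"] show ?case by auto
qed

section \<open>Rolle's theorem with a zero at infinity, and interpolation\<close>

lemma rolle_infinity:
  fixes f :: "real \<Rightarrow> real"
  assumes "\<And>t. (f has_real_derivative f' t) (at t)" "(f \<longlongrightarrow> 0) at_top" "f a = 0"
  shows "\<exists>\<xi>>a. f' \<xi> = 0"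
proof (rule ccontr)
  assume nz: "\<not> (\<exists>\<xi>>a. f' \<xi> = 0)"
  have cont: "isCont f t" for t using assms(1) DERIV_isCont by blast
  show False
  proof (cases "f (a + 1) = 0")
    case True
    have "\<exists>z. a < z \<and> z < a + 1 \<and> f' z = 0"
      using MVT2[of a "a + 1" f f'] assms(1,3) True by auto
    then show False using nz by auto
  next
    case False
    obtain B where B: "\<And>t. t \<ge> B \<Longrightarrow> \<bar>f t\<bar> < \<bar>f (a + 1)\<bar>"
      using tendstoD[OF assms(2), of "\<bar>f (a + 1)\<bar>"] False by (auto simp: eventually_at_top_linorder)
    define b where "b = max B (a + 2)"
    have b: "a + 1 < b" "\<bar>f b\<bar> < \<bar>f (a + 1)\<bar>" using B[of b] by (auto simp: b_def)
    \<comment> \<open>Since \<open>f b\<close> is smaller in modulus than \<open>f (a + 1)\<close>,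
      its value is taken between \<open>a\<close> and \<open>a + 1\<close> if the signs agree; if
      they differ, \<open>f\<close> has a second zero beyond \<open>a + 1\<close>, which contradicts
      \<open>nz\<close> by the mean value theorem.\<close>
    have "\<exists>x\<ge>a. x \<le> a + 1 \<and> f x = f b \<or> False"
    proof (cases "f (a+1) > 0")
      case True
      show ?thesis
      proof (cases "f b \<ge> 0")
        case True
        then show ?thesis using IVT[of f a "f b" "a+1"] b cont \<open>f (a+1) > 0\<close> assms(3) by auto
      next
        case False
        then have "\<exists>x\<ge>a+1. x \<le> b \<and> f x = 0" using IVT2[of f b 0 "a+1"] b cont \<open>f (a+1) > 0\<close> by auto
        then obtain x where x: "x \<ge> a+1" "f x = 0" by auto
        have "\<exists>z. a < z \<and> z < x \<and> f' z = 0"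
          using MVT2[of a x f f'] assms(1,3) x by auto
        then show ?thesis using nz by auto
      qed
    next
      case neg: False
      show ?thesis
      proof (cases "f b \<le> 0")
        case True
        then show ?thesis using IVT2[of f "a+1" "f b" a] b cont neg assms(3) by auto
      next
        case False
        then have "\<exists>x\<ge>a+1. x \<le> b \<and> f x = 0" using IVT[of f "a+1" 0 b] b cont neg by auto
        then obtain x where x: "x \<ge> a+1" "f x = 0" by auto
        have "\<exists>z. a < z \<and> z < x \<and> f' z = 0"
          using MVT2[of a x f f'] assms(1,3) x by auto
        then show ?thesis using nz by auto
      qed
    qed
    then obtain x where x: "a \<le> x" "x \<le> a + 1" "f x = f b" by auto
    have "\<exists>z. x < z \<and> z < b \<and> f' z = 0"
      using MVT2[of x b f f'] assms(1) x b by auto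
    then show False using nz x by auto
  qed
qed

text \<open>Differentiation loses no zero here: \<open>N\<close> zeros of \<open>f'\<close> lie
  between those of \<open>f\<close>, and one more lies beyond \<open>t N\<close> because
  \<open>f\<close> decays.\<close>

lemma rolle_zeros_infinity:
  fixes f :: "real \<Rightarrow> real" and t :: "nat \<Rightarrow> real"
  assumes "\<And>t. (f has_real_derivative f' t) (at t)" "(f \<longlongrightarrow> 0) at_top"
    "strict_mono t" "\<And>i. i \<le> N \<Longrightarrow> f (t i) = 0"
  obtains t' where "strict_mono t'" "t 0 < t' 0" "\<And>i. i \<le> N \<Longrightarrow> f' (t' i) = 0"
proof -
  obtain T where T: "T > t N" "f' T = 0" using rolle_infinity[OF assms(1,2), of "t N"] assms(4) by auto
  \<comment> \<open>The tail is moved so that the gap following \<open>t N\<close> contains the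
    extra zero \<open>T\<close>.\<close>
  define s where "s i = (if i \<le> N then t i else T + real (i - N))" for i :: nat
  have s: "strict_mono s"
    unfolding strict_mono_Suc_iff
  proof
    fix i
    consider "i < N" | "i = N" | "i > N" by linarith
    then show "s i < s (Suc i)"
      by cases (use assms(3) T in \<open>auto simp: s_def strict_mono_Suc_iff\<close>)
  qed
  have "\<exists>\<xi>. s i < \<xi> \<and> \<xi> < s (Suc i) \<and> f' \<xi> = 0" if "i \<le> N" for i
  proof (cases "i = N")
    case True
    then show ?thesis using T by (auto simp: s_def intro!: exI[of _ T])
  next
    case False
    then have "f (s i) = 0" "f (s (Suc i)) = 0" "s i < s (Suc i)"
      using that assms(4) s[unfolded strict_mono_Suc_iff, rule_format, of i] by (auto simp: s_def)
    then show ?thesis using MVT2[of "s i" "s (Suc i)" f f'] assms(1) by auto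
  qed
  then obtain \<xi> where "strict_mono \<xi>" "\<And>i. s i < \<xi> i" "\<And>i. i \<le> N \<Longrightarrow> f' (\<xi> i) = 0"
    using strict_mono_between[OF s, of "\<lambda>i. i \<le> N" "\<lambda>i \<xi>. f' \<xi> = 0"] by metis
  moreover have "s 0 = t 0" by (simp add: s_def)
  ultimately show ?thesis using that by metis
qed

text \<open>Newton interpolation: \<open>w\<close> belongs to the enlarged solution space and
  vanishes at the earlier nodes. If it vanished at the new node too, \<open>lde_zeros\<close> would
  produce a zero of \<open>exp (\<mu> * t)\<close>.\<close>

lemma lde_interpolation:
  assumes "strict_mono t"
  shows "\<exists>f. lde ls f (\<lambda>_. 0) \<and> (\<forall>i<length ls. f (t i) = y i)"
proof (induction ls arbitrary: y rule: rev_induct)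
  case Nil
  show ?case by (intro exI[of _ "\<lambda>_. 0"]) auto
next
  case (snoc \<mu> ls)
  obtain p where p: "lde ls p (\<lambda>_. 0)" "\<And>i. i < length ls \<Longrightarrow> p (t i) = y i"
    using snoc.IH by blast
  obtain b where b: "lde ls b (\<lambda>t. exp (\<mu> * t))"
    using lde_exists[of "\<lambda>t. exp (\<mu> * t)"] by (auto intro!: continuous_intros)
  obtain c where c: "lde ls c (\<lambda>_. 0)" "\<And>i. i < length ls \<Longrightarrow> c (t i) = b (t i)"
    using snoc.IH[of "\<lambda>i. b (t i)"] by blast
  define w where "w t = b t - c t" for t
  have w: "lde ls w (\<lambda>t. exp (\<mu> * t))" using lde_diff[OF b c(1)] by (simp add: w_def[abs_def])
  have w0: "w (t i) = 0" if "i < length ls" for i using c(2)[OF that] by (simp add: w_def)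
  have nz: "w (t (length ls)) \<noteq> 0"
    using lde_zeros[OF w assms] w0 by (force simp: order_le_less)
  define \<beta> where "\<beta> = (y (length ls) - p (t (length ls))) / w (t (length ls))"
  have "lde ls (\<lambda>t. p t + \<beta> * w t) (\<lambda>t. \<beta> * exp (\<mu> * t))"
    using lde_linear[OF p(1) w, of 1 \<beta>] by simp
  then have "lde (ls @ [\<mu>]) (\<lambda>t. p t + \<beta> * w t) (\<lambda>_. 0)"
    unfolding lde_snoc_0 by blast
  moreover have "p (t i) + \<beta> * w (t i) = y i" if "i < length (ls @ [\<mu>])" for i
    using that p(2) w0 nz by (cases "i = length ls") (auto simp: \<beta>_def)
  ultimately show ?case by blast
qed

lemma lde_smooth:
  assumes "lde ls f (\<lambda>_. 0)"
  shows "\<And>t. (f has_real_derivative deriv f t) (at t)"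
    "\<And>t. (deriv f has_real_derivative deriv (deriv f) t) (at t)"
    "lde ls (deriv f) (\<lambda>_. 0)" "lde ls (deriv (deriv f)) (\<lambda>_. 0)"
  using lde_deriv2[OF assms, of "\<lambda>_. 0" "\<lambda>_. 0"] by auto

section \<open>Exchange of exponents and comparison of alternating solutions\<close>

lemma exp_crossing:
  fixes a b :: real
  assumes "a * exp (\<nu> * p) < b * exp (\<mu> * p)" "b * exp (\<mu> * z) = a * exp (\<nu> * z)"
    "a > 0" "b > 0" "\<nu> < \<mu>"
  shows "z < p"
proof -
  have "b * exp ((\<mu> - \<nu>) * z) * exp (\<nu> * z) = a * exp (\<nu> * z)"
    using assms(2) by (simp add: mult.assoc left_diff_distrib flip: exp_add)
  then have "b * exp ((\<mu> - \<nu>) * z) = a" by simp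
  moreover have "a * exp (\<nu> * p) < b * exp ((\<mu> - \<nu>) * p) * exp (\<nu> * p)"
    using assms(1) by (simp add: mult.assoc left_diff_distrib flip: exp_add)
  then have "a < b * exp ((\<mu> - \<nu>) * p)" by simp
  ultimately have "exp ((\<mu> - \<nu>) * z) < exp ((\<mu> - \<nu>) * p)"
    using assms(4) by (metis mult_less_cancel_left_pos)
  then show ?thesis using assms(5) by simp
qed

text \<open>The difference \<open>w\<close> of the two interpolants vanishes at all nodes and at infinity, so \<open>w''\<close> has
  enough positive zeros; a positive sign of \<open>w''\<close> at \<open>0\<close> would then force the wrong order of signs on
  the binomial \<open>b * exp (\<kappa> * t) - a * exp (\<nu> * t)\<close> that remains after the Rolle steps.\<close>
lemma exchange_exponent:
  assumes "lde (\<nu> # ls) q (\<lambda>_. 0)" "\<And>\<mu>. \<mu> \<in> set ls \<Longrightarrow> \<mu> < 0" "\<nu> \<le> \<kappa>" "\<kappa> < 0"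
    "strict_mono s" "s 0 = 0" "\<And>i. i \<le> length ls \<Longrightarrow> (-1) ^ i * q (s i) > 0"
  shows "\<exists>g. lde (ls @ [\<kappa>]) g (\<lambda>_. 0) \<and> (\<forall>i \<le> length ls. g (s i) = q (s i)) \<and>
    deriv (deriv g) 0 \<le> deriv (deriv q) 0"
proof (cases "\<nu> = \<kappa>")
  case True
  then show ?thesis using lde_rotate[OF assms(1)] by auto
next
  case False
  then have less: "\<nu> < \<kappa>" using assms by simp
  have q: "lde (ls @ [\<nu>]) q (\<lambda>_. 0)" using lde_rotate assms by blast
  obtain a where a: "lde ls q (\<lambda>t. a * exp (\<nu> * t))" using q unfolding lde_snoc_0 by blast
  obtain g where g: "lde (ls @ [\<kappa>]) g (\<lambda>_. 0)" "\<And>i. i \<le> length ls \<Longrightarrow> g (s i) = q (s i)"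
    using lde_interpolation[OF assms(5), of "ls @ [\<kappa>]" "\<lambda>i. q (s i)"] by (auto simp: less_Suc_eq_le)
  obtain b where b: "lde ls g (\<lambda>t. b * exp (\<kappa> * t))" using g(1) unfolding lde_snoc_0 by blast
  define \<sigma> :: real where "\<sigma> = (-1) ^ length ls"
  have \<sigma>: "\<sigma> * \<sigma> = 1" by (simp add: \<sigma>_def flip: power_add)
  \<comment> \<open>Both interpolants share the alternating node values, so the coefficients
    \<open>a\<close> and \<open>b\<close> have the same sign \<sigma>; this makes the remaining
    binomial a difference of two terms of known sign.\<close>
  obtain x where "0 < (\<sigma> * a) * exp x"
    using lde_alternation[OF a assms(5), of 1] assms(7) by (auto simp: \<sigma>_def mult.assoc)
  then have apos: "\<sigma> * a > 0" by (rule zero_less_mult_pos2) simp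
  obtain x where "0 < (\<sigma> * b) * exp x"
    using lde_alternation[OF b assms(5), of 1] assms(7) g(2) by (auto simp: \<sigma>_def mult.assoc)
  then have bpos: "\<sigma> * b > 0" by (rule zero_less_mult_pos2) simp
  define w where "w t = g t - q t" for t
  have w: "lde ls w (\<lambda>t. b * exp (\<kappa> * t) - a * exp (\<nu> * t))"
    using lde_diff[OF b a] by (simp add: w_def[abs_def])
  have d1: "((\<lambda>t. b * exp (\<kappa> * t) - a * exp (\<nu> * t)) has_real_derivative
      b * \<kappa> * exp (\<kappa> * t) - a * \<nu> * exp (\<nu> * t)) (at t)" for t
    by (intro DERIV_diff DERIV_exp_lin)
  have d2: "((\<lambda>t. b * \<kappa> * exp (\<kappa> * t) - a * \<nu> * exp (\<nu> * t)) has_real_derivative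
      b * \<kappa> * \<kappa> * exp (\<kappa> * t) - a * \<nu> * \<nu> * exp (\<nu> * t)) (at t)" for t
    by (intro DERIV_diff DERIV_exp_lin)
  note w' = lde_deriv2[OF w d1 d2]
  note gs = lde_smooth[OF g(1)] and qs = lde_smooth[OF q]
  have "deriv w = (\<lambda>t. deriv g t - deriv q t)"
    unfolding w_def[abs_def] by (intro ext DERIV_imp_deriv DERIV_diff gs qs)
  then have dd: "deriv (deriv w) 0 = deriv (deriv g) 0 - deriv (deriv q) 0"
    by (simp only:) (intro DERIV_imp_deriv DERIV_diff gs qs)
  have negs: "\<And>\<mu>. \<mu> \<in> set (ls @ [\<kappa>]) \<Longrightarrow> \<mu> < 0" "\<And>\<mu>. \<mu> \<in> set (ls @ [\<nu>]) \<Longrightarrow> \<mu> < 0"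
    using assms(2-4) by auto
  have w0: "(w \<longlongrightarrow> 0) at_top"
    using tendsto_diff[OF lde_tendsto_0[OF g(1) negs(1)] lde_tendsto_0[OF q negs(2)]]
    by (simp add: w_def[abs_def])
  have w'0: "(deriv w \<longlongrightarrow> 0) at_top"
    using tendsto_diff[OF lde_tendsto_0[OF gs(3) negs(1)] lde_tendsto_0[OF qs(3) negs(2)]]
    by (simp add: \<open>deriv w = _\<close>)
  have "w (s i) = 0" if "i \<le> length ls" for i using g(2) that by (simp add: w_def)
  then obtain r where r: "strict_mono r" "s 0 < r 0" "\<And>i. i \<le> length ls \<Longrightarrow> deriv w (r i) = 0"
    using rolle_zeros_infinity[OF w'(1) w0 assms(5), of "length ls"] by metis
  obtain v where v: "strict_mono v" "r 0 < v 0" "\<And>i. i \<le> length ls \<Longrightarrow> deriv (deriv w) (v i) = 0"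
    using rolle_zeros_infinity[OF w'(3) w'0 r(1), of "length ls"] r(3) by metis
  have "deriv (deriv w) 0 \<le> 0"
  proof (rule ccontr)
    assume wpos: "\<not> deriv (deriv w) 0 \<le> 0"
    \<comment> \<open>The factors in \<open>ls\<close> consume \<open>length ls\<close> of the
      \<open>length ls + 1\<close> zeros. With \<open>M = 1\<close>, a sign at \<open>t' 0\<close>
      and a zero to its right at \<open>t' 1\<close> survive, while \<open>exp_crossing\<close> puts
      that zero to the left.\<close>
    define t where "t i = (case i of 0 \<Rightarrow> 0 | Suc j \<Rightarrow> v j)" for i
    have "strict_mono t"
      unfolding strict_mono_Suc_iff t_def using v(1,2) r(2) assms(6)
      by (auto simp: strict_mono_Suc_iff split: nat.split)
    moreover have "deriv (deriv w) (t i) = 0" if "1 \<le> i" "i \<le> length ls + 1" for i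
      using that v(3) by (auto simp: t_def split: nat.split)
    ultimately have "\<exists>t'. strict_mono t' \<and>
      (-1) ^ length ls * 1 * (b * \<kappa> * \<kappa> * exp (\<kappa> * t' 0) - a * \<nu> * \<nu> * exp (\<nu> * t' 0)) > 0 \<and>
      (\<forall>i::nat. 1 \<le> i \<longrightarrow> i \<le> 1 \<longrightarrow> b * \<kappa> * \<kappa> * exp (\<kappa> * t' i) - a * \<nu> * \<nu> * exp (\<nu> * t' i) = 0)"
      using wpos by (intro lde_signed_zeros[OF w'(4), where t = t]) (auto simp: t_def)
    then obtain t' where t': "strict_mono t'"
      "\<sigma> * (b * \<kappa> * \<kappa> * exp (\<kappa> * t' 0) - a * \<nu> * \<nu> * exp (\<nu> * t' 0)) > 0"
      "\<forall>i::nat. 1 \<le> i \<longrightarrow> i \<le> 1 \<longrightarrow> b * \<kappa> * \<kappa> * exp (\<kappa> * t' i) - a * \<nu> * \<nu> * exp (\<nu> * t' i) = 0"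
      unfolding \<sigma>_def mult_1_right by blast
    have sq: "\<kappa> * \<kappa> > 0" "\<nu> * \<nu> > 0" using assms(3,4) by (auto simp: zero_less_mult_iff)
    have "t' 1 < t' 0"
    proof (rule exp_crossing)
      show "(\<sigma> * a) * (\<nu> * \<nu>) * exp (\<nu> * t' 0) < (\<sigma> * b) * (\<kappa> * \<kappa>) * exp (\<kappa> * t' 0)"
        using t'(2) by (simp add: algebra_simps)
      show "(\<sigma> * b) * (\<kappa> * \<kappa>) * exp (\<kappa> * t' 1) = (\<sigma> * a) * (\<nu> * \<nu>) * exp (\<nu> * t' 1)"
        using t'(3)[rule_format, of 1] by (simp add: algebra_simps)
      show "(\<sigma> * a) * (\<nu> * \<nu>) > 0" "(\<sigma> * b) * (\<kappa> * \<kappa>) > 0"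
        using apos bpos sq mult_pos_pos by blast+
    qed (use less in auto)
    moreover have "t' 0 < t' 1" using t'(1) by (simp add: strict_mono_Suc_iff)
    ultimately show False by simp
  qed
  then show ?thesis using g dd by (intro exI[of _ g]) auto
qed

text \<open>All targets lie above the common exponent \<nu>, so every exchange raises an exponent,
  the direction that lowers the second derivative at 0. Node values are kept, hence so is the
  alternation hypothesis for the next exchange.\<close>

lemma exchange_exponents:
  assumes "lde (replicate (length us) \<nu> @ ls) q (\<lambda>_. 0)" "length us + length ls = Suc n"
    "\<And>\<mu>. \<mu> \<in> set ls \<Longrightarrow> \<mu> < 0" "\<And>\<mu>. \<mu> \<in> set us \<Longrightarrow> \<mu> < 0" "\<And>\<mu>. \<mu> \<in> set us \<Longrightarrow> \<nu> \<le> \<mu>"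
    "\<nu> < 0" "strict_mono s" "s 0 = 0" "\<And>i. i \<le> n \<Longrightarrow> (-1) ^ i * q (s i) > 0"
  shows "\<exists>g. lde (ls @ us) g (\<lambda>_. 0) \<and> (\<forall>i \<le> n. g (s i) = q (s i)) \<and>
    deriv (deriv g) 0 \<le> deriv (deriv q) 0"
  using assms
proof (induction us arbitrary: ls q)
  case Nil
  then show ?case by auto
next
  case (Cons \<kappa> us)
  let ?l = "replicate (length us) \<nu> @ ls"
  have len: "length ?l = n" using Cons.prems(2) by simp
  have "\<exists>g. lde (?l @ [\<kappa>]) g (\<lambda>_. 0) \<and> (\<forall>i \<le> length ?l. g (s i) = q (s i)) \<and>
    deriv (deriv g) 0 \<le> deriv (deriv q) 0"
  proof (rule exchange_exponent)
    show "lde (\<nu> # ?l) q (\<lambda>_. 0)" using Cons.prems(1) by simp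
    show "\<mu> < 0" if "\<mu> \<in> set ?l" for \<mu> using that Cons.prems(3,6) by auto
    show "(-1) ^ i * q (s i) > 0" if "i \<le> length ?l" for i
      using that Cons.prems(9) by (simp only: len)
  qed (use Cons.prems in auto)
  then obtain g where g: "lde (?l @ [\<kappa>]) g (\<lambda>_. 0)" "\<And>i. i \<le> n \<Longrightarrow> g (s i) = q (s i)"
    "deriv (deriv g) 0 \<le> deriv (deriv q) 0"
    unfolding len by blast
  have "\<exists>g'. lde ((ls @ [\<kappa>]) @ us) g' (\<lambda>_. 0) \<and> (\<forall>i \<le> n. g' (s i) = g (s i)) \<and>
    deriv (deriv g') 0 \<le> deriv (deriv g) 0"
    using Cons.prems g by (intro Cons.IH) auto
  then show ?case using g(2,3) by fastforce
qed

text \<open>The difference \<open>h\<close> falls from a positive value at 0 to its first zero, and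
  \<open>h'\<close> later returns to 0, so \<open>h''\<close> is positive at some \<open>p2\<close>
  before its zeros \<open>v\<close>. A negative value of \<open>h''\<close> at 0 would put both
  signs in front of the same zeros.\<close>

lemma alternation_comparison:
  assumes "lde us q (\<lambda>_. 0)" "lde us f (\<lambda>_. 0)" "\<And>\<mu>. \<mu> \<in> set us \<Longrightarrow> \<mu> < 0"
    "length us = Suc (Suc N)" "strict_mono s" "s 0 = 0"
    "\<And>i. i \<le> Suc N \<Longrightarrow> \<bar>f (s i)\<bar> < (-1) ^ i * q (s i)"
  shows "deriv (deriv f) 0 \<le> deriv (deriv q) 0"
proof (rule ccontr)
  assume contr: "\<not> ?thesis"
  note fs = lde_smooth[OF assms(2)] and qs = lde_smooth[OF assms(1)]
  define h where "h t = q t - f t" for t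
  have h: "lde us h (\<lambda>_. 0)" using lde_diff[OF assms(1,2)] by (simp add: h_def[abs_def])
  note hs = lde_smooth[OF h]
  have "deriv h = (\<lambda>t. deriv q t - deriv f t)"
    unfolding h_def[abs_def] by (intro ext DERIV_imp_deriv DERIV_diff fs qs)
  then have "deriv (deriv h) 0 = deriv (deriv q) 0 - deriv (deriv f) 0"
    by (simp only:) (intro DERIV_imp_deriv DERIV_diff fs qs)
  then have neg: "deriv (deriv h) 0 < 0" using contr by simp
  have alt: "(-1) ^ i * h (s i) > 0" if "i \<le> Suc N" for i
  proof -
    have "(-1) ^ i * f (s i) \<le> \<bar>f (s i)\<bar>" by (cases "even i") auto
    then show ?thesis using assms(7)[OF that] by (simp add: h_def algebra_simps)
  qed
  have "\<exists>\<xi>. s i < \<xi> \<and> \<xi> < s (Suc i) \<and> h \<xi> = 0" if "i \<le> N" for i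
  proof -
    have cont: "continuous_on {s i..s (Suc i)} h"
      using hs(1) DERIV_isCont continuous_at_imp_continuous_on by blast
    have lt: "s i < s (Suc i)" using assms(5) by (simp add: strict_mono_Suc_iff)
    have nz: "h (s i) \<noteq> 0" "h (s (Suc i)) \<noteq> 0" using alt[of i] alt[of "Suc i"] that by auto
    have "\<exists>\<xi>\<ge>s i. \<xi> \<le> s (Suc i) \<and> h \<xi> = 0"
    proof (cases "even i")
      case True
      then show ?thesis
        using IVT2'[of h "s (Suc i)" 0 "s i"] cont lt alt[of i] alt[of "Suc i"] that by auto
    next
      case False
      then show ?thesis
        using IVT'[of h "s i" 0 "s (Suc i)"] cont lt alt[of i] alt[of "Suc i"] that by auto
    qed
    then obtain \<xi> where "s i \<le> \<xi>" "\<xi> \<le> s (Suc i)" "h \<xi> = 0" by blast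
    moreover from this nz have "\<xi> \<noteq> s i" "\<xi> \<noteq> s (Suc i)" by auto
    ultimately show ?thesis by (intro exI[of _ \<xi>]) auto
  qed
  then obtain z where z: "strict_mono z" "\<And>i. s i < z i" "\<And>i. i \<le> N \<Longrightarrow> h (z i) = 0"
    using strict_mono_between[OF assms(5), of "\<lambda>i. i \<le> N" "\<lambda>i \<xi>. h \<xi> = 0"] by metis
  have z0: "0 < z 0" using z(2)[of 0] assms(6) by simp
  obtain r where r: "strict_mono r" "z 0 < r 0" "\<And>i. i \<le> N \<Longrightarrow> deriv h (r i) = 0"
    using rolle_zeros_infinity[OF hs(1) lde_tendsto_0[OF h assms(3)] z(1), of N] z(3) by auto
  obtain v where v: "strict_mono v" "r 0 < v 0" "\<And>i. i \<le> N \<Longrightarrow> deriv (deriv h) (v i) = 0"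
    using rolle_zeros_infinity[OF hs(2) lde_tendsto_0[OF hs(3) assms(3)] r(1), of N] r(3) by auto
  obtain p1 where p1: "0 < p1" "p1 < z 0" "deriv h p1 < 0"
    using rolle_step_pos[OF z0, of h 0 "deriv h" "-1"] hs(1) alt[of 0] assms(6) z(3)[of 0] by auto
  obtain p2 where p2: "p1 < p2" "p2 < r 0" "deriv (deriv h) p2 > 0"
    using rolle_step_pos[of p1 "r 0" "deriv h" 0 "deriv (deriv h)" 1] hs(2) p1 r by auto
  obtain us' \<kappa> where us: "us = us' @ [\<kappa>]" using assms(4) by (metis length_Suc_conv_rev)
  then have len: "length us' = Suc N" using assms(4) by simp
  have "lde (us' @ [\<kappa>]) (deriv (deriv h)) (\<lambda>_. 0)" using hs(4) us by simp
  then obtain c where c: "lde us' (deriv (deriv h)) (\<lambda>t. c * exp (\<kappa> * t))"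
    unfolding lde_snoc_0 by blast
  \<comment> \<open>Any sign of \<open>h''\<close> to the left of its \<open>N + 1\<close> zeros
    fixes the sign of \<open>c\<close>, because the \<open>N + 1\<close> factors in
    \<open>us'\<close> consume exactly these zeros. Opposite signs at 0 and \<open>p2\<close> are
    therefore incompatible.\<close>
  have *: "(-1) ^ Suc N * \<sigma> * c > 0" if "\<sigma> * deriv (deriv h) p > 0" "p < v 0" for \<sigma> p
  proof -
    define t where "t i = (case i of 0 \<Rightarrow> p | Suc j \<Rightarrow> v j)" for i
    have "strict_mono t"
      unfolding strict_mono_Suc_iff t_def using v(1) that
      by (auto simp: strict_mono_Suc_iff split: nat.split)
    moreover have "deriv (deriv h) (t i) = 0" if "1 \<le> i" "i \<le> length us' + 0" for i
      using that v(3) len by (auto simp: t_def split: nat.split)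
    ultimately have "\<exists>t'. strict_mono t' \<and> (-1) ^ length us' * \<sigma> * (c * exp (\<kappa> * t' 0)) > 0 \<and>
      (\<forall>i::nat. 1 \<le> i \<longrightarrow> i \<le> 0 \<longrightarrow> c * exp (\<kappa> * t' i) = 0)"
      using that by (intro lde_signed_zeros[OF c, where t = t]) (auto simp: t_def)
    then obtain x where "((-1) ^ Suc N * \<sigma> * c) * exp x > 0" unfolding len by (auto simp: mult.assoc)
    then show ?thesis by (rule zero_less_mult_pos2) simp
  qed
  from *[of "-1" 0] neg p2 p1 v(2) r(2) z0 *[of 1 p2] show False by auto
qed

subsection \<open>Hermite functions and a Markov inequality\<close>

lemma lde_poly_exp:
  assumes "degree P < k"
  shows "lde (replicate k \<nu>) (\<lambda>t. poly P (c * t) * exp (\<nu> * t)) (\<lambda>_. 0)"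
proof -
  \<comment> \<open>Each factor differentiates the polynomial and finally reaches 0, whose degree is
    0; the alternative \<open>P = 0\<close> is what the induction has left at
    \<open>k = 0\<close>.\<close>
  have "P = 0 \<or> degree P < k \<Longrightarrow> ?thesis"
  proof (induction k arbitrary: P)
    case 0
    then show ?case by simp
  next
    case (Suc k)
    let ?R = "smult c (pderiv P)"
    have "((\<lambda>t. poly P (c * t) * exp (\<nu> * t)) has_real_derivative
        \<nu> * (poly P (c * t) * exp (\<nu> * t)) + poly ?R (c * t) * exp (\<nu> * t)) (at t)" for t
      by (rule derivative_eq_intros DERIV_chain2[OF poly_DERIV] refl | simp add: algebra_simps)+
    moreover have "?R = 0 \<or> degree ?R < k"
    proof (cases "degree P = 0")
      case True
      then have "pderiv P = 0" by (simp add: pderiv_eq_0_iff)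
      then show ?thesis by simp
    next
      case False
      have "degree ?R \<le> degree P - 1"
        using degree_smult_le[of c "pderiv P"] by (simp add: degree_pderiv)
      with False Suc.prems show ?thesis by auto
    qed
    then have "lde (replicate k \<nu>) (\<lambda>t. poly ?R (c * t) * exp (\<nu> * t)) (\<lambda>_. 0)"
      by (rule Suc.IH)
    ultimately show ?case unfolding replicate_Suc lde.simps(2)
      by (intro exI[of _ "\<lambda>t. poly ?R (c * t) * exp (\<nu> * t)"] conjI allI)
  qed
  with assms show ?thesis by blast
qed

lemma poly_exp_tendsto_0:
  assumes "(c::real) > 0"
  shows "((\<lambda>t. poly P t * exp (- c * t)) \<longlongrightarrow> 0) at_top"
proof -
  have "lde (replicate (Suc (degree P)) (- c)) (\<lambda>t. poly P (1 * t) * exp (- c * t)) (\<lambda>_. 0)"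
    by (rule lde_poly_exp) simp
  then have "((\<lambda>t. poly P (1 * t) * exp (- c * t)) \<longlongrightarrow> 0) at_top"
    by (rule lde_tendsto_0) (use assms in \<open>auto simp: in_set_replicate\<close>)
  then show ?thesis by simp
qed

text \<open>In the variable \<open>y\<close> with \<open>x = y\<^sup>2 / 2\<close>, such a polynomial is the Hermite polynomial
  \<open>H\<^bsub>2n\<^esub>(y)\<close> up to a factor, and \<open>P x * exp (- x)\<close> is the corresponding Hermite function.\<close>
definition hermite_like :: "nat \<Rightarrow> real poly \<Rightarrow> bool" where
  "hermite_like n P \<longleftrightarrow> degree P \<le> n \<and> poly P 0 = 1 \<and>
    [:0, 2:] * pderiv (pderiv P) + [:1, -4:] * pderiv P + smult (4 * real n) P = 0"

text \<open>Two raising steps \<open>H_(m+1) = 2 y H_m - H_m'\<close> at once, from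
  \<open>m = 2 n\<close>, with the second derivative removed by the Hermite equation, written in
  \<open>x = y^2 / 2\<close> and renormalised to value 1 at 0.\<close>

definition hermite_step :: "nat \<Rightarrow> real poly \<Rightarrow> real poly" where
  "hermite_step n P =
    smult (1 / (4 * real n + 2)) ([:0, 4:] * pderiv P + [:4 * real n + 2, -8:] * P)"

lemma hermite_like_ode:
  assumes "hermite_like n P"
  shows "2 * x * poly (pderiv (pderiv P)) x =
    (4 * x - 1) * poly (pderiv P) x - 4 * real n * poly P x"
proof -
  have "poly ([:0, 2:] * pderiv (pderiv P) + [:1, -4:] * pderiv P + smult (4 * real n) P) x = 0"
    using assms by (simp only: hermite_like_def poly_0)
  then show ?thesis by (simp add: algebra_simps)
qed

lemma hermite_like_at_0:
  assumes "hermite_like n P"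
  shows "poly P 0 = 1" "poly (pderiv P) 0 = - 4 * real n"
    "poly (pderiv (pderiv P)) 0 = 16 * real n * (real n - 1) / 3"
proof -
  show 1: "poly P 0 = 1" using assms by (simp add: hermite_like_def)
  show 2: "poly (pderiv P) 0 = - 4 * real n" using hermite_like_ode[OF assms, of 0] 1 by simp
  \<comment> \<open>The equation is singular at 0, where the factor of the second derivative
    vanishes; it has to be differentiated once to yield that derivative.\<close>
  have "pderiv ([:0, 2:] * pderiv (pderiv P) + [:1, -4:] * pderiv P + smult (4 * real n) P) = 0"
    using assms by (simp only: hermite_like_def pderiv_0)
  then have "poly (pderiv ([:0, 2:] * pderiv (pderiv P) + [:1, -4:] * pderiv P + smult (4 * real n) P)) 0 = 0"
    by simp
  then show "poly (pderiv (pderiv P)) 0 = 16 * real n * (real n - 1) / 3"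
    using 2 by (simp add: pderiv_mult pderiv_add pderiv_smult pderiv_pCons algebra_simps)
qed

lemma hermite_like_step:
  assumes "hermite_like n P"
  shows "hermite_like (Suc n) (hermite_step n P)"
proof -
  let ?Q = "hermite_step n P"
  define c where "c = 1 / (4 * real n + 2)"
  have Q: "?Q = smult c ([:0, 4:] * pderiv P + [:4 * real n + 2, -8:] * P)"
    by (simp add: hermite_step_def c_def)
  have "degree ([:0, 4:] * pderiv P) \<le> Suc n"
  proof (cases "pderiv P = 0")
    case False
    then have "degree P \<noteq> 0" by (simp add: pderiv_eq_0_iff)
    moreover have "degree P \<le> n" using assms by (simp add: hermite_like_def)
    ultimately show ?thesis
      using False by (subst degree_mult_eq) (auto simp: degree_pderiv)
  qed simp
  moreover have "degree ([:4 * real n + 2, -8:] * P) \<le> Suc n"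
    using degree_mult_le[of "[:4 * real n + 2, -8:]" P] assms by (simp add: hermite_like_def)
  ultimately have deg: "degree ?Q \<le> Suc n"
    unfolding Q by (intro degree_smult_le[THEN order_trans] degree_add_le)
  have 0: "poly ?Q 0 = 1" using assms by (simp add: hermite_step_def hermite_like_def add_nonneg_eq_0_iff)
  note ode = hermite_like_ode[OF assms]
  \<comment> \<open>By the equation for \<open>P\<close>, the derivative of \<open>Q\<close> is
    again of first order in \<open>P\<close>, which reduces the equation for \<open>Q\<close> to
    that for \<open>P\<close>.\<close>
  have Q': "pderiv ?Q = smult (c * 4 * (real n + 1)) (pderiv P - smult 2 P)"
  proof (rule poly_ext)
    fix x
    have "poly (pderiv ?Q) x = c * (2 * (2 * x * poly (pderiv (pderiv P)) x) + 4 * poly (pderiv P) x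
        + (4 * real n + 2 - 8 * x) * poly (pderiv P) x - 8 * poly P x)"
      by (simp add: Q pderiv_mult pderiv_add pderiv_smult pderiv_minus pderiv_pCons algebra_simps)
    also have "\<dots> = poly (smult (c * 4 * (real n + 1)) (pderiv P - smult 2 P)) x"
      unfolding ode by (simp add: algebra_simps)
    finally show "poly (pderiv ?Q) x = \<dots>" .
  qed
  have "[:0, 2:] * pderiv (pderiv ?Q) + [:1, -4:] * pderiv ?Q + smult (4 * real (Suc n)) ?Q = 0"
  proof (rule poly_ext)
    fix x
    have "poly ([:0, 2:] * pderiv (pderiv ?Q) + [:1, -4:] * pderiv ?Q + smult (4 * real (Suc n)) ?Q) x
      = c * 4 * (real n + 1) * ((2 * x * poly (pderiv (pderiv P)) x) - 4 * x * poly (pderiv P) x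
        + (1 - 4 * x) * (poly (pderiv P) x - 2 * poly P x)
        + 4 * x * poly (pderiv P) x + (4 * real n + 2 - 8 * x) * poly P x)"
      unfolding Q' by (simp add: Q pderiv_diff pderiv_smult algebra_simps)
    also have "\<dots> = poly 0 x" unfolding ode by (simp add: algebra_simps)
    finally show "poly ([:0, 2:] * pderiv (pderiv ?Q) + [:1, -4:] * pderiv ?Q + smult (4 * real (Suc n)) ?Q) x = poly 0 x" .
  qed
  then show ?thesis using deg 0 unfolding hermite_like_def by blast
qed

text \<open>The derivative of \<open>x powr (n + 1/2) * exp (- 2 * x) * P x\<close> is a positive multiple of the next
  polynomial, so that each step gains one sign change.\<close>
lemma hermite_step_sign:
  assumes "0 \<le> a" "a < b"
    and less: "\<sigma> * (sqrt a * (a ^ n * (poly P a * exp (- 2 * a)))) < \<sigma> * (sqrt b * (b ^ n * (poly P b * exp (- 2 * b))))"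
  shows "\<exists>\<xi>. a < \<xi> \<and> \<xi> < b \<and> \<sigma> * poly (hermite_step n P) \<xi> > 0"
proof -
  define f where "f x = sqrt x * (x ^ n * (poly P x * exp (- 2 * x)))" for x
  have der: "(f has_real_derivative
      (x ^ n * exp (- 2 * x) / sqrt x * ((2 * real n + 1) / 2)) * poly (hermite_step n P) x) (at x)" if "x > 0" for x
  proof -
    have xn: "real n * x ^ (n - 1) * x = real n * x ^ n" by (cases n) auto
    have sq: "sqrt x \<noteq> 0" "x = sqrt x * sqrt x" using that by auto
    have D: "(f has_real_derivative
      inverse (sqrt x) / 2 * (x ^ n * (poly P x * exp (- 2 * x)))
      + sqrt x * (real n * x ^ (n - 1) * (poly P x * exp (- 2 * x))
      + x ^ n * (poly (pderiv P) x * exp (- 2 * x) + poly P x * (exp (- 2 * x) * (- 2))))) (at x)"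
    proof -
      have "((\<lambda>x. x ^ n * (poly P x * exp (- 2 * x))) has_real_derivative
        real n * x ^ (n - 1) * (poly P x * exp (- 2 * x))
        + x ^ n * (poly (pderiv P) x * exp (- 2 * x) + poly P x * (exp (- 2 * x) * (- 2)))) (at x)"
        by (rule derivative_eq_intros poly_DERIV refl | simp add: algebra_simps)+
      from DERIV_mult[OF DERIV_real_sqrt[OF that] this] show ?thesis
        by (simp only: f_def[abs_def] mult.commute)
    qed
    have A1: "inverse (sqrt x) / 2 * (x ^ n * (poly P x * exp (- 2 * x)))
      + sqrt x * (real n * x ^ (n - 1) * (poly P x * exp (- 2 * x))
      + x ^ n * (poly (pderiv P) x * exp (- 2 * x) + poly P x * (exp (- 2 * x) * (- 2))))
      = (exp (- 2 * x) / sqrt x) * (x ^ n * poly P x / 2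
      + (sqrt x * sqrt x) * (real n * x ^ (n - 1) * poly P x
      + x ^ n * (poly (pderiv P) x - 2 * poly P x)))"
    proof -
      have "inverse S / 2 * (X * (y * e)) + S * (k * Y * (y * e) + X * (y1 * e + y * (e * (- 2))))
        = (e / S) * (X * y / 2 + (S * S) * (k * Y * y + X * (y1 - 2 * y)))"
        if "S \<noteq> 0" for S X y e k Y y1 :: real
        using that by (simp add: field_simps)
      then show ?thesis using sq(1) by blast
    qed
    have A2: "(x ^ n * poly P x / 2
      + (sqrt x * sqrt x) * (real n * x ^ (n - 1) * poly P x + x ^ n * (poly (pderiv P) x - 2 * poly P x)))
      = x ^ n * poly P x / 2
      + (real n * x ^ (n - 1) * x) * poly P x + x * x ^ n * (poly (pderiv P) x - 2 * poly P x)"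
      using that by (simp add: algebra_simps)
    have A3: "\<dots> = x ^ n * (((2 * real n + 1) / 2 - 2 * x) * poly P x + x * poly (pderiv P) x)"
      unfolding xn by (simp add: field_simps)
    have A4: "\<dots> = x ^ n * (((2 * real n + 1) / 2) * poly (hermite_step n P) x)"
    proof -
      have "(4 * real n + 2) * poly (hermite_step n P) x = 4 * x * poly (pderiv P) x + (4 * real n + 2 - 8 * x) * poly P x"
        by (simp add: hermite_step_def field_simps add_nonneg_eq_0_iff)
      moreover have "(2 * real n + 1) / 2 * poly (hermite_step n P) x = (4 * real n + 2) * poly (hermite_step n P) x / 4"
        by (simp add: field_simps)
      ultimately show ?thesis by (simp only:) (simp add: field_simps)
    qed
    show ?thesis using D unfolding A1 A2 A3 A4 by (simp add: mult_ac)
  qed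
  have "\<exists>z>a. z < b \<and> f b - f a = (b - a) * ((z ^ n * exp (- 2 * z) / sqrt z * ((2 * real n + 1) / 2)) * poly (hermite_step n P) z)"
  proof -
    \<comment> \<open>The left end may be 0, where \<open>sqrt\<close> is continuous but not
      differentiable, so the mean value theorem is used with differentiability in the open interval
      only.\<close>
    have "continuous_on {a..b} f" unfolding f_def by (intro continuous_intros)
    then have "\<exists>l z. a < z \<and> z < b \<and> DERIV f z :> l \<and> f b - f a = (b - a) * l"
      using der assms(1) by (intro MVT[OF assms(2)]) (auto simp: real_differentiable_def intro: order_le_less_trans)
    then obtain l z where z: "a < z" "z < b" "DERIV f z :> l" "f b - f a = (b - a) * l" by blast
    then have "z > 0" using assms(1) by simp
    from DERIV_unique[OF z(3) der[OF this]] z show ?thesis by blast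
  qed
  then obtain z where z: "z > a" "z < b"
    "f b - f a = (b - a) * ((z ^ n * exp (- 2 * z) / sqrt z * ((2 * real n + 1) / 2)) * poly (hermite_step n P) z)" by blast
  define K where "K = (b - a) * (z ^ n * exp (- 2 * z) / sqrt z * ((2 * real n + 1) / 2))"
  have "K > 0" unfolding K_def using z(1) assms(1,2) by (intro mult_pos_pos divide_pos_pos) auto
  moreover have "\<sigma> * f b - \<sigma> * f a = K * (\<sigma> * poly (hermite_step n P) z)"
    using z(3) by (simp add: K_def algebra_simps)
  moreover have "\<sigma> * f b - \<sigma> * f a > 0" using less by (simp add: f_def)
  ultimately have "\<sigma> * poly (hermite_step n P) z > 0" by (simp add: zero_less_mult_iff)
  with z show ?thesis by blast
qed

lemma tendsto_0_less:
  fixes f :: "real \<Rightarrow> real"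
  assumes "(f \<longlongrightarrow> 0) at_top" "e > 0"
  obtains B where "B \<ge> A" "\<bar>f B\<bar> < e"
proof -
  obtain B where B: "\<And>t. t \<ge> B \<Longrightarrow> \<bar>f t\<bar> < e"
    using tendstoD[OF assms] by (auto simp: eventually_at_top_linorder)
  then show ?thesis using that[of "max A B"] by auto
qed

lemma strict_mono_extend:
  fixes t :: "nat \<Rightarrow> real"
  assumes "strict_mono t" "\<And>i. i < N \<Longrightarrow> t i < B"
  shows "strict_mono (\<lambda>i. if i < N then t i else B + real (i - N))"
  unfolding strict_mono_Suc_iff
proof
  fix i
  consider "Suc i < N" | "Suc i = N" | "i \<ge> N" by linarith
  then show "(if i < N then t i else B + real (i - N)) < (if Suc i < N then t (Suc i) else B + real (Suc i - N))"
    by cases (use assms in \<open>auto simp: strict_mono_Suc_iff\<close>)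
qed

text \<open>The weighted function \<open>f\<close> vanishes at 0, alternates at \<open>n + 1\<close>
  points and is small at some far \<open>B\<close>. This gives \<open>n + 2\<close> increments of
  alternating sign, each of which \<open>hermite_step_sign\<close> turns into a sign of the next
  polynomial.\<close>

lemma hermite_alternation:
  "\<exists>P p. hermite_like n P \<and> strict_mono p \<and> p 0 > 0 \<and> (\<forall>i\<le>n. (-1) ^ i * poly P (p i) > 0)"
proof (induction n)
  case 0
  show ?case
    by (intro exI[of _ 1] exI[of _ "\<lambda>i. real i + 1"]) (auto simp: hermite_like_def strict_mono_def)
next
  case (Suc n)
  then obtain P p where P: "hermite_like n P" and p: "strict_mono p" "p 0 > 0"
    "\<And>i. i \<le> n \<Longrightarrow> (-1) ^ i * poly P (p i) > 0" by blast
  define f where "f x = sqrt x * (x ^ n * (poly P x * exp (- 2 * x)))" for x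
  have ppos: "p i > 0" for i using p(1,2) strict_mono_less_eq[OF p(1), of 0 i] by simp
  have fp: "(-1) ^ i * f (p i) > 0" if "i \<le> n" for i
  proof -
    have "(-1) ^ i * f (p i) = sqrt (p i) * p i ^ n * exp (- 2 * p i) * ((-1) ^ i * poly P (p i))"
      by (simp add: f_def)
    also have "\<dots> > 0" using ppos[of i] by (intro mult_pos_pos[OF _ p(3)[OF that]]) auto
    finally show ?thesis .
  qed
  have "f (p n) \<noteq> 0" using fp[of n] by auto
  \<comment> \<open>For \<open>B \<ge> 1\<close> the factor \<open>sqrt B\<close> is at most
    \<open>B\<close>, so a polynomial times an exponential majorises \<open>f\<close>.\<close>
  have lim: "((\<lambda>t. poly (monom 1 (Suc n) * P) t * exp (- 2 * t)) \<longlongrightarrow> 0) at_top"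
    by (rule poly_exp_tendsto_0) simp
  obtain B where B: "B \<ge> max 1 (p n + 1)"
    "\<bar>poly (monom 1 (Suc n) * P) B * exp (- 2 * B)\<bar> < \<bar>f (p n)\<bar>"
    using tendsto_0_less[OF lim, of "\<bar>f (p n)\<bar>" "max 1 (p n + 1)"] \<open>f (p n) \<noteq> 0\<close> by auto
  have "\<bar>f B\<bar> = sqrt B * (B ^ n * \<bar>poly P B\<bar> * exp (- 2 * B))"
    using B(1) by (simp add: f_def abs_mult)
  also have "\<dots> \<le> B * (B ^ n * \<bar>poly P B\<bar> * exp (- 2 * B))"
    using B(1) by (intro mult_right_mono real_le_lsqrt) (auto simp: power2_eq_square)
  also have "\<dots> = \<bar>poly (monom 1 (Suc n) * P) B * exp (- 2 * B)\<bar>"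
    using B(1) by (simp add: abs_mult poly_monom)
  finally have fB: "\<bar>f B\<bar> < \<bar>f (p n)\<bar>" using B(2) by simp
  define t' where "t' i = (case i of 0 \<Rightarrow> 0 | Suc j \<Rightarrow> p j)" for i
  have t': "strict_mono t'" unfolding strict_mono_Suc_iff t'_def using p(1,2)
    by (auto simp: strict_mono_Suc_iff split: nat.split)
  define t where "t i = (if i < Suc (Suc n) then t' i else B + real (i - Suc (Suc n)))" for i
  have "t' i < B" if "i < Suc (Suc n)" for i
    using strict_mono_less_eq[OF t', of i "Suc n"] that B(1) by (simp add: t'_def)
  then have t: "strict_mono t" unfolding t_def[abs_def] by (rule strict_mono_extend[OF t'])
  have "\<exists>\<xi>. t i < \<xi> \<and> \<xi> < t (Suc i) \<and> (-1) ^ i * poly (hermite_step n P) \<xi> > 0" if "i \<le> Suc n" for i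
  proof -
    have lt: "t i < t (Suc i)" using t by (simp add: strict_mono_Suc_iff)
    have nn: "t i \<ge> 0" using strict_mono_less_eq[OF t, of 0 i] by (simp add: t_def t'_def)
    have "(-1) ^ i * f (t i) < (-1) ^ i * f (t (Suc i))"
    proof (cases i)
      case 0
      then show ?thesis using fp[of 0] by (simp add: t_def t'_def f_def)
    next
      case (Suc j)
      show ?thesis
      proof (cases "i = Suc n")
        case True
        have *: "(-1) ^ Suc n * f (p n) = - \<bar>f (p n)\<bar>" using fp[of n] by (cases "even n") auto
        have "- \<bar>f B\<bar> \<le> (-1) ^ Suc n * f B" by (cases "even n") auto
        then have "(-1) ^ Suc n * f (p n) < (-1) ^ Suc n * f B" unfolding * using fB by linarith
        then show ?thesis by (simp add: t_def t'_def True)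
      next
        case False
        then show ?thesis using fp[of j] fp[of "Suc j"] that by (simp add: t_def t'_def Suc)
      qed
    qed
    then show ?thesis using hermite_step_sign[OF nn lt] by (simp add: f_def)
  qed
  then obtain \<xi> where \<xi>: "strict_mono \<xi>" "\<And>i. t i < \<xi> i"
    "\<And>i. i \<le> Suc n \<Longrightarrow> (-1) ^ i * poly (hermite_step n P) (\<xi> i) > 0"
    using strict_mono_between[OF t, of "\<lambda>i. i \<le> Suc n" "\<lambda>i \<xi>. (-1) ^ i * poly (hermite_step n P) \<xi> > 0"]
    by metis
  moreover have "\<xi> 0 > 0" using \<xi>(2)[of 0] by (simp add: t_def t'_def)
  ultimately show ?case using hermite_like_step[OF P] by blast
qed

section \<open>Extrema of the Hermite function\<close>

lemma interior_max:
  fixes u :: "real \<Rightarrow> real"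
  assumes "\<And>x. (u has_real_derivative u1 x) (at x)" "a < p" "p < b" "\<sigma> * u a < \<sigma> * u p" "\<sigma> * u b < \<sigma> * u p" "\<sigma> \<noteq> 0"
  shows "\<exists>\<xi>. a < \<xi> \<and> \<xi> < b \<and> u1 \<xi> = 0 \<and> \<sigma> * u p \<le> \<sigma> * u \<xi>"
proof -
  have "continuous_on {a..b} (\<lambda>x. \<sigma> * u x)"
    by (intro continuous_intros continuous_at_imp_continuous_on ballI DERIV_isCont[OF assms(1)])
  then obtain \<xi> where \<xi>: "\<xi> \<in> {a..b}" "\<And>x. x \<in> {a..b} \<Longrightarrow> \<sigma> * u x \<le> \<sigma> * u \<xi>"
    using continuous_attains_sup[of "{a..b}" "\<lambda>x. \<sigma> * u x"] assms(2,3) by auto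
  have ge: "\<sigma> * u p \<le> \<sigma> * u \<xi>" using \<xi>(2)[of p] assms(2,3) by auto
  then have "\<xi> \<noteq> a" "\<xi> \<noteq> b" using assms(4,5) by auto
  then have in': "a < \<xi>" "\<xi> < b" using \<xi>(1) by auto
  have der: "((\<lambda>x. \<sigma> * u x) has_real_derivative \<sigma> * u1 \<xi>) (at \<xi>)"
    by (intro DERIV_cmult assms(1))
  have max: "\<forall>y. \<bar>\<xi> - y\<bar> < min (\<xi> - a) (b - \<xi>) \<longrightarrow> \<sigma> * u y \<le> \<sigma> * u \<xi>"
    by (intro allI impI \<xi>(2)) (auto simp: abs_if split: if_splits)
  have "\<sigma> * u1 \<xi> = 0"
    using DERIV_local_max[OF der _ max] in' by simp
  then show ?thesis using in' ge assms(6) by auto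
qed

text \<open>At a critical point both Sonin type functions \<open>2xu'\<^sup>2 - (2x - m)u\<^sup>2\<close> (decreasing) and
  \<open>u\<^sup>2 + 2xu'\<^sup>2 / (m - 2x)\<close> (increasing on the left of \<open>m / 2\<close>) reduce to multiples of \<open>u\<^sup>2\<close>.\<close>
lemma critical_value_ge_1:
  fixes u u1 u2 :: "real \<Rightarrow> real"
  assumes u: "\<And>x. (u has_real_derivative u1 x) (at x)" and u1: "\<And>x. (u1 has_real_derivative u2 x) (at x)"
    and ode: "\<And>x. 2 * x * u2 x = (2 * x - m) * u x - u1 x"
    and lim: "((\<lambda>x. 2 * x * (u1 x)\<^sup>2 - (2 * x - m) * (u x)\<^sup>2) \<longlongrightarrow> 0) at_top"
    and "u 0 = 1" "s > 0" "u1 s = 0" "u s \<noteq> 0"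
  shows "\<bar>u s\<bar> \<ge> 1"
proof -
  define S where "S x = 2 * x * (u1 x)\<^sup>2 - (2 * x - m) * (u x)\<^sup>2" for x
  have S: "(S has_real_derivative - 2 * (u x)\<^sup>2) (at x)" for x
  proof -
    have "(S has_real_derivative 2 * (u1 x)\<^sup>2 + 2 * u1 x * (2 * x * u2 x) - 2 * (u x)\<^sup>2 - 2 * (2 * x - m) * u x * u1 x) (at x)"
      unfolding S_def by (rule derivative_eq_intros u u1 refl | simp add: algebra_simps power2_eq_square)+
    then show ?thesis unfolding ode by (simp add: algebra_simps power2_eq_square)
  qed
  have s: "2 * s < m"
  proof (rule ccontr)
    assume "\<not> ?thesis"
    then have "S s \<le> 0" using \<open>u1 s = 0\<close> by (simp add: S_def)
    \<comment> \<open>\<open>S\<close> decreases strictly just after \<open>s\<close> because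
      \<open>u s\<close> is nonzero. It then stays below a negative value, against its limit
      0.\<close>
    have "- 2 * (u s)\<^sup>2 < 0" using \<open>u s \<noteq> 0\<close> by simp
    from DERIV_neg_dec_right[OF S this] obtain d where d: "d > 0" "\<And>h. 0 < h \<Longrightarrow> h < d \<Longrightarrow> S (s + h) < S s" by blast
    define s' where "s' = s + d / 2"
    have "S s' < 0" using d(2)[of "d / 2"] d(1) \<open>S s \<le> 0\<close> by (simp add: s'_def)
    have "S x \<le> S s'" if "x \<ge> s'" for x
      using DERIV_nonpos_imp_nonincreasing[OF that, of S] S by (meson mult_nonpos_nonneg zero_le_power2 neg_le_0_iff_le zero_le_numeral)
    then have "0 \<le> S s'"
      using lim unfolding S_def[symmetric]
      by (intro tendsto_upperbound[of S 0 at_top]) (auto simp: eventually_at_top_linorder)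
    then show False using \<open>S s' < 0\<close> by simp
  qed
  define E where "E x = (u x)\<^sup>2 + 2 * x * (u1 x)\<^sup>2 / (m - 2 * x)" for x
  have "E 0 \<le> E s"
  proof (rule DERIV_nonneg_imp_nondecreasing[of 0 s E])
    fix x assume x: "0 \<le> x" "x \<le> s"
    then have nz: "m - 2 * x > 0" using s by simp
    have "(E has_real_derivative 2 * u x * u1 x + ((2 * (u1 x)\<^sup>2 + 2 * u1 x * (2 * x * u2 x)) * (m - 2 * x)
        + 4 * x * (u1 x)\<^sup>2) / (m - 2 * x)\<^sup>2) (at x)"
      unfolding E_def
      by (rule derivative_eq_intros u u1 refl | use nz in \<open>simp add: algebra_simps power2_eq_square\<close>)+
    moreover have "2 * u x * u1 x + ((2 * (u1 x)\<^sup>2 + 2 * u1 x * (2 * x * u2 x)) * (m - 2 * x)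
        + 4 * x * (u1 x)\<^sup>2) / (m - 2 * x)\<^sup>2 = 4 * x * (u1 x)\<^sup>2 / (m - 2 * x)\<^sup>2"
    proof -
      have *: "2 * (u1 x)\<^sup>2 + 2 * u1 x * ((2 * x - m) * u x - u1 x) = (- 2 * u x * u1 x) * (m - 2 * x)"
        by (simp add: algebra_simps power2_eq_square)
      have "a + ((- a) * w * w + c) / w\<^sup>2 = c / w\<^sup>2" if "w \<noteq> 0" for a c w :: real
        using that by (simp add: power2_eq_square field_simps)
      from this[of "m - 2 * x" "2 * u x * u1 x"] show ?thesis unfolding ode * using nz by simp
    qed
    ultimately show "\<exists>y. (E has_real_derivative y) (at x) \<and> 0 \<le> y"
      using x by (intro exI[of _ "4 * x * (u1 x)\<^sup>2 / (m - 2 * x)\<^sup>2"]) auto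
  qed (use \<open>s > 0\<close> in simp)
  then have "1 \<le> (u s)\<^sup>2" using \<open>u 0 = 1\<close> \<open>u1 s = 0\<close> by (simp add: E_def)
  then show ?thesis by (simp add: abs_le_square_iff[of 1, simplified])
qed

text \<open>The alternation points enclose \<open>n\<close> zeros of \<open>u\<close>. After each
  zero there is an extremum of the right sign, of modulus at least one by
  \<open>critical_value_ge_1\<close>; together with the value 1 at 0 this makes \<open>n + 1\<close>
  alternating points.\<close>

lemma hermite_snake:
  "\<exists>P s. hermite_like n P \<and> strict_mono s \<and> s 0 = 0 \<and>
    (\<forall>i\<le>n. (-1) ^ i * (poly P (s i) * exp (- s i)) \<ge> 1)"
proof -
  obtain P p where P: "hermite_like n P" and p: "strict_mono p" "p 0 > 0"
    "\<And>i. i \<le> n \<Longrightarrow> (-1) ^ i * poly P (p i) > 0" using hermite_alternation by blast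
  define u where "u x = poly P x * exp (- x)" for x
  define u1 where "u1 x = poly (pderiv P - P) x * exp (- x)" for x
  define u2 where "u2 x = poly (pderiv (pderiv P) - smult 2 (pderiv P) + P) x * exp (- x)" for x
  have u: "(u has_real_derivative u1 x) (at x)" for x
    unfolding u_def u1_def by (rule derivative_eq_intros poly_DERIV refl | simp add: algebra_simps)+
  have u1: "(u1 has_real_derivative u2 x) (at x)" for x
    unfolding u1_def u2_def
    by (rule derivative_eq_intros poly_DERIV refl | simp add: algebra_simps pderiv_diff)+
  \<comment> \<open>In the variable \<open>y\<close> with \<open>x = y^2 / 2\<close> this is the
    equation \<open>d^2 u / dy^2 = (y^2 - (4 n + 1)) u\<close> of the Hermite function, whence
    \<open>m = 4 n + 1\<close>.\<close>
  have ode: "2 * x * u2 x = (2 * x - (4 * real n + 1)) * u x - u1 x" for x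
  proof -
    have "2 * x * u2 x = (2 * x * poly (pderiv (pderiv P)) x - 4 * x * poly (pderiv P) x + 2 * x * poly P x) * exp (- x)"
      by (simp add: u2_def algebra_simps)
    then show ?thesis unfolding hermite_like_ode[OF P] by (simp add: u_def u1_def algebra_simps)
  qed
  have lim: "((\<lambda>x. 2 * x * (u1 x)\<^sup>2 - (2 * x - (4 * real n + 1)) * (u x)\<^sup>2) \<longlongrightarrow> 0) at_top"
  proof -
    have "2 * x * (u1 x)\<^sup>2 - (2 * x - (4 * real n + 1)) * (u x)\<^sup>2 =
      poly ([:0, 2:] * (pderiv P - P)\<^sup>2 - [:- (4 * real n + 1), 2:] * P\<^sup>2) x * exp (- 2 * x)" for x
    proof -
      have "exp (- 2 * x) = (exp (- x))\<^sup>2" by (simp add: power2_eq_square flip: exp_add)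
      moreover have "2 * x * (a * e)\<^sup>2 - k * (b * e)\<^sup>2 = (2 * x * a\<^sup>2 - k * b\<^sup>2) * e\<^sup>2" for a b e k
        by (simp add: power_mult_distrib algebra_simps)
      ultimately show ?thesis by (simp add: u_def u1_def mult.commute[of x 2]) (simp add: algebra_simps)
    qed
    then show ?thesis by (simp only:) (rule poly_exp_tendsto_0, simp)
  qed
  have u0: "u 0 = 1" using hermite_like_at_0(1)[OF P] by (simp add: u_def)
  have ulim: "(u \<longlongrightarrow> 0) at_top" using poly_exp_tendsto_0[of 1 P] by (simp add: u_def[abs_def])
  have up: "(-1) ^ i * u (p i) > 0" if "i \<le> n" for i
    using mult_pos_pos[OF p(3)[OF that] exp_gt_zero[of "- p i"]] by (simp add: u_def mult.assoc)
  have "\<exists>\<xi>. p i < \<xi> \<and> \<xi> < p (Suc i) \<and> u \<xi> = 0" if "i < n" for i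
  proof -
    have cont: "continuous_on {p i..p (Suc i)} u"
      using u DERIV_isCont continuous_at_imp_continuous_on by blast
    have lt: "p i < p (Suc i)" using p(1) by (simp add: strict_mono_Suc_iff)
    have nz: "u (p i) \<noteq> 0" "u (p (Suc i)) \<noteq> 0" using up[of i] up[of "Suc i"] that by auto
    have "\<exists>\<xi>\<ge>p i. \<xi> \<le> p (Suc i) \<and> u \<xi> = 0"
    proof (cases "even i")
      case True
      then show ?thesis
        using IVT2'[of u "p (Suc i)" 0 "p i"] cont lt up[of i] up[of "Suc i"] that by auto
    next
      case False
      then show ?thesis
        using IVT'[of u "p i" 0 "p (Suc i)"] cont lt up[of i] up[of "Suc i"] that by auto
    qed
    then obtain \<xi> where "p i \<le> \<xi>" "\<xi> \<le> p (Suc i)" "u \<xi> = 0" by blast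
    moreover from this nz have "\<xi> \<noteq> p i" "\<xi> \<noteq> p (Suc i)" by auto
    ultimately show ?thesis by (intro exI[of _ \<xi>]) auto
  qed
  then obtain z' where z': "strict_mono z'" "\<And>i. p i < z' i" "\<And>i. z' i < p (Suc i)" "\<And>i. i < n \<Longrightarrow> u (z' i) = 0"
    using strict_mono_between[OF p(1), of "\<lambda>i. i < n" "\<lambda>i \<xi>. u \<xi> = 0"] by metis
  obtain B where B: "B \<ge> p (Suc n)" "\<bar>u B\<bar> < \<bar>u (p n)\<bar>"
  proof -
    have "\<bar>u (p n)\<bar> > 0" using up[of n] by auto
    from tendsto_0_less[OF ulim this] show ?thesis using that by blast
  qed
  \<comment> \<open>\<open>z n = B\<close> stands in for a zero beyond the last one: there
    \<open>u\<close> is smaller in modulus than at \<open>p n\<close>, which is enough for an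
    interior extremum.\<close>
  define z where "z i = (if i < n then z' i else B + real (i - n))" for i
  have "z' i < B" if "i < n" for i
    using z'(3)[of i] strict_mono_less_eq[OF p(1), of "Suc i" "Suc n"] that B(1) by simp
  then have z: "strict_mono z" unfolding z_def[abs_def] by (rule strict_mono_extend[OF z'(1)])
  have pz: "p (Suc i) < z (Suc i)" if "i < n" for i
  proof (cases "Suc i < n")
    case True
    then show ?thesis using z'(2) by (simp add: z_def)
  next
    case False
    then have "Suc i = n" using that by simp
    moreover have "p n < p (Suc n)" using p(1) by (simp add: strict_mono_Suc_iff)
    ultimately show ?thesis using B(1) by (simp add: z_def)
  qed
  have "\<exists>\<xi>. z i < \<xi> \<and> \<xi> < z (Suc i) \<and> (u1 \<xi> = 0 \<and> (-1) ^ Suc i * u \<xi> > 0)" if "i < n" for i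
  proof -
    have "\<exists>\<xi>. z i < \<xi> \<and> \<xi> < z (Suc i) \<and> u1 \<xi> = 0 \<and> (-1) ^ Suc i * u (p (Suc i)) \<le> (-1) ^ Suc i * u \<xi>"
    proof (rule interior_max[OF u])
      show "z i < p (Suc i)" using z'(3) that by (simp add: z_def)
      show "p (Suc i) < z (Suc i)" using pz[OF that] .
      have pos: "(-1) ^ Suc i * u (p (Suc i)) > 0" using up[of "Suc i"] that by simp
      then show "(-1) ^ Suc i * u (z i) < (-1) ^ Suc i * u (p (Suc i))"
        using z'(4)[OF that] that by (simp add: z_def)
      show "(-1) ^ Suc i * u (z (Suc i)) < (-1) ^ Suc i * u (p (Suc i))"
      proof (cases "Suc i < n")
        case True
        then show ?thesis using pos z'(4)[OF True] by (simp add: z_def)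
      next
        case False
        then have n: "Suc i = n" using that by simp
        have "(-1) ^ Suc i * u B \<le> \<bar>u B\<bar>" by (cases "even i") auto
        moreover have "(-1) ^ Suc i * u (p n) = \<bar>u (p n)\<bar>" using pos n by (cases "even i") auto
        moreover have "z (Suc i) = B" using n by (simp add: z_def)
        ultimately show ?thesis using B(2) n by simp
      qed
    qed simp
    moreover have "(-1) ^ Suc i * u (p (Suc i)) > 0" using up[of "Suc i"] that by simp
    ultimately show ?thesis by (meson order_less_le_trans)
  qed
  then obtain \<xi> where \<xi>: "strict_mono \<xi>" "\<And>i. z i < \<xi> i"
    "\<And>i. i < n \<Longrightarrow> u1 (\<xi> i) = 0 \<and> (-1) ^ Suc i * u (\<xi> i) > 0"
    using strict_mono_between[OF z, of "\<lambda>i. i < n" "\<lambda>i \<xi>. u1 \<xi> = 0 \<and> (-1) ^ Suc i * u \<xi> > 0"] by metis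
  have "z 0 > 0"
  proof (cases n)
    case 0
    have "p 0 < p (Suc 0)" using p(1) by (simp add: strict_mono_Suc_iff)
    then show ?thesis using B(1) p(2) 0 by (simp add: z_def)
  next
    case (Suc k)
    then show ?thesis using z'(2)[of 0] p(2) by (simp add: z_def)
  qed
  then have \<xi>pos: "\<xi> i > 0" for i
    using \<xi>(2)[of 0] strict_mono_less_eq[OF \<xi>(1), of 0 i] by simp
  define s where "s i = (case i of 0 \<Rightarrow> 0 | Suc j \<Rightarrow> \<xi> j)" for i
  have "strict_mono s" unfolding strict_mono_Suc_iff s_def using \<xi>(1) \<xi>pos
    by (auto simp: strict_mono_Suc_iff split: nat.split)
  moreover have "(-1) ^ i * u (s i) \<ge> 1" if "i \<le> n" for i
  proof (cases i)
    case 0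
    then show ?thesis using u0 by (simp add: s_def)
  next
    case (Suc j)
    then have j: "u1 (\<xi> j) = 0" "(-1) ^ Suc j * u (\<xi> j) > 0" using \<xi>(3)[of j] that by auto
    then have "\<bar>u (\<xi> j)\<bar> \<ge> 1"
      by (intro critical_value_ge_1[OF u u1 ode lim u0 \<xi>pos]) auto
    moreover have "\<bar>u (\<xi> j)\<bar> = (-1) ^ Suc j * u (\<xi> j)" using j(2) by (cases "even j") auto
    ultimately show ?thesis by (simp add: s_def Suc)
  qed
  moreover have "s 0 = 0" by (simp add: s_def)
  ultimately show ?thesis using P by (intro exI[of _ P] exI[of _ s]) (auto simp: u_def)
qed

theorem markov_exponential_sum:
  assumes "lde us f (\<lambda>_. 0)" "length us \<ge> 2" "\<And>\<mu>. \<mu> \<in> set us \<Longrightarrow> - \<rho> \<le> \<mu> \<and> \<mu> < 0"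
    "\<And>t. t \<ge> 0 \<Longrightarrow> \<bar>f t\<bar> \<le> 1"
  defines "d \<equiv> real (length us)"
  shows "\<bar>deriv (deriv f) 0\<bar> \<le> (16 * d\<^sup>2 - 24 * d + 11) / 3 * \<rho>\<^sup>2"
proof -
  obtain N where N: "length us = Suc (Suc N)" using assms(2) by (metis add_2_eq_Suc le_Suc_ex)
  let ?n = "Suc N"
  have "us ! 0 \<in> set us" using N by (intro nth_mem) simp
  then have \<rho>: "\<rho> > 0" using assms(3)[of "us ! 0"] by auto
  obtain P s where P: "hermite_like ?n P" and s: "strict_mono s" "s 0 = 0"
    "\<And>i. i \<le> ?n \<Longrightarrow> (-1) ^ i * (poly P (s i) * exp (- s i)) \<ge> 1" using hermite_snake[of ?n] by blast
  define q where "q t = poly P (\<rho> * t) * exp (- \<rho> * t)" for t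
  define q1 where "q1 t = \<rho> * (poly (pderiv P - P) (\<rho> * t) * exp (- \<rho> * t))" for t
  define q2 where "q2 t = \<rho> * (\<rho> * (poly (pderiv (pderiv P) - smult 2 (pderiv P) + P) (\<rho> * t) * exp (- \<rho> * t)))" for t
  have "(q has_real_derivative q1 t) (at t)" for t unfolding q_def q1_def
    by (rule derivative_eq_intros DERIV_chain2[OF poly_DERIV] refl | simp add: algebra_simps)+
  then have dq: "deriv q = q1" using DERIV_imp_deriv by blast
  have "(q1 has_real_derivative q2 t) (at t)" for t unfolding q2_def q1_def
    by (rule derivative_eq_intros DERIV_chain2[OF poly_DERIV] refl | simp add: algebra_simps pderiv_diff)+
  then have "deriv q1 = q2" using DERIV_imp_deriv by blast
  then have "deriv (deriv q) 0 = q2 0" using dq by simp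
  also have "\<dots> = \<rho> * (\<rho> * (poly (pderiv (pderiv P)) 0 - 2 * poly (pderiv P) 0 + poly P 0))"
    by (simp add: q2_def)
  \<comment> \<open>With \<open>n = d - 1\<close> the values at 0 add up to
    \<open>16 n (n - 1) / 3 + 8 n + 1\<close>; this is the origin of the constant.\<close>
  also have "\<dots> = (16 * d\<^sup>2 - 24 * d + 11) / 3 * \<rho>\<^sup>2"
    unfolding hermite_like_at_0[OF P] d_def N by (simp add: power2_eq_square field_simps)
  finally have q20: "deriv (deriv q) 0 = \<dots>" .
  have "degree P < Suc ?n" using P by (simp add: hermite_like_def)
  then have "lde (replicate (Suc ?n) (- \<rho>)) q (\<lambda>_. 0)"
    unfolding q_def[abs_def] by (rule lde_poly_exp)
  then have q: "lde (replicate (length us) (- \<rho>) @ []) q (\<lambda>_. 0)" by (simp only: N append_Nil2)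
  define r where "r i = s i / \<rho>" for i
  have r: "strict_mono r" "r 0 = 0" using s \<rho> by (auto simp: r_def strict_mono_Suc_iff divide_strict_right_mono)
  have qr: "(-1) ^ i * q (r i) \<ge> 1" if "i \<le> ?n" for i
    using s(3)[OF that] \<rho> by (simp add: q_def r_def)
  obtain g where g: "lde us g (\<lambda>_. 0)" "\<And>i. i \<le> ?n \<Longrightarrow> g (r i) = q (r i)"
    "deriv (deriv g) 0 \<le> deriv (deriv q) 0"
  proof -
    have "\<exists>g. lde ([] @ us) g (\<lambda>_. 0) \<and> (\<forall>i \<le> ?n. g (r i) = q (r i)) \<and>
      deriv (deriv g) 0 \<le> deriv (deriv q) 0"
    proof (rule exchange_exponents[OF q])
      show "0 < (-1) ^ i * q (r i)" if "i \<le> ?n" for i using qr[OF that] by linarith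
    qed (use N \<rho> assms(3) r in auto)
    then show ?thesis using that by auto
  qed
  have rnn: "r i \<ge> 0" for i using strict_mono_less_eq[OF r(1), of 0 i] r(2) by simp
  \<comment> \<open>The comparison needs strict inequalities at the nodes, but both \<open>f\<close>
    and \<open>q\<close> may have modulus one there. Hence \<open>f\<close> is scaled by
    \<open>z < 1\<close>, with \<sigma> covering both signs, and \<open>z\<close> tends to 1
    afterwards.\<close>
  have *: "z * (\<sigma> * deriv (deriv f) 0) \<le> deriv (deriv g) 0" if z: "0 < z" "z < 1" and \<sigma>: "\<bar>\<sigma>\<bar> = 1" for z \<sigma> :: real
  proof -
    let ?f = "\<lambda>t. (z * \<sigma>) * f t"
    have lf: "lde us ?f (\<lambda>_. 0)" using lde_cmult[OF assms(1), of "z * \<sigma>"] by simp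
    note fs = lde_smooth[OF assms(1)]
    have "deriv ?f = (\<lambda>t. (z * \<sigma>) * deriv f t)" by (intro ext DERIV_imp_deriv DERIV_cmult fs)
    then have "deriv (deriv ?f) 0 = (z * \<sigma>) * deriv (deriv f) 0"
      by (simp only:) (intro DERIV_imp_deriv DERIV_cmult fs)
    moreover have "deriv (deriv ?f) 0 \<le> deriv (deriv g) 0"
    proof (rule alternation_comparison[OF g(1) lf _ N r])
      fix i assume i: "i \<le> ?n"
      have "\<bar>z * \<sigma> * f (r i)\<bar> = z * \<bar>f (r i)\<bar>" using z \<sigma> by (simp add: abs_mult)
      also have "\<dots> \<le> z" using assms(4)[OF rnn] z by (simp add: mult_left_le)
      also have "\<dots> < (-1) ^ i * g (r i)" unfolding g(2)[OF i] using z(2) qr[OF i] by (rule order_less_le_trans)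
      finally show "\<bar>z * \<sigma> * f (r i)\<bar> < (-1) ^ i * g (r i)" .
    qed (use assms(3) in auto)
    ultimately show ?thesis by (simp add: mult.assoc)
  qed
  have "\<sigma> * deriv (deriv f) 0 \<le> deriv (deriv g) 0" if "\<bar>\<sigma>\<bar> = 1" for \<sigma> :: real
    by (rule field_le_mult_one_interval) (rule *[OF _ _ that])
  from this[of 1] this[of "-1"] show ?thesis using g(3) q20 by auto
qed

subsection \<open>Matrix flows\<close>

definition poly_mat :: "complex^'n^'n \<Rightarrow> complex poly \<Rightarrow> complex^'n \<Rightarrow> complex^'n" where
  "poly_mat A p z = (\<Sum>i\<le>degree p. coeff p i *s ((*v) A ^^ i) z)"

primrec annih :: "complex^'n^'n \<Rightarrow> complex list \<Rightarrow> complex^'n \<Rightarrow> complex^'n" where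
  "annih A [] z = z"
| "annih A (c # cs) z = annih A cs (A *v z - c *s z)"

lemma poly_mat_bound:
  assumes "degree p \<le> N"
  shows "poly_mat A p z = (\<Sum>i\<le>N. coeff p i *s ((*v) A ^^ i) z)"
  unfolding poly_mat_def using assms by (intro sum.mono_neutral_left) (auto simp: coeff_eq_0)

lemma matrix_power_diff:
  fixes A :: "complex^'n^'n"
  shows "((*v) A ^^ i) (y - c *s z) = ((*v) A ^^ i) y - c *s ((*v) A ^^ i) z"
  by (induction i) (auto simp: matrix_vector_mult_diff_distrib vector_scalar_commute)

lemma poly_mat_diff: "poly_mat A q (y - c *s z) = poly_mat A q y - c *s poly_mat A q z"
  unfolding poly_mat_def matrix_power_diff
  by (simp add: sum_subtractf vec.scale_sum_right vector_ssub_ldistrib vector_smult_assoc mult.commute)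

lemma poly_mat_commute: "A *v poly_mat A q z = poly_mat A q (A *v z)"
proof -
  have "A *v poly_mat A q z = (\<Sum>i\<le>degree q. A *v (coeff q i *s ((*v) A ^^ i) z))"
    unfolding poly_mat_def using vec.linear_sum[OF matrix_vector_mul_linear_gen] by blast
  then show ?thesis
    unfolding poly_mat_def by (simp add: vector_scalar_commute funpow_swap1)
qed

lemma poly_mat_linear_factor: "poly_mat A ([:- c, 1:] * q) z = poly_mat A q (A *v z - c *s z)"
proof -
  let ?d = "degree q"
  have "degree ([:- c, 1:] * q) \<le> Suc ?d"
    using degree_mult_le[of "[:- c, 1:]" q] by simp
  then have "poly_mat A ([:- c, 1:] * q) z = (\<Sum>i\<le>Suc ?d. coeff ([:- c, 1:] * q) i *s ((*v) A ^^ i) z)"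
    by (rule poly_mat_bound)
  also have "\<dots> = (\<Sum>i\<le>Suc ?d. coeff (pCons 0 q) i *s ((*v) A ^^ i) z) - c *s (\<Sum>i\<le>Suc ?d. coeff q i *s ((*v) A ^^ i) z)"
    by (simp add: vec.scale_sum_right vec.scale_left_diff_distrib sum_subtractf
        vector_smult_assoc del: sum.atMost_Suc)
  also have "(\<Sum>i\<le>Suc ?d. coeff (pCons 0 q) i *s ((*v) A ^^ i) z) = poly_mat A q (A *v z)"
    unfolding sum.atMost_Suc_shift by (simp add: poly_mat_def funpow_swap1)
  also have "(\<Sum>i\<le>Suc ?d. coeff q i *s ((*v) A ^^ i) z) = poly_mat A q z"
    by (rule poly_mat_bound[symmetric]) simp
  finally show ?thesis by (simp add: poly_mat_diff)
qed

text \<open>Factors belonging to roots that are not eigenvalues are injective and can be dropped.\<close>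
lemma poly_mat_annih:
  assumes "p \<noteq> 0" "poly_mat A p z = 0"
  shows "\<exists>cs. length cs \<le> degree p \<and> (\<forall>c\<in>set cs. \<exists>v. v \<noteq> 0 \<and> A *v v = c *s v) \<and> annih A cs z = 0"
  using assms
proof (induction "degree p" arbitrary: p z)
  case 0
  then have "coeff p 0 *s z = 0" by (simp add: poly_mat_def)
  moreover have "coeff p 0 \<noteq> 0" using 0 by (metis leading_coeff_neq_0)
  ultimately have "z = 0" by (simp add: vec_eq_iff)
  then show ?case by (intro exI[of _ "[]"]) auto
next
  case (Suc k)
  have "\<not> constant (poly p)" using Suc(2) by (metis constant_degree nat.distinct(1))
  then obtain c where "poly p c = 0" using fundamental_theorem_of_algebra by blast
  then obtain q where q: "p = [:- c, 1:] * q" by (metis poly_eq_0_iff_dvd dvdE)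
  have "q \<noteq> 0" using q Suc.prems(1) by auto
  then have deg: "degree q = k" using q Suc(2) by (simp add: degree_mult_eq del: mult_pCons_left)
  show ?case
  proof (cases "\<exists>v. v \<noteq> 0 \<and> A *v v = c *s v")
    case True
    have *: "poly_mat A q (A *v z - c *s z) = 0" using Suc.prems(2) q by (simp add: poly_mat_linear_factor del: mult_pCons_left)
    obtain cs where "length cs \<le> k" "\<forall>c\<in>set cs. \<exists>v. v \<noteq> 0 \<and> A *v v = c *s v" "annih A cs (A *v z - c *s z) = 0"
      using Suc(1)[OF deg[symmetric] \<open>q \<noteq> 0\<close> *] unfolding deg by blast
    then show ?thesis using True Suc(2) by (intro exI[of _ "c # cs"]) auto
  next
    case False
    have "poly_mat A p z = A *v poly_mat A q z - c *s poly_mat A q z"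
      unfolding q poly_mat_linear_factor poly_mat_diff poly_mat_commute ..
    then have *: "poly_mat A q z = 0" using False Suc.prems(2) by auto
    obtain cs where "length cs \<le> k" "\<forall>c\<in>set cs. \<exists>v. v \<noteq> 0 \<and> A *v v = c *s v" "annih A cs z = 0"
      using Suc(1)[OF deg[symmetric] \<open>q \<noteq> 0\<close> *] unfolding deg by blast
    then show ?thesis using Suc(2) by (intro exI[of _ cs]) auto
  qed
qed

lemma annihilating_poly:
  fixes A :: "complex^'n^'n"
  shows "\<exists>p. p \<noteq> 0 \<and> degree p \<le> CARD('n) \<and> poly_mat A p z = 0"
proof -
  let ?n = "CARD('n)"
  define w where "w i = ((*v) A ^^ i) z" for i
  have sum: "poly_mat A p z = (\<Sum>i\<le>?n. coeff p i *s w i)" if "degree p \<le> ?n" for p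
    using poly_mat_bound[OF that] by (simp add: w_def)
  show ?thesis
  \<comment> \<open>Linear dependence is a property of the set of iterates, so coinciding iterates
    need a polynomial of their own.\<close>
  proof (cases "inj_on w {..?n}")
    case False
    then obtain i j where ij: "i \<le> ?n" "j \<le> ?n" "i \<noteq> j" "w i = w j" by (auto simp: inj_on_def)
    define p :: "complex poly" where "p = monom 1 i - monom 1 j"
    have "coeff p i = 1" using ij by (simp add: p_def)
    then have "p \<noteq> 0" by auto
    moreover have "degree p \<le> ?n" unfolding p_def using ij by (intro degree_diff_le) (auto simp: degree_monom_eq)
    moreover have "(\<Sum>k\<le>?n. coeff p k *s w k) = (\<Sum>k\<le>?n. (if k = i then w k else 0) - (if k = j then w k else 0))"
      by (intro sum.cong) (auto simp: p_def)
    then have "poly_mat A p z = 0" using sum[OF \<open>degree p \<le> ?n\<close>] ij by (simp add: sum_subtractf)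
    ultimately show ?thesis by blast
  next
    case True
    let ?S = "w ` {..?n}"
    have "card ?S = Suc ?n" using True by (simp add: card_image)
    moreover have "card ?S \<le> ?n" if "vec.independent ?S"
      using vec.independent_card_le_dim[OF subset_UNIV that] by (simp add: vec.dim_UNIV card_cart_basis)
    ultimately have "vec.dependent ?S" by fastforce
    then obtain u where u: "\<exists>v\<in>?S. u v \<noteq> 0" "(\<Sum>v\<in>?S. u v *s v) = 0"
      using vec.dependent_finite[of ?S] by auto
    define p where "p = (\<Sum>i\<le>?n. monom (u (w i)) i)"
    have coeff: "coeff p i = (if i \<le> ?n then u (w i) else 0)" for i
      by (simp add: p_def coeff_sum)
    have "p \<noteq> 0" using u(1) coeff by (metis atMost_iff coeff_0 imageE)
    moreover have "degree p \<le> ?n" by (rule degree_le) (simp add: coeff)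
    moreover have "poly_mat A p z = 0"
      using u(2) unfolding sum[OF \<open>degree p \<le> ?n\<close>] sum.reindex[OF True] by (simp add: coeff)
    ultimately show ?thesis by blast
  qed
qed

definition cvec :: "real^'n \<Rightarrow> complex^'n" where
  "cvec x = (\<chi> i. complex_of_real (x $ i))"

lemma cvec_eq_0: "cvec x = 0 \<longleftrightarrow> x = 0"
  by (simp add: cvec_def vec_eq_iff)

lemma cvec_0 [simp]: "cvec 0 = 0"
  by (simp add: cvec_eq_0)

lemma cmat_cvec: "cmat A *v cvec x - complex_of_real \<mu> *s cvec x = cvec (A *v x - \<mu> *\<^sub>R x)"
  by (simp add: cmat_def cvec_def matrix_vector_mult_def vec_eq_iff)

lemma real_eigenvector:
  assumes "mat_eigenvalue A (complex_of_real \<mu>)"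
  obtains u where "u \<noteq> 0" "A *v u = \<mu> *\<^sub>R u"
proof -
  obtain v where v: "v \<noteq> 0" "cmat A *v v = complex_of_real \<mu> *s v"
    using assms by (auto simp: mat_eigenvalue_def)
  define a b where "a = (\<chi> i. Re (v $ i))" and "b = (\<chi> i. Im (v $ i))"
  have "A *v a = \<mu> *\<^sub>R a"
    using v(2) by (auto simp: a_def cmat_def matrix_vector_mult_def vec_eq_iff complex_eq_iff)
  moreover have "A *v b = \<mu> *\<^sub>R b"
    using v(2) by (auto simp: b_def cmat_def matrix_vector_mult_def vec_eq_iff complex_eq_iff)
  moreover have "a \<noteq> 0 \<or> b \<noteq> 0"
    using v(1) by (auto simp: a_def b_def vec_eq_iff complex_eq_iff)
  ultimately show ?thesis using that by blast
qed

lemma eigenvector_mat_eigenvalue: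
  assumes "u \<noteq> 0" "A *v u = \<mu> *\<^sub>R u"
  shows "mat_eigenvalue A (complex_of_real \<mu>)"
  using cmat_cvec[of A u \<mu>] assms cvec_eq_0[of u]
  by (auto simp: mat_eigenvalue_def intro!: exI[of _ "cvec u"])

lemma eigenvalue_le_onorm:
  fixes A :: "real^'n^'n"
  assumes "u \<noteq> 0" "A *v u = \<mu> *\<^sub>R u"
  shows "\<bar>\<mu>\<bar> \<le> onorm ((*v) A)"
proof -
  have "\<bar>\<mu>\<bar> * norm u \<le> onorm ((*v) A) * norm u"
    using onorm[OF matrix_vector_mul_bounded_linear[of A], of u] assms(2) by simp
  then show ?thesis using assms(1) by simp
qed

text \<open>\<open>spec_rad\<close> is a \<open>Sup\<close> of reals, which bounds its members only
  if the set is bounded; the real eigenvectors belonging to real eigenvalues provide the bound by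
  the operator norm.\<close>

lemma eigenvalue_le_spec_rad:
  fixes A :: "real^'n^'n"
  assumes "only_real_eigenvalues A" "u \<noteq> 0" "A *v u = \<mu> *\<^sub>R u"
  shows "\<bar>\<mu>\<bar> \<le> spec_rad A"
  unfolding spec_rad_def
proof (rule cSup_upper)
  show "\<bar>\<mu>\<bar> \<in> {cmod c |c. mat_eigenvalue A c}"
    using eigenvector_mat_eigenvalue[OF assms(2,3)] by (auto intro!: exI[of _ "complex_of_real \<mu>"])
  show "bdd_above {cmod c |c. mat_eigenvalue A c}"
  proof (rule bdd_aboveI, safe)
    fix c assume c: "mat_eigenvalue A c"
    then have "Im c = 0" using assms(1) by (simp add: only_real_eigenvalues_def)
    then have *: "c = complex_of_real (Re c)" by (simp add: complex_eq_iff)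
    then obtain v where "v \<noteq> 0" "A *v v = Re c *\<^sub>R v" using real_eigenvector c by metis
    then show "cmod c \<le> onorm ((*v) A)" using eigenvalue_le_onorm * by (metis norm_of_real)
  qed
qed

text \<open>The recursion has the shape of \<open>lde\<close>, so that a product annihilating
  \<open>x\<close> becomes the differential equation of the flow from \<open>x\<close>.\<close>

primrec rannih :: "real^'n^'n \<Rightarrow> real list \<Rightarrow> real^'n \<Rightarrow> real^'n" where
  "rannih A [] x = x"
| "rannih A (\<mu> # ls) x = rannih A ls (A *v x - \<mu> *\<^sub>R x)"

lemma annih_cvec: "annih (cmat A) (map complex_of_real ls) (cvec x) = cvec (rannih A ls x)"
  by (induction ls arbitrary: x) (auto simp: cmat_cvec)

lemma real_annihilator:
  fixes A :: "real^'n^'n"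
  assumes "only_real_eigenvalues A"
  obtains ls where "length ls \<le> CARD('n)" "\<And>\<mu>. \<mu> \<in> set ls \<Longrightarrow> \<exists>u. u \<noteq> 0 \<and> A *v u = \<mu> *\<^sub>R u"
    "rannih A ls x = 0"
proof -
  obtain p where p: "p \<noteq> 0" "degree p \<le> CARD('n)" "poly_mat (cmat A) p (cvec x) = 0"
    using annihilating_poly by blast
  obtain cs where cs: "length cs \<le> degree p" "\<And>c. c \<in> set cs \<Longrightarrow> mat_eigenvalue A c"
    "annih (cmat A) cs (cvec x) = 0"
    using poly_mat_annih[OF p(1,3)] by (auto simp: mat_eigenvalue_def)
  note eig = cs(2)
  have "Im c = 0" if "c \<in> set cs" for c
    using eig[OF that] assms by (simp add: only_real_eigenvalues_def)
  then have real: "complex_of_real (Re c) = c" if "c \<in> set cs" for c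
    using that by (simp add: complex_eq_iff)
  let ?ls = "map Re cs"
  have "map complex_of_real ?ls = cs" using real by (simp add: map_idI)
  then have "rannih A ?ls x = 0" using cs(3) annih_cvec[of A ?ls x] by (simp add: cvec_eq_0)
  moreover have "\<exists>u. u \<noteq> 0 \<and> A *v u = \<mu> *\<^sub>R u" if "\<mu> \<in> set ?ls" for \<mu>
    using that eig real real_eigenvector by (metis imageE list.set_map)
  ultimately show ?thesis using that[of ?ls] cs(1) p(2) by simp
qed

section \<open>Existence and uniqueness of flows\<close>

definition mat_flow :: "real^'n^'n \<Rightarrow> (real \<Rightarrow> real^'n) \<Rightarrow> bool" where
  "mat_flow A z \<longleftrightarrow> (\<forall>t. (z has_vector_derivative A *v z t) (at t))"

lemma has_vector_derivative_matrix:
  fixes A :: "real^'n^'n"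
  assumes "(z has_vector_derivative z') (at t)"
  shows "((\<lambda>t. A *v z t) has_vector_derivative A *v z') (at t)"
  using bounded_linear.has_vector_derivative[OF matrix_vector_mul_bounded_linear assms] .

text \<open>The flow \<open>y\<close> from \<open>A x - \<mu> x\<close> exists by induction, and
  \<open>z\<close> solves \<open>z' = \<mu> z + y\<close>. The defect
  \<open>w = A z - \<mu> z - y\<close> satisfies \<open>w' = \<mu> w\<close> and starts at 0, so it
  vanishes and \<open>z' = A z\<close>. The construction exhibits every coordinate of
  \<open>z\<close> as an exponential sum.\<close>

lemma mat_flow_exists_annih:
  fixes A :: "real^'n^'n"
  assumes "rannih A ls x = 0"
  shows "\<exists>z. z 0 = x \<and> mat_flow A z \<and> (\<forall>a. lde ls (\<lambda>t. a \<bullet> z t) (\<lambda>_. 0))"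
  using assms
proof (induction ls arbitrary: x)
  case Nil
  then show ?case by (intro exI[of _ "\<lambda>_. 0"]) (auto simp: mat_flow_def)
next
  case (Cons \<mu> ls)
  then obtain y where y: "y 0 = A *v x - \<mu> *\<^sub>R x" "mat_flow A y" "\<And>a. lde ls (\<lambda>t. a \<bullet> y t) (\<lambda>_. 0)"
    by auto
  have dy: "(y has_vector_derivative A *v y t) (at t)" for t using y(2) by (simp add: mat_flow_def)
  then have "isCont y t" for t using has_vector_derivative_continuous by blast
  then obtain z where z: "z 0 = x" "\<And>t. (z has_vector_derivative \<mu> *\<^sub>R z t + y t) (at t)"
    using linear_ode_exists by blast
  define w where "w t = A *v z t - \<mu> *\<^sub>R z t - y t" for t
  have dw: "(w has_vector_derivative \<mu> *\<^sub>R w t) (at t)" for t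
  proof -
    have "(w has_vector_derivative A *v (\<mu> *\<^sub>R z t + y t) - \<mu> *\<^sub>R (\<mu> *\<^sub>R z t + y t) - A *v y t) (at t)"
      unfolding w_def
      by (intro has_vector_derivative_diff has_vector_derivative_matrix z dy
          bounded_linear.has_vector_derivative[OF bounded_linear_scaleR_right])
    then show ?thesis
      by (simp add: w_def matrix_vector_right_distrib algebra_simps matrix_vector_mult_scaleR)
  qed
  have "w t = 0" for t
  proof -
    have "a \<bullet> w t = 0" for a
    proof -
      have "((\<lambda>t. a \<bullet> w t) has_real_derivative \<mu> * (a \<bullet> w t)) (at t)" for t
        using bounded_linear.has_vector_derivative[OF bounded_linear_inner_right dw, of a t]
        by (simp add: has_real_derivative_iff_has_vector_derivative)
      from exp_ode_unique[OF this] have "a \<bullet> w t = (a \<bullet> w 0) * exp (\<mu> * t)" by metis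
      then show ?thesis using y(1) z(1) by (simp add: w_def)
    qed
    then show ?thesis by (metis inner_eq_zero_iff)
  qed
  then have eq: "A *v z t = \<mu> *\<^sub>R z t + y t" for t by (simp add: w_def algebra_simps)
  have "mat_flow A z" using z(2) by (simp add: mat_flow_def eq)
  moreover have "lde (\<mu> # ls) (\<lambda>t. a \<bullet> z t) (\<lambda>_. 0)" for a
  proof -
    have "((\<lambda>t. a \<bullet> z t) has_real_derivative \<mu> * (a \<bullet> z t) + a \<bullet> y t) (at t)" for t
      using bounded_linear.has_vector_derivative[OF bounded_linear_inner_right z(2), of a t]
      by (simp add: has_real_derivative_iff_has_vector_derivative inner_add_right)
    with y(3)[of a] show ?thesis by (auto intro!: exI[of _ "\<lambda>t. a \<bullet> y t"])
  qed
  ultimately show ?case using z(1) by blast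
qed

text \<open>A Gronwall argument: the weighted squared norm \<open>g\<close> is nonincreasing. It
  works forward in time; backward uniqueness comes from \<open>mat_flow_reflect\<close>.\<close>

lemma mat_flow_zero_nonneg:
  fixes A :: "real^'n^'n"
  assumes "mat_flow A z" "z 0 = 0" "t \<ge> 0"
  shows "z t = 0"
proof -
  let ?K = "onorm ((*v) A)"
  define g where "g t = exp (- 2 * ?K * t) * (z t \<bullet> z t)" for t
  have dz: "(z has_derivative (\<lambda>h. h *\<^sub>R (A *v z t))) (at t)" for t
    using assms(1) by (simp add: mat_flow_def has_vector_derivative_def)
  have zz: "((\<lambda>t. z t \<bullet> z t) has_real_derivative 2 * (z t \<bullet> (A *v z t))) (at t)" for t
    unfolding has_field_derivative_def
    by (rule has_derivative_eq_rhs[OF has_derivative_inner[OF dz dz]])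
      (simp add: fun_eq_iff inner_commute[of "A *v z t"])
  have "g t \<le> g 0"
  proof (rule DERIV_nonpos_imp_nonincreasing[of 0 t g])
    fix t
    have "(g has_real_derivative exp (- 2 * ?K * t) * (2 * (z t \<bullet> (A *v z t)) - 2 * ?K * (z t \<bullet> z t))) (at t)"
      unfolding g_def by (rule derivative_eq_intros zz refl | simp add: algebra_simps)+
    moreover have "z t \<bullet> (A *v z t) \<le> ?K * (z t \<bullet> z t)"
    proof -
      have "z t \<bullet> (A *v z t) \<le> norm (z t) * norm (A *v z t)" by (rule norm_cauchy_schwarz)
      also have "\<dots> \<le> norm (z t) * (?K * norm (z t))"
        by (intro mult_left_mono onorm matrix_vector_mul_bounded_linear) auto
      finally show ?thesis by (simp add: power2_norm_eq_inner[symmetric] power2_eq_square mult_ac)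
    qed
    ultimately show "\<exists>y. (g has_real_derivative y) (at t) \<and> y \<le> 0"
      by (intro exI conjI) (auto simp: mult_nonneg_nonpos)
  qed (use assms in simp)
  then have "exp (- 2 * ?K * t) * (z t \<bullet> z t) \<le> 0" using assms(2) by (simp add: g_def)
  then have "z t \<bullet> z t \<le> 0" by (simp add: mult_le_0_iff)
  then show ?thesis by (metis inner_eq_zero_iff inner_ge_zero order_antisym)
qed

lemma mat_flow_reflect:
  assumes "mat_flow A z"
  shows "mat_flow (- A) (\<lambda>t. z (- t))"
  unfolding mat_flow_def
proof
  fix t
  have z: "(z has_vector_derivative A *v z (- t)) (at (- t))"
    using assms by (simp add: mat_flow_def)
  have "(uminus has_vector_derivative - 1) (at t)"
    unfolding has_real_derivative_iff_has_vector_derivative[symmetric]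
    by (rule DERIV_minus[OF DERIV_ident])
  from vector_diff_chain_at[OF this z]
  have "((\<lambda>t. z (- t)) has_vector_derivative - (A *v z (- t))) (at t)" by (simp add: o_def)
  moreover have "- A *v z (- t) = - (A *v z (- t))"
    by (simp add: matrix_vector_mult_def vec_eq_iff sum_negf)
  ultimately show "((\<lambda>t. z (- t)) has_vector_derivative - A *v z (- t)) (at t)" by simp
qed

lemma mat_flow_lincomb:
  fixes A :: "real^'n^'n"
  assumes "mat_flow A y" "mat_flow A z"
  shows "mat_flow A (\<lambda>t. a *\<^sub>R y t + b *\<^sub>R z t)"
  unfolding mat_flow_def
proof
  fix t
  have "((\<lambda>t. a *\<^sub>R y t + b *\<^sub>R z t) has_vector_derivative a *\<^sub>R (A *v y t) + b *\<^sub>R (A *v z t)) (at t)"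
    using assms by (intro has_vector_derivative_add
        bounded_linear.has_vector_derivative[OF bounded_linear_scaleR_right]) (auto simp: mat_flow_def)
  then show "((\<lambda>t. a *\<^sub>R y t + b *\<^sub>R z t) has_vector_derivative A *v (a *\<^sub>R y t + b *\<^sub>R z t)) (at t)"
    by (simp add: matrix_vector_right_distrib matrix_vector_mult_scaleR)
qed

lemma mat_flow_unique:
  fixes A :: "real^'n^'n"
  assumes "mat_flow A y" "mat_flow A z" "y 0 = z 0"
  shows "y t = z t"
proof -
  have w: "mat_flow A (\<lambda>t. 1 *\<^sub>R y t + (-1) *\<^sub>R z t)" by (intro mat_flow_lincomb assms)
  show ?thesis
  proof (cases "t \<ge> 0")
    case True
    then show ?thesis using mat_flow_zero_nonneg[OF w] assms(3) by simp
  next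
    case False
    then show ?thesis using mat_flow_zero_nonneg[OF mat_flow_reflect[OF w], of "- t"] assms(3) by simp
  qed
qed

text \<open>The matrix exponential \<open>exp (t A) x\<close>; a junk value unless the flow exists, which is shown below
  for matrices with only real eigenvalues.\<close>
definition mexp :: "real^'n^'n \<Rightarrow> real \<Rightarrow> real^'n \<Rightarrow> real^'n" where
  "mexp A t x = (SOME z. z 0 = x \<and> mat_flow A z) t"

context
  fixes A :: "real^'n^'n"
  assumes real_ev: "only_real_eigenvalues A"
begin

lemma mexp_flow: "mat_flow A (\<lambda>t. mexp A t x)" and mexp_0: "mexp A 0 x = x"
proof -
  obtain ls where "rannih A ls x = 0" using real_annihilator[OF real_ev] by blast
  from mat_flow_exists_annih[OF this] have "\<exists>z. z 0 = x \<and> mat_flow A z" by blast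
  from someI_ex[OF this] show "mat_flow A (\<lambda>t. mexp A t x)" "mexp A 0 x = x"
    by (auto simp: mexp_def[abs_def])
qed

lemma mexp_eqI: "mat_flow A z \<Longrightarrow> z 0 = x \<Longrightarrow> mexp A t x = z t"
  using mat_flow_unique[OF mexp_flow] mexp_0 by metis

lemma mexp_deriv: "((\<lambda>t. mexp A t x) has_vector_derivative A *v mexp A t x) (at t)"
  using mexp_flow by (simp add: mat_flow_def)

lemma mexp_linear: "linear (mexp A t)"
proof (rule linearI)
  show "mexp A t (x + y) = mexp A t x + mexp A t y" for x y
    using mexp_eqI[OF mat_flow_lincomb[OF mexp_flow mexp_flow, of 1 x 1 y], of "x + y"] by (simp add: mexp_0)
  show "mexp A t (c *\<^sub>R x) = c *\<^sub>R mexp A t x" for c x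
    using mexp_eqI[OF mat_flow_lincomb[OF mexp_flow mexp_flow, of c x 0 x], of "c *\<^sub>R x"] by (simp add: mexp_0)
qed

lemma mexp_add: "mexp A (s + t) x = mexp A t (mexp A s x)"
proof -
  have "mat_flow A (\<lambda>t. mexp A (s + t) x)"
    unfolding mat_flow_def
  proof
    fix t
    have "((+) s has_vector_derivative 1) (at t)"
      unfolding has_real_derivative_iff_has_vector_derivative[symmetric]
      by (auto intro!: derivative_eq_intros)
    from vector_diff_chain_at[OF this mexp_deriv[of x "s + t"]]
    show "((\<lambda>t. mexp A (s + t) x) has_vector_derivative A *v mexp A (s + t) x) (at t)"
      by (simp add: o_def)
  qed
  from mexp_eqI[OF this] show ?thesis by simp
qed

lemma mexp_inj: "inj (mexp A t)"
  using mexp_add[of t "- t"] by (intro inj_on_inverseI[of _ "mexp A (- t)"]) (simp add: mexp_0)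

lemma mexp_eigenvector: "A *v u = \<mu> *\<^sub>R u \<Longrightarrow> mexp A t u = exp (\<mu> * t) *\<^sub>R u"
proof (rule mexp_eqI)
  assume u: "A *v u = \<mu> *\<^sub>R u"
  show "mat_flow A (\<lambda>t. exp (\<mu> * t) *\<^sub>R u)"
    unfolding mat_flow_def
  proof
    fix t
    have "((\<lambda>t. exp (\<mu> * t)) has_real_derivative \<mu> * exp (\<mu> * t)) (at t)"
      by (rule derivative_eq_intros refl | simp)+
    then have "((\<lambda>t. exp (\<mu> * t) *\<^sub>R u) has_vector_derivative (\<mu> * exp (\<mu> * t)) *\<^sub>R u) (at t)"
      using has_vector_derivative_scaleR[OF _ has_vector_derivative_const] by fastforce
    then show "((\<lambda>t. exp (\<mu> * t) *\<^sub>R u) has_vector_derivative A *v (exp (\<mu> * t) *\<^sub>R u)) (at t)"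
      using u by (simp add: matrix_vector_mult_scaleR mult.commute)
  qed
qed simp

text \<open>The Markov bound depends on the number of exponents, so the list is padded to length
  \<open>CARD('n)\<close>. Padding uses a true eigenvalue to keep the range of exponents; if the
  list for \<open>x\<close> is empty, the eigenvalue comes from an annihilator of a nonzero
  vector.\<close>

lemma mexp_lde:
  obtains ls where "length ls = CARD('n)" "\<And>\<mu>. \<mu> \<in> set ls \<Longrightarrow> \<exists>u. u \<noteq> 0 \<and> A *v u = \<mu> *\<^sub>R u"
    "\<And>a. lde ls (\<lambda>t. a \<bullet> mexp A t x) (\<lambda>_. 0)"
proof -
  obtain ls where ls: "length ls \<le> CARD('n)" "\<And>\<mu>. \<mu> \<in> set ls \<Longrightarrow> \<exists>u. u \<noteq> 0 \<and> A *v u = \<mu> *\<^sub>R u"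
    "rannih A ls x = 0" using real_annihilator[OF real_ev] by blast
  obtain z where z: "z 0 = x" "mat_flow A z" "\<And>a. lde ls (\<lambda>t. a \<bullet> z t) (\<lambda>_. 0)"
    using mat_flow_exists_annih[OF ls(3)] by blast
  then have lde: "lde ls (\<lambda>t. a \<bullet> mexp A t x) (\<lambda>_. 0)" for a using mexp_eqI[OF z(2,1)] by simp
  obtain \<nu> where \<nu>: "\<exists>u. u \<noteq> 0 \<and> A *v u = \<nu> *\<^sub>R u"
  proof (cases ls)
    case (Cons \<nu> _)
    then show ?thesis using ls(2)[of \<nu>] that by auto
  next
    case Nil
    have ex: "\<exists>y::real^'n. y \<noteq> 0" by (intro exI[of _ "axis undefined 1"]) (simp add: axis_eq_0_iff)
    then obtain y :: "real^'n" where "y \<noteq> 0" by blast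
    obtain ls' where ls': "\<And>\<mu>. \<mu> \<in> set ls' \<Longrightarrow> \<exists>u. u \<noteq> 0 \<and> A *v u = \<mu> *\<^sub>R u" "rannih A ls' y = 0"
      by (rule real_annihilator[OF real_ev, of y]) (rule that)
    then have "ls' \<noteq> []" using \<open>y \<noteq> 0\<close> by auto
    then show ?thesis using that ls'(1) by (meson list.set_sel(1))
  qed
  have "lde (ls @ replicate k \<nu>) f (\<lambda>_. 0)" if "lde ls f (\<lambda>_. 0)" for k f
  proof (induction k)
    case (Suc k)
    have "lde ((ls @ replicate k \<nu>) @ [\<nu>]) f (\<lambda>_. 0)"
      unfolding lde_snoc using Suc by (intro exI[of _ "\<lambda>_. 0"]) auto
    then show ?case by (simp add: replicate_append_same)
  qed (use that in simp)
  with lde ls \<nu> show ?thesis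
    by (intro that[of "ls @ replicate (CARD('n) - length ls) \<nu>"]) (auto simp: in_set_replicate)
qed

end

subsection \<open>Joint spectral radius\<close>

lemma norm_matrix_mult_le:
  fixes A :: "real^'m^'k" and B :: "real^'n^'m"
  shows "norm (A ** B) \<le> norm A * norm B"
proof -
  have row: "norm ((A ** B) $ i) \<le> norm (A $ i) * norm B" for i
  proof -
    have "(A ** B) $ i = (\<Sum>j\<in>UNIV. (A $ i $ j) *\<^sub>R (B $ j))"
      by (simp add: matrix_matrix_mult_def vec_eq_iff)
    then have "norm ((A ** B) $ i) \<le> (\<Sum>j\<in>UNIV. norm (A $ i $ j) * norm (B $ j))"
      by (simp only:) (rule norm_sum[THEN order_trans], simp)
    also have "\<dots> \<le> L2_set (\<lambda>j. norm (A $ i $ j)) UNIV * L2_set (\<lambda>j. norm (B $ j)) UNIV"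
      using L2_set_mult_ineq[of "\<lambda>j. norm (A $ i $ j)" "\<lambda>j. norm (B $ j)" UNIV] by simp
    finally show ?thesis by (simp add: norm_vec_def)
  qed
  have "norm (A ** B) = L2_set (\<lambda>i. norm ((A ** B) $ i)) UNIV" by (simp add: norm_vec_def)
  also have "\<dots> \<le> L2_set (\<lambda>i. norm (A $ i) * norm B) UNIV"
    by (intro L2_set_mono row) auto
  also have "\<dots> = norm A * norm B"
    by (simp add: norm_vec_def[of A] L2_set_left_distrib)
  finally show ?thesis .
qed

lemma tendsto_powr_inverse_nat:
  assumes "(K::real) > 0"
  shows "(\<lambda>k. K powr (1 / real k)) \<longlonglongrightarrow> 1"
proof -
  have "(\<lambda>k. K powr (1 / real k)) \<longlonglongrightarrow> K powr 0"
    using assms by (intro tendsto_powr tendsto_const lim_1_over_n) auto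
  then show ?thesis using assms by simp
qed

text \<open>Fekete's lemma in multiplicative form: the limit is the infimum of \<open>a k powr (1 / k)\<close>.\<close>
lemma submultiplicative_root_convergent:
  fixes a :: "nat \<Rightarrow> real"
  assumes nonneg: "\<And>k. a k \<ge> 0" and sub: "\<And>m n. a (m + n) \<le> a m * a n"
  shows "convergent (\<lambda>k. a k powr (1 / real k))"
proof (cases "\<exists>m\<ge>1. a m = 0")
  case True
  then obtain m where m: "a m = 0" by blast
  have "a k = 0" if "k \<ge> m" for k
  proof -
    have "a (m + (k - m)) \<le> 0" using sub[of m "k - m"] m by simp
    then show ?thesis using nonneg[of k] that by simp
  qed
  then have "\<forall>\<^sub>F k in sequentially. a k powr (1 / real k) = 0"
    by (auto simp: eventually_sequentially)
  from tendsto_eventually[OF this] show ?thesis by (rule convergentI)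
next
  case False
  then have pos: "a k > 0" if "k \<ge> 1" for k using nonneg[of k] that by (auto simp: order_less_le)
  define b where "b k = a k powr (1 / real k)" for k
  define L where "L = Inf (b ` {1..})"
  have bdd: "bdd_below (b ` {1..})" by (intro bdd_belowI[of _ 0]) (auto simp: b_def)
  have "b \<longlonglongrightarrow> L"
  proof (rule order_tendstoI)
    fix x assume "x < L"
    have "L \<le> b k" if "k \<ge> 1" for k unfolding L_def using bdd that by (intro cInf_lower) auto
    then show "\<forall>\<^sub>F k in sequentially. x < b k"
      using \<open>x < L\<close> unfolding eventually_sequentially by (meson order_less_le_trans)
  next
    fix x assume "L < x"
    then obtain m where m: "m \<ge> 1" "b m < x"
      unfolding L_def using cInf_lessD[of "b ` {1..}" x] by auto
    define c where "c = b m"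
    have c: "c > 0" using pos[OF m(1)] by (simp add: c_def b_def)
    have cm: "a m = c ^ m" using m(1) pos[OF m(1)] c
      by (simp add: c_def b_def powr_powr flip: powr_realpow)
    \<comment> \<open>In \<open>k = q * m + s\<close> with \<open>s < m\<close>, the sum bounds
      every remainder factor \<open>a s / c ^ s\<close>. The summand 1, here and in
      \<open>a 0 * K + 1\<close>, keeps the constant positive, so that its k-th roots tend to
      1.\<close>
    define K where "K = 1 + (\<Sum>s<m. a s / c ^ s)"
    have K: "K > 0" unfolding K_def using nonneg c by (intro add_pos_nonneg sum_nonneg) auto
    have mult: "a (q * m) \<le> a 0 * a m ^ q" for q
    proof (induction q)
      case (Suc q)
      have "a (Suc q * m) \<le> a (q * m) * a m" using sub[of "q * m" m] by (simp add: add.commute)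
      also have "\<dots> \<le> a 0 * a m ^ q * a m" using Suc nonneg by (intro mult_right_mono) auto
      finally show ?case by (simp add: mult_ac)
    qed simp
    have bound: "a k \<le> (a 0 * K + 1) * c ^ k" for k
    proof -
      let ?q = "k div m" and ?s = "k mod m"
      have s: "?s < m" using m(1) by simp
      have "a k = a (?q * m + ?s)" by simp
      also have "\<dots> \<le> a (?q * m) * a ?s" by (rule sub)
      also have "\<dots> \<le> a 0 * a m ^ ?q * a ?s" using nonneg by (intro mult_right_mono mult) auto
      also have "\<dots> = a 0 * (a ?s / c ^ ?s) * (c ^ (m * ?q) * c ^ ?s)"
        using c by (simp add: cm power_mult)
      also have "c ^ (m * ?q) * c ^ ?s = c ^ k" by (simp flip: power_add)
      also have "a ?s / c ^ ?s \<le> K"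
      proof -
        have "a ?s / c ^ ?s \<le> (\<Sum>s<m. a s / c ^ s)"
          using s nonneg c by (intro member_le_sum) auto
        then show ?thesis by (simp add: K_def)
      qed
      then have "a 0 * (a ?s / c ^ ?s) * c ^ k \<le> a 0 * K * c ^ k"
        using nonneg c by (intro mult_right_mono mult_left_mono) auto
      finally have "a k \<le> a 0 * K * c ^ k" .
      moreover have "c ^ k > 0" using c by simp
      ultimately show ?thesis unfolding distrib_right mult_1 by linarith
    qed
    have K': "a 0 * K + 1 > 0" using nonneg[of 0] K by (intro add_nonneg_pos) auto
    have "(\<lambda>k. (a 0 * K + 1) powr (1 / real k) * c) \<longlonglongrightarrow> 1 * c"
      by (intro tendsto_mult tendsto_powr_inverse_nat[OF K'] tendsto_const)
    then have "\<forall>\<^sub>F k in sequentially. (a 0 * K + 1) powr (1 / real k) * c < x"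
      using m(2) by (intro order_tendstoD) (auto simp: c_def)
    then show "\<forall>\<^sub>F k in sequentially. b k < x"
      using eventually_ge_at_top[of 1]
    proof eventually_elim
      case (elim k)
      have "b k \<le> ((a 0 * K + 1) * c ^ k) powr (1 / real k)"
        unfolding b_def using bound nonneg by (intro powr_mono2) auto
      also have "\<dots> = (a 0 * K + 1) powr (1 / real k) * c"
        using elim(2) c K' by (simp add: powr_mult powr_powr flip: powr_realpow)
      finally show ?case using elim(1) by simp
    qed
  qed
  then show ?thesis unfolding convergent_def b_def[abs_def] by blast
qed

lemma foldr_matrix_mult_append:
  fixes xs :: "(real^'n^'n) list"
  shows "foldr (**) (xs @ ys) (mat 1) = foldr (**) xs (mat 1) ** foldr (**) ys (mat 1)"
  by (induction xs) (auto simp: matrix_mul_assoc)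

text \<open>\<open>jsr\<close> is a \<open>lim\<close>, which carries information only for a
  convergent sequence. Convergence follows from submultiplicativity of the suprema, and the constant
  \<open>K\<close> disappears in the k-th roots.\<close>

lemma jsr_le:
  fixes \<M> :: "(real^'n^'n) set"
  assumes "bounded \<M>" "\<M> \<noteq> {}" "K > 0" "q > 0"
    and bound: "\<And>ps. set ps \<subseteq> \<M> \<Longrightarrow> norm (foldr (**) ps (mat 1)) \<le> K * q ^ length ps"
  shows "jsr \<M> \<le> q"
proof -
  define S where "S k = {ps. length ps = k \<and> set ps \<subseteq> \<M>}" for k
  define a where "a k = (SUP ps \<in> S k. norm (foldr (**) ps (mat 1)))" for k
  obtain M where "M \<in> \<M>" using assms(2) by blast
  then have ne: "S k \<noteq> {}" for k
    by (auto simp: S_def intro!: exI[of _ "replicate k M"])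
  have bdd: "bdd_above ((\<lambda>ps. norm (foldr (**) ps (mat 1))) ` S k)" for k
    using bound by (intro bdd_aboveI[of _ "K * q ^ k"]) (auto simp: S_def)
  have le_a: "norm (foldr (**) ps (mat 1)) \<le> a k" if "ps \<in> S k" for ps k
    unfolding a_def using bdd that by (intro cSUP_upper)
  have a0: "a k \<ge> 0" for k using le_a ne by (meson ex_in_conv norm_ge_zero order_trans)
  have aK: "a k \<le> K * q ^ k" for k
    unfolding a_def using bound ne by (intro cSUP_least) (auto simp: S_def)
  have "a (m + n) \<le> a m * a n" for m n
    unfolding a_def[of "m + n"]
  proof (rule cSUP_least[OF ne])
    fix ps assume ps: "ps \<in> S (m + n)"
    have "take m ps \<in> S m" "drop m ps \<in> S n"
      using ps set_take_subset[of m ps] set_drop_subset[of m ps] by (auto simp: S_def)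
    then have "norm (foldr (**) (take m ps) (mat 1)) * norm (foldr (**) (drop m ps) (mat 1)) \<le> a m * a n"
      by (intro mult_mono le_a a0) auto
    moreover have "norm (foldr (**) ps (mat 1)) \<le> norm (foldr (**) (take m ps) (mat 1)) * norm (foldr (**) (drop m ps) (mat 1))"
      using norm_matrix_mult_le foldr_matrix_mult_append[of "take m ps" "drop m ps"] by simp
    ultimately show "norm (foldr (**) ps (mat 1)) \<le> a m * a n" by linarith
  qed
  then have "convergent (\<lambda>k. a k powr (1 / real k))"
    using a0 by (intro submultiplicative_root_convergent)
  then have lim: "(\<lambda>k. a k powr (1 / real k)) \<longlonglongrightarrow> jsr \<M>"
    unfolding jsr_def a_def S_def by (simp add: convergent_LIMSEQ_iff)
  have "(\<lambda>k. K powr (1 / real k) * q) \<longlonglongrightarrow> 1 * q"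
    by (intro tendsto_mult tendsto_powr_inverse_nat[OF assms(3)] tendsto_const)
  moreover have "a k powr (1 / real k) \<le> K powr (1 / real k) * q" if "k \<ge> 1" for k
  proof -
    have "a k powr (1 / real k) \<le> (K * q ^ k) powr (1 / real k)"
      using a0 aK by (intro powr_mono2) auto
    also have "\<dots> = K powr (1 / real k) * q"
      using that assms(3,4) by (simp add: powr_mult powr_powr flip: powr_realpow)
    finally show ?thesis .
  qed
  ultimately show ?thesis using LIMSEQ_le[OF lim] by fastforce
qed

subsection \<open>Piecewise constant trajectories and extremal norms\<close>

primrec run :: "((real^'n^'n) \<times> real) list \<Rightarrow> real^'n \<Rightarrow> real^'n" where
  "run [] x = x"
| "run (p # ps) x = run ps (mexp (fst p) (snd p) x)"

definition duration :: "((real^'n^'n) \<times> real) list \<Rightarrow> real" where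
  "duration ps = sum_list (map snd ps)"

definition admissible :: "(real^'n^'n) set \<Rightarrow> ((real^'n^'n) \<times> real) list \<Rightarrow> bool" where
  "admissible \<A> ps \<longleftrightarrow> (\<forall>p\<in>set ps. fst p \<in> \<A> \<and> snd p \<ge> 0)"

text \<open>The supremum of this set becomes the extremal norm of \<open>x\<close>.\<close>

definition gains :: "(real^'n^'n) set \<Rightarrow> real \<Rightarrow> real^'n \<Rightarrow> real set" where
  "gains \<A> a x = {exp (- a * duration ps) * norm (run ps x) | ps. admissible \<A> ps}"

lemma run_append: "run (ps @ qs) x = run qs (run ps x)"
  by (induction ps arbitrary: x) auto

lemma duration_append: "duration (ps @ qs) = duration ps + duration qs"
  by (simp add: duration_def)

lemma admissible_append: "admissible \<A> (ps @ qs) \<longleftrightarrow> admissible \<A> ps \<and> admissible \<A> qs"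
  by (auto simp: admissible_def)

lemma lipschitz_abs_cont_on:
  fixes x :: "real \<Rightarrow> 'a::real_normed_vector"
  assumes "L-lipschitz_on S x"
  shows "abs_cont_on S x"
  unfolding abs_cont_on_def
proof (intro allI impI)
  fix e :: real assume "e > 0"
  have L: "L \<ge> 0" using assms by (rule lipschitz_on_nonneg)
  define \<delta> where "\<delta> = e / (L + 1)"
  have "\<delta> > 0" using \<open>e > 0\<close> L by (simp add: \<delta>_def)
  moreover have "(\<Sum>i<n. norm (x (b i) - x (a i))) < e"
    if *: "\<forall>i<n. a i \<le> b i \<and> {a i..b i} \<subseteq> S" "(\<Sum>i<n. b i - a i) < \<delta>" for n :: nat and a b
  proof -
    have "(\<Sum>i<n. norm (x (b i) - x (a i))) \<le> (\<Sum>i<n. L * (b i - a i))"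
    proof (rule sum_mono)
      fix i assume "i \<in> {..<n}"
      then have "a i \<le> b i" and sub: "{a i..b i} \<subseteq> S" using *(1) by auto
      then have "a i \<in> S" "b i \<in> S" using subsetD[OF sub, of "a i"] subsetD[OF sub, of "b i"] by auto
      with \<open>a i \<le> b i\<close> show "norm (x (b i) - x (a i)) \<le> L * (b i - a i)"
        using lipschitz_onD[OF assms, of "b i" "a i"] by (simp add: dist_norm)
    qed
    also have "\<dots> = L * (\<Sum>i<n. b i - a i)" by (simp add: sum_distrib_left)
    also have "\<dots> \<le> L * \<delta>" using *(2) L by (intro mult_left_mono) auto
    also have "\<dots> < e" using \<open>e > 0\<close> L by (simp add: \<delta>_def field_simps)
    finally show ?thesis .
  qed
  ultimately show "\<exists>\<delta>>0. \<forall>(n::nat) a b. (\<forall>i<n. a i \<le> b i \<and> {a i..b i} \<subseteq> S) \<and>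
        (\<forall>i<n. \<forall>j<n. i \<noteq> j \<longrightarrow> b i \<le> a j \<or> b j \<le> a i) \<and> (\<Sum>i<n. b i - a i) < \<delta>
        \<longrightarrow> (\<Sum>i<n. norm (x (b i) - x (a i))) < e"
    by blast
qed

context
  fixes \<A> :: "(real^'n^'n) set"
  assumes real_ev: "\<And>A. A \<in> \<A> \<Longrightarrow> only_real_eigenvalues A"
begin

lemma mexp_lipschitz:
  assumes "A \<in> \<A>"
  obtains L where "L-lipschitz_on {a..b} (\<lambda>t. mexp A (t - c) x)"
proof -
  note A = real_ev[OF assms]
  have d: "((\<lambda>t. mexp A (t - c) x) has_vector_derivative A *v mexp A (t - c) x) (at t)" for t
  proof -
    have "((\<lambda>t. t - c) has_vector_derivative 1) (at t)"
      unfolding has_real_derivative_iff_has_vector_derivative[symmetric]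
      by (auto intro!: derivative_eq_intros)
    from vector_diff_chain_at[OF this mexp_deriv[OF A, of x "t - c"]]
    show ?thesis by (simp add: o_def)
  qed
  have "continuous_on {a..b} (\<lambda>t. A *v mexp A (t - c) x)"
    using has_vector_derivative_continuous[OF has_vector_derivative_matrix[OF d]]
    by (intro continuous_at_imp_continuous_on) auto
  then have "bounded ((\<lambda>t. A *v mexp A (t - c) x) ` {a..b})"
    using compact_continuous_image compact_imp_bounded by blast
  then obtain L where L: "L > 0" "\<And>t. t \<in> {a..b} \<Longrightarrow> norm (A *v mexp A (t - c) x) \<le> L"
    by (auto simp: bounded_pos)
  have "L-lipschitz_on {a..b} (\<lambda>t. mexp A (t - c) x)"
  proof (rule bounded_derivative_imp_lipschitz)
    fix t assume t: "t \<in> {a..b}"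
    show "((\<lambda>t. mexp A (t - c) x) has_derivative (\<lambda>h. h *\<^sub>R (A *v mexp A (t - c) x))) (at t within {a..b})"
      using d[of t] unfolding has_vector_derivative_def by (rule has_derivative_at_withinI)
    show "onorm (\<lambda>h. h *\<^sub>R (A *v mexp A (t - c) x)) \<le> L"
    proof (rule onorm_bound)
      show "norm (h *\<^sub>R (A *v mexp A (t - c) x)) \<le> L * norm h" for h
        using mult_right_mono[OF L(2)[OF t], of "\<bar>h\<bar>"] by (simp add: mult.commute)
    qed (use L(1) in simp)
  qed (use L(1) in auto)
  then show ?thesis using that by blast
qed

lemma run_linear: "admissible \<A> ps \<Longrightarrow> linear (run ps)"
proof (induction ps)
  case Nil
  then show ?case by (simp add: linear_iff)
next
  case (Cons p ps)
  then have "linear (mexp (fst p) (snd p))" "linear (run ps)"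
    using mexp_linear real_ev by (auto simp: admissible_def)
  from linear_compose[OF this] show ?case by (simp add: o_def)
qed

lemma run_inj: "admissible \<A> ps \<Longrightarrow> inj (run ps)"
proof (induction ps)
  case Nil
  then show ?case by (simp add: inj_def)
next
  case (Cons p ps)
  then have "inj (run ps)" "inj (mexp (fst p) (snd p))"
    using mexp_inj real_ev by (auto simp: admissible_def)
  from inj_compose[OF this] show ?case by (simp add: o_def)
qed

lemma piecewise_constant_trajectory:
  fixes s :: "nat \<Rightarrow> (real^'n^'n) \<times> real"
  assumes adm: "\<And>i. fst (s i) \<in> \<A>" "\<And>i. snd (s i) \<ge> 0"
  defines "T \<equiv> (\<lambda>i. duration (map s [0..<i]))"
  assumes unbounded: "\<And>t. \<exists>i. t < T i"
  obtains x where "trajectory \<A> x" "\<And>i. x (T i) = run (map s [0..<i]) x0"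
proof -
  define X where "X i = run (map s [0..<i]) x0" for i
  define A where "A i = fst (s i)" for i
  note ev = real_ev[OF adm(1)]
  have TS: "T (Suc i) = T i + snd (s i)" for i by (simp add: T_def duration_def)
  have T0: "T 0 = 0" by (simp add: T_def duration_def)
  have mono: "mono T" using adm(2) by (simp add: mono_iff_le_Suc TS)
  have Tnn: "T i \<ge> 0" for i using monoD[OF mono, of 0 i] T0 by simp
  have XS: "X (Suc i) = mexp (A i) (T (Suc i) - T i) (X i)" for i
    by (simp add: X_def run_append TS A_def)
  \<comment> \<open>Pieces of duration zero are admissible, so switching times may coincide; the
    state at such a time must not depend on the index.\<close>
  have XT: "X k = X i" if "i \<le> k" "T k = T i" for i k
    using that
  proof (induction k rule: dec_induct)
    case (step k)
    have "T k = T i" "T (Suc k) = T k"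
      using step monoD[OF mono, of i k] monoD[OF mono, of k "Suc k"] by auto
    then show ?case using step XS[of k] mexp_0[OF ev, of k] by (simp add: A_def)
  qed simp
  define idx where "idx t = (LEAST i. t < T (Suc i))" for t
  have ex: "\<exists>i. t < T (Suc i)" for t
  proof -
    obtain i where "t < T i" using unbounded by blast
    also have "T i \<le> T (Suc i)" by (rule monoD[OF mono]) simp
    finally show ?thesis by blast
  qed
  have idx_less: "t < T (Suc (idx t))" for t unfolding idx_def using LeastI_ex[OF ex] .
  have idx_ge: "T (idx t) \<le> t" if "t \<ge> 0" for t
  proof (cases "idx t")
    case 0
    then show ?thesis using T0 that by simp
  next
    case (Suc j)
    then have "\<not> t < T (Suc j)" using not_less_Least[of j "\<lambda>i. t < T (Suc i)"] by (simp add: idx_def)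
    then show ?thesis using Suc by simp
  qed
  have idx_le: "idx t \<le> i" if "t < T (Suc i)" for t i
    unfolding idx_def using that by (rule Least_le)
  define x where "x t = mexp (A (idx t)) (t - T (idx t)) (X (idx t))" for t
  have piece: "x t = mexp (A i) (t - T i) (X i)" if t: "T i \<le> t" "t \<le> T (Suc i)" for i t
  proof (cases "t < T (Suc i)")
    case True
    have "\<not> idx t < i"
    proof
      assume "idx t < i"
      then have "T (Suc (idx t)) \<le> T i" by (intro monoD[OF mono]) simp
      then show False using idx_less[of t] t by simp
    qed
    then have "idx t = i" using idx_le[OF True] by simp
    then show ?thesis by (simp add: x_def)
  next
    case False
    then have tT: "t = T (Suc i)" using t by simp
    have "t \<ge> 0" unfolding tT by (rule Tnn)
    have "\<not> idx t \<le> i"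
    proof
      assume "idx t \<le> i"
      then have "T (Suc (idx t)) \<le> T (Suc i)" by (intro monoD[OF mono]) simp
      then show False using idx_less[of t] tT by simp
    qed
    then have le: "Suc i \<le> idx t" by simp
    then have "T (idx t) = T (Suc i)"
      using idx_ge[OF \<open>t \<ge> 0\<close>] monoD[OF mono le] tT by simp
    then have "x t = X (Suc i)" using XT[OF le] mexp_0[OF ev] tT by (simp add: x_def A_def)
    then show ?thesis by (simp add: XS tT)
  qed
  have xT: "x (T i) = X i" for i
    using piece[of i "T i"] monoD[OF mono, of i "Suc i"] mexp_0[OF ev] by (simp add: A_def)
  have lip: "\<exists>L. L-lipschitz_on {0..T i} x" for i
  proof (induction i)
    case 0
    show ?case by (intro exI[of _ 0]) (auto simp: T0 lipschitz_on_def)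
  next
    case (Suc i)
    then obtain L where L: "L-lipschitz_on {0..T i} x" by blast
    obtain M where "M-lipschitz_on {T i..T (Suc i)} (\<lambda>t. mexp (A i) (t - T i) (X i))"
      using mexp_lipschitz[of "A i"] adm(1) by (metis A_def)
    then have "M-lipschitz_on {T i..T (Suc i)} x"
      using piece[of i] by (simp add: lipschitz_on_def)
    then have "(max L M)-lipschitz_on {T i..T (Suc i)} x" "(max L M)-lipschitz_on {0..T i} x"
      using L by (auto intro: lipschitz_on_le)
    from lipschitz_on_concat[OF this(2,1) refl] show ?case by (intro exI[of _ "max L M"]) simp
  qed
  have "abs_cont_on {0..t} x" for t
  proof -
    obtain i where i: "t < T i" using unbounded by blast
    obtain L where "L-lipschitz_on {0..T i} x" using lip by blast
    then have "L-lipschitz_on {0..t} x" by (rule lipschitz_on_subset) (use i in auto)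
    then show ?thesis by (rule lipschitz_abs_cont_on)
  qed
  moreover have "(\<lambda>t. A (idx t)) \<in> borel_measurable (lebesgue_on {0..})"
  proof -
    have "idx \<in> measurable borel (count_space UNIV)"
      unfolding idx_def[abs_def] by measurable
    then have "idx \<in> measurable lborel (count_space UNIV)" by simp
    then have "idx \<in> measurable (lebesgue_on {0..}) (count_space UNIV)"
      by (intro measurable_restrict_space1 measurable_completion)
    from measurable_compose[OF this, of A borel] show ?thesis by simp
  qed
  moreover have "AE t in lebesgue_on {0..}. (x has_vector_derivative (A (idx t) *v x t)) (at t)"
  proof -
    have "range T \<in> null_sets lebesgue"
      by (intro null_sets_completionI countable_imp_null_set_lborel) simp
    then have "AE t in lebesgue. t \<notin> range T" by (rule AE_not_in)
    then have "AE t in lebesgue. t \<in> {0..} \<longrightarrow> (x has_vector_derivative (A (idx t) *v x t)) (at t)"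
    proof eventually_elim
      case (elim t)
      show ?case
      proof
        assume "t \<in> {0..}"
        then have t: "T (idx t) < t" "t < T (Suc (idx t))"
          using idx_ge[of t] idx_less[of t] elim rangeI[of T "idx t"] by (fastforce simp: order_less_le)+
        let ?i = "idx t"
        have "((\<lambda>t. t - T ?i) has_vector_derivative 1) (at t)"
          unfolding has_real_derivative_iff_has_vector_derivative[symmetric]
          by (auto intro!: derivative_eq_intros)
        from vector_diff_chain_at[OF this mexp_deriv[OF ev, of ?i "X ?i" "t - T ?i"]]
        have "((\<lambda>u. mexp (A ?i) (u - T ?i) (X ?i)) has_vector_derivative A ?i *v x t) (at t)"
          by (simp add: o_def x_def A_def)
        then show "(x has_vector_derivative A ?i *v x t) (at t)"
          by (rule has_vector_derivative_transform_within_open[where S = "{T ?i<..<T (Suc ?i)}"])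
            (use t piece[of ?i] in auto)
      qed
    qed
    then show ?thesis by (subst AE_restrict_space_iff) auto
  qed
  ultimately have "trajectory \<A> x"
    unfolding trajectory_def using adm(1) by (auto simp: A_def intro!: exI[of _ "\<lambda>t. A (idx t)"])
  then show ?thesis using that xT by (simp add: X_def)
qed

lemma bdd_gains_run:
  assumes "admissible \<A> ps" "bdd_above (gains \<A> a x)"
  shows "bdd_above (gains \<A> a (run ps x))"
proof -
  obtain M where M: "\<And>qs. admissible \<A> qs \<Longrightarrow> exp (- a * duration qs) * norm (run qs x) \<le> M"
    using assms(2) by (auto simp: bdd_above_def gains_def)
  show ?thesis
  proof (rule bdd_aboveI)
    fix y assume "y \<in> gains \<A> a (run ps x)"
    then obtain qs where qs: "admissible \<A> qs" "y = exp (- a * duration qs) * norm (run qs (run ps x))"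
      by (auto simp: gains_def)
    have "exp (- a * duration qs) = exp (a * duration ps) * exp (- a * duration (ps @ qs))"
      by (simp add: duration_append algebra_simps flip: exp_add)
    then have "y = exp (a * duration ps) * (exp (- a * duration (ps @ qs)) * norm (run (ps @ qs) x))"
      by (simp add: qs run_append)
    also have "\<dots> \<le> exp (a * duration ps) * M"
      using assms(1) qs(1) by (intro mult_left_mono M) (auto simp: admissible_append)
    finally show "y \<le> exp (a * duration ps) * M" .
  qed
qed

lemma bdd_gains_subspace: "subspace {x. bdd_above (gains \<A> a x)}"
  unfolding subspace_def
proof (intro conjI ballI allI)
  show "0 \<in> {x. bdd_above (gains \<A> a x)}"
    using linear_0[OF run_linear] by (auto simp: gains_def intro!: bdd_aboveI[of _ 0])
next
  fix x y assume "x \<in> {x. bdd_above (gains \<A> a x)}" "y \<in> {x. bdd_above (gains \<A> a x)}"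
  then have bdd: "bdd_above (gains \<A> a x)" "bdd_above (gains \<A> a y)" by auto
  obtain M where M: "\<And>qs. admissible \<A> qs \<Longrightarrow> exp (- a * duration qs) * norm (run qs x) \<le> M"
    using bdd(1) by (auto simp: bdd_above_def gains_def)
  obtain N where N: "\<And>qs. admissible \<A> qs \<Longrightarrow> exp (- a * duration qs) * norm (run qs y) \<le> N"
    using bdd(2) by (auto simp: bdd_above_def gains_def)
  have "exp (- a * duration qs) * norm (run qs (x + y)) \<le> M + N" if "admissible \<A> qs" for qs
  proof -
    have "exp (- a * duration qs) * norm (run qs (x + y)) \<le> exp (- a * duration qs) * (norm (run qs x) + norm (run qs y))"
      by (intro mult_left_mono) (auto simp: linear_add[OF run_linear[OF that]] norm_triangle_ineq)
    then show ?thesis using M[OF that] N[OF that] by (simp add: distrib_left)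
  qed
  then show "x + y \<in> {x. bdd_above (gains \<A> a x)}" by (auto simp: gains_def intro!: bdd_aboveI[of _ "M + N"])
next
  fix c x assume "x \<in> {x. bdd_above (gains \<A> a x)}"
  then obtain M where M: "\<And>qs. admissible \<A> qs \<Longrightarrow> exp (- a * duration qs) * norm (run qs x) \<le> M"
    by (auto simp: bdd_above_def gains_def)
  have "exp (- a * duration qs) * norm (run qs (c *\<^sub>R x)) \<le> \<bar>c\<bar> * M" if "admissible \<A> qs" for qs
    using mult_left_mono[OF M[OF that], of "\<bar>c\<bar>"]
    by (simp add: linear_cmul[OF run_linear[OF that]] mult_ac)
  then show "c *\<^sub>R x \<in> {x. bdd_above (gains \<A> a x)}"
    by (auto simp: gains_def intro!: bdd_aboveI[of _ "\<bar>c\<bar> * M"])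
qed

text \<open>The flow maps are injective and preserve the finite-dimensional subspace of states with bounded
  gain, hence they cannot lead into it from outside.\<close>
lemma bdd_gains_run_iff:
  assumes "admissible \<A> ps"
  shows "bdd_above (gains \<A> a (run ps x)) \<longleftrightarrow> bdd_above (gains \<A> a x)"
proof
  let ?U = "{x. bdd_above (gains \<A> a x)}"
  have "run ps ` ?U \<subseteq> ?U" using bdd_gains_run[OF assms] by auto
  moreover have "subspace (run ps ` ?U)"
    using linear_subspace_image[OF run_linear[OF assms] bdd_gains_subspace] .
  moreover have "dim (run ps ` ?U) = dim ?U"
    by (rule dim_image_eq[OF run_linear[OF assms]]) (use run_inj[OF assms] in \<open>auto intro: inj_on_subset\<close>)
  ultimately have eq: "run ps ` ?U = ?U"
    using subspace_dim_equal[of "run ps ` ?U" ?U] bdd_gains_subspace by simp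
  assume "bdd_above (gains \<A> a (run ps x))"
  then have "run ps x \<in> run ps ` ?U" using eq by simp
  then show "bdd_above (gains \<A> a x)" using run_inj[OF assms] by (auto dest: injD)
qed (rule bdd_gains_run[OF assms])

text \<open>The constant in \<open>growth\<close> depends on the trajectory. Unbounded gain from
  \<open>x0\<close> persists after every finite signal by \<open>bdd_gains_run_iff\<close>, so one
  infinite signal can be built that exceeds gain \<open>n\<close> at stage \<open>n\<close>; its
  trajectory has no constant at all.\<close>

lemma bdd_gains:
  assumes "\<A> \<noteq> {}" and growth: "\<And>x. trajectory \<A> x \<Longrightarrow> \<exists>C. \<forall>t\<ge>0. norm (x t) \<le> C * exp (a * t)"
  shows "bdd_above (gains \<A> a x0)"
proof (rule ccontr)
  assume unbdd: "\<not> bdd_above (gains \<A> a x0)"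
  obtain A0 where A0: "A0 \<in> \<A>" using assms(1) by blast
  define gain where "gain ps = exp (- a * duration ps) * norm (run ps x0)" for ps
  let ?P = "\<lambda>n p. admissible \<A> p \<and> n \<le> length p \<and> real n \<le> duration p"
  \<comment> \<open>The appended piece of duration one makes the total duration unbounded, so that
    the limiting signal is defined for all times.\<close>
  let ?Q = "\<lambda>n p p'. \<exists>l. p' = (p @ l) @ [(A0, 1)] \<and> admissible \<A> l \<and> gain (p @ l) > real n"
  have "\<exists>f. \<forall>n. ?P n (f n) \<and> ?Q n (f n) (f (Suc n))"
  proof (rule dependent_nat_choice)
    show "\<exists>p. ?P 0 p" by (intro exI[of _ "[]"]) (auto simp: admissible_def duration_def)
  next
    fix p n assume p: "?P n p"
    then have "\<not> bdd_above (gains \<A> a (run p x0))" using bdd_gains_run_iff[of p a x0] unbdd by blast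
    \<comment> \<open>The factor \<open>exp (a * duration p)\<close> compensates the rescaling by
      the prefix, so that the gain of the whole list \<open>p @ l\<close> exceeds
      \<open>n\<close>.\<close>
    then obtain y where y: "y \<in> gains \<A> a (run p x0)" "y > real n * exp (a * duration p)"
      unfolding bdd_above_def by (meson not_le)
    then obtain l where l: "admissible \<A> l"
      "real n * exp (a * duration p) < exp (- a * duration l) * norm (run l (run p x0))"
      by (auto simp: gains_def)
    have "real n < gain (p @ l)"
    proof -
      have "real n = exp (- a * duration p) * (real n * exp (a * duration p))"
        by (simp add: exp_minus)
      also have "\<dots> < exp (- a * duration p) * (exp (- a * duration l) * norm (run l (run p x0)))"
        using l(2) by simp
      also have "\<dots> = gain (p @ l)"
        by (simp add: gain_def run_append duration_append algebra_simps exp_add exp_diff exp_minus field_simps)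
      finally show ?thesis .
    qed
    moreover have "duration l \<ge> 0"
      using l(1) unfolding duration_def by (intro sum_list_nonneg) (auto simp: admissible_def)
    then have "real (Suc n) \<le> duration ((p @ l) @ [(A0, 1)])" using p by (simp add: duration_def)
    ultimately show "\<exists>p'. ?P (Suc n) p' \<and> ?Q n p p'"
      using p l(1) A0 by (intro exI[of _ "(p @ l) @ [(A0, 1)]"]) (auto simp: admissible_def)
  qed
  then obtain f where f: "\<And>n. ?P n (f n)" "\<And>n. ?Q n (f n) (f (Suc n))" by blast
  define s where "s i = f (Suc i) ! i" for i
  have prefix: "\<exists>l. f n = f m @ l" if "m \<le> n" for m n
    using that
  proof (induction n rule: dec_induct)
    case (step n)
    then show ?case using f(2)[of n] by auto
  qed simp
  have nth: "f n ! i = s i" if "i < length (f n)" for n i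
  proof -
    have len: "i < length (f (Suc i))" using f(1)[of "Suc i"] by simp
    show ?thesis
    proof (cases "n \<le> Suc i")
      case True
      then show ?thesis using prefix[OF True] that by (auto simp: s_def nth_append)
    next
      case False
      then obtain l where "f n = f (Suc i) @ l" using prefix[of "Suc i" n] by auto
      then show ?thesis using len by (simp add: s_def nth_append)
    qed
  qed
  have take: "map s [0..<k] = take k (f n)" if "k \<le> length (f n)" for k n
    using that nth by (intro nth_equalityI) auto
  have s_adm: "fst (s i) \<in> \<A>" "snd (s i) \<ge> 0" for i
  proof -
    have "i < length (f (Suc i))" "admissible \<A> (f (Suc i))" using f(1)[of "Suc i"] by auto
    then show "fst (s i) \<in> \<A>" "snd (s i) \<ge> 0"
      using nth_mem[of i "f (Suc i)"] by (auto simp: s_def admissible_def)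
  qed
  have "\<exists>i. t < duration (map s [0..<i])" for t
  proof -
    obtain n where "t < real n" using reals_Archimedean2 by blast
    also have "real n \<le> duration (f n)" using f(1) by blast
    also have "f n = map s [0..<length (f n)]" using take[of "length (f n)" n] by simp
    finally show ?thesis by blast
  qed
  then obtain x where x: "trajectory \<A> x" "\<And>i. x (duration (map s [0..<i])) = run (map s [0..<i]) x0"
    using piecewise_constant_trajectory[of s x0] s_adm by blast
  obtain C where C: "\<And>t. t \<ge> 0 \<Longrightarrow> norm (x t) \<le> C * exp (a * t)" using growth[OF x(1)] by blast
  obtain n where n: "C < real n" using reals_Archimedean2 by blast
  obtain l where l: "f (Suc n) = (f n @ l) @ [(A0, 1)]" "gain (f n @ l) > real n" "admissible \<A> l"
    using f(2)[of n] by blast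
  let ?k = "length (f n @ l)"
  have ps: "map s [0..<?k] = f n @ l" using take[of ?k "Suc n"] l(1) by simp
  have "duration (f n @ l) \<ge> 0"
    using l(3) f(1)[of n] unfolding duration_def by (intro sum_list_nonneg) (auto simp: admissible_def)
  then have "norm (run (f n @ l) x0) \<le> C * exp (a * duration (f n @ l))"
    using C[of "duration (f n @ l)"] x(2)[of ?k] unfolding ps by simp
  then have "gain (f n @ l) \<le> C" by (simp add: gain_def exp_minus field_simps)
  then show False using l(2) n by simp
qed

end

text \<open>\<open>bdd_gains\<close> makes the supremum finite. The empty list gives the lower bound
  by \<open>norm\<close>, linearity of \<open>run\<close> gives the norm axioms, and prepending the
  piece \<open>(A, t)\<close> gives decay along the flow.\<close>

lemma extremal_norm_exists:
  fixes \<A> :: "(real^'n^'n) set"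
  assumes real_ev: "\<And>A. A \<in> \<A> \<Longrightarrow> only_real_eigenvalues A" and "\<A> \<noteq> {}"
    and growth: "\<And>x. trajectory \<A> x \<Longrightarrow> \<exists>C. \<forall>t\<ge>0. norm (x t) \<le> C * exp (a * t)"
  obtains v :: "real^'n \<Rightarrow> real" and K where
    "\<And>x. norm x \<le> v x" "\<And>x y. v (x + y) \<le> v x + v y" "\<And>c x. v (c *\<^sub>R x) = \<bar>c\<bar> * v x"
    "\<And>x. v x \<le> K * norm x" "K > 0"
    "\<And>A t x. A \<in> \<A> \<Longrightarrow> t \<ge> 0 \<Longrightarrow> v (mexp A t x) \<le> exp (a * t) * v x"
proof -
  define v where "v x = Sup (gains \<A> a x)" for x
  have bdd: "bdd_above (gains \<A> a x)" for x by (rule bdd_gains) (simp_all add: assms)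
  have up: "exp (- a * duration ps) * norm (run ps x) \<le> v x" if "admissible \<A> ps" for ps x
    unfolding v_def using bdd that by (intro cSup_upper) (auto simp: gains_def)
  have least: "v x \<le> M" if "\<And>ps. admissible \<A> ps \<Longrightarrow> exp (- a * duration ps) * norm (run ps x) \<le> M" for x M
    unfolding v_def
  proof (rule cSup_least)
    have "admissible \<A> []" by (simp add: admissible_def)
    then show "gains \<A> a x \<noteq> {}" by (auto simp: gains_def)
  qed (use that in \<open>auto simp: gains_def\<close>)
  have lin: "linear (run ps)" if "admissible \<A> ps" for ps by (rule run_linear[OF _ that]) (rule real_ev)
  have 1: "norm x \<le> v x" for x
    using up[of "[]" x] by (simp add: admissible_def duration_def)
  have 2: "v (x + y) \<le> v x + v y" for x y
  proof (rule least)
    fix ps assume ps: "admissible \<A> ps"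
    have "exp (- a * duration ps) * norm (run ps (x + y)) \<le> exp (- a * duration ps) * (norm (run ps x) + norm (run ps y))"
      by (intro mult_left_mono) (auto simp: linear_add[OF lin[OF ps]] norm_triangle_ineq)
    then show "exp (- a * duration ps) * norm (run ps (x + y)) \<le> v x + v y"
      using up[OF ps, of x] up[OF ps, of y] by (simp add: distrib_left)
  qed
  have le: "v (c *\<^sub>R x) \<le> \<bar>c\<bar> * v x" for c x
  proof (rule least)
    fix ps assume ps: "admissible \<A> ps"
    show "exp (- a * duration ps) * norm (run ps (c *\<^sub>R x)) \<le> \<bar>c\<bar> * v x"
      using mult_left_mono[OF up[OF ps, of x], of "\<bar>c\<bar>"]
      by (simp add: linear_cmul[OF lin[OF ps]] mult_ac)
  qed
  have 3: "v (c *\<^sub>R x) = \<bar>c\<bar> * v x" for c x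
  proof (cases "c = 0")
    case True
    then show ?thesis using le[of 0 x] 1[of 0] by simp
  next
    case False
    have "\<bar>c\<bar> * v x = \<bar>c\<bar> * v (inverse c *\<^sub>R (c *\<^sub>R x))" using False by simp
    also have "\<dots> \<le> \<bar>c\<bar> * (\<bar>inverse c\<bar> * v (c *\<^sub>R x))" by (intro mult_left_mono le) auto
    also have "\<dots> = v (c *\<^sub>R x)" using False by (simp add: abs_inverse field_simps)
    finally show ?thesis using le[of c x] by simp
  qed
  have vnn: "v x \<ge> 0" for x using 1[of x] norm_ge_zero[of x] by linarith
  define K where "K = (\<Sum>b\<in>Basis. v b) + 1"
  have K: "K > 0" unfolding K_def using vnn by (intro add_nonneg_pos sum_nonneg) auto
  have 4: "v x \<le> K * norm x" for x
  proof -
    have sum: "v (\<Sum>b\<in>B. (x \<bullet> b) *\<^sub>R b) \<le> (\<Sum>b\<in>B. \<bar>x \<bullet> b\<bar> * v b)" if "finite B" for B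
      using that
    proof (induction B)
      case empty
      then show ?case using 3[of 0 0] by simp
    next
      case (insert b B)
      then show ?case using 2[of "(x \<bullet> b) *\<^sub>R b" "\<Sum>b\<in>B. (x \<bullet> b) *\<^sub>R b"] by (simp add: 3)
    qed
    have "v x \<le> (\<Sum>b\<in>Basis. \<bar>x \<bullet> b\<bar> * v b)" using sum[OF finite_Basis] by (simp add: euclidean_representation)
    also have "\<dots> \<le> (\<Sum>b\<in>Basis. norm x * v b)"
      using vnn by (intro sum_mono mult_right_mono Basis_le_norm) auto
    also have "\<dots> \<le> K * norm x" by (simp add: K_def sum_distrib_left algebra_simps)
    finally show ?thesis .
  qed
  have 5: "v (mexp A t x) \<le> exp (a * t) * v x" if "A \<in> \<A>" "t \<ge> 0" for A t x
  proof (rule least)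
    fix ps assume ps: "admissible \<A> ps"
    then have "admissible \<A> ((A, t) # ps)" using that by (simp add: admissible_def)
    from mult_left_mono[OF up[OF this, of x], of "exp (a * t)"]
    have "exp (a * t) * (exp (- a * duration ((A, t) # ps)) * norm (run ps (mexp A t x))) \<le> exp (a * t) * v x"
      by simp
    moreover have "exp (a * t) * exp (- a * duration ((A, t) # ps)) = exp (- a * duration ps)"
      by (simp add: duration_def algebra_simps flip: exp_add)
    ultimately show "exp (- a * duration ps) * norm (run ps (mexp A t x)) \<le> exp (a * t) * v x"
      by (metis mult.assoc)
  qed
  show ?thesis by (rule that[OF 1 2 3 4 K 5])
qed

subsection \<open>Contraction of the Euler step\<close>

lemma eigenvalue_exists:
  fixes A :: "real^'n^'n"
  assumes "only_real_eigenvalues A"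
  obtains u \<mu> where "u \<noteq> 0" "A *v u = \<mu> *\<^sub>R u"
proof -
  obtain ls where ls: "length ls = CARD('n)" "\<And>\<mu>. \<mu> \<in> set ls \<Longrightarrow> \<exists>u. u \<noteq> 0 \<and> A *v u = \<mu> *\<^sub>R u"
    by (rule mexp_lde[OF assms, of 0]) (rule that)
  then have "ls ! 0 \<in> set ls" by (intro nth_mem) simp
  then show ?thesis using ls(2) that by blast
qed

text \<open>The point \<open>y\<close> is separated from the closed ball of radius \<open>m\<close>.
  As 0 is in the ball, the level \<open>b\<close> is negative, and scaling by \<open>m / b\<close>
  reverses the separation and normalises the functional to dual norm at most one.\<close>

lemma norming_functional:
  fixes v :: "'a::euclidean_space \<Rightarrow> real"
  assumes norm_le: "\<And>x. norm x \<le> v x" and tri: "\<And>x y. v (x + y) \<le> v x + v y"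
    and hom: "\<And>c x. v (c *\<^sub>R x) = \<bar>c\<bar> * v x" and "0 < m" "m < v y"
  obtains w where "\<And>u. \<bar>w \<bullet> u\<bar> \<le> v u" "m < w \<bullet> y"
proof -
  let ?S = "{z. v z \<le> m}"
  have conv: "convex_on UNIV v"
  proof (rule convex_onI)
    fix t x y assume "0 < (t::real)" "t < 1"
    then show "v ((1 - t) *\<^sub>R x + t *\<^sub>R y) \<le> (1 - t) * v x + t * v y"
      using tri[of "(1 - t) *\<^sub>R x" "t *\<^sub>R y"] by (simp add: hom)
  qed simp
  have "continuous_on UNIV v" by (rule convex_on_continuous[OF _ conv]) simp
  then have "closed ?S" by (intro closed_Collect_le continuous_intros) auto
  moreover have "convex ?S"
  proof (rule convexI)
    fix x y and s t :: real assume *: "x \<in> ?S" "y \<in> ?S" "0 \<le> s" "0 \<le> t" "s + t = 1"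
    have "v (s *\<^sub>R x + t *\<^sub>R y) \<le> s * v x + t * v y"
      using tri[of "s *\<^sub>R x" "t *\<^sub>R y"] * by (simp add: hom)
    also have "\<dots> \<le> s * m + t * m" using * by (intro add_mono mult_left_mono) auto
    also have "\<dots> = m" using *(5) by (simp flip: distrib_right)
    finally show "s *\<^sub>R x + t *\<^sub>R y \<in> ?S" by simp
  qed
  moreover have "y \<notin> ?S" using assms by simp
  ultimately obtain a b where ab: "a \<bullet> y < b" "\<And>z. z \<in> ?S \<Longrightarrow> a \<bullet> z > b"
    using separating_hyperplane_closed_point[of ?S y] by blast
  have v0: "v 0 = 0" using hom[of 0 0] by simp
  then have b: "b < 0" using ab(2)[of 0] assms(4) by simp
  define w where "w = (m / b) *\<^sub>R a"
  have le: "w \<bullet> u \<le> v u" for u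
  proof (cases "u = 0")
    case True
    then show ?thesis using v0 by simp
  next
    case False
    then have pos: "v u > 0" by (intro order_less_le_trans[OF _ norm_le]) simp
    then have "(m / v u) *\<^sub>R u \<in> ?S" using assms(4) by (simp add: hom)
    from ab(2)[OF this] have "b < (m / v u) * (a \<bullet> u)" by simp
    then have "b * v u < m * (a \<bullet> u)" using pos by (simp add: field_simps)
    then have "m * (a \<bullet> u) / b < v u" using b by (simp add: field_simps)
    then show ?thesis by (simp add: w_def)
  qed
  have "\<bar>w \<bullet> u\<bar> \<le> v u" for u
    using le[of u] le[of "- u"] hom[of "-1" u] by simp
  moreover have "m < w \<bullet> y"
    using ab(1) b assms(4) by (simp add: w_def field_simps)
  ultimately show ?thesis using that by blast
qed

locale extremal_norm =
  fixes A :: "real^'n^'n" and v :: "real^'n \<Rightarrow> real" and a r :: real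
  assumes real_ev: "only_real_eigenvalues A" and spec: "spec_rad A \<le> r"
    and norm_le: "\<And>x. norm x \<le> v x" and tri: "\<And>x y. v (x + y) \<le> v x + v y"
    and hom: "\<And>c x. v (c *\<^sub>R x) = \<bar>c\<bar> * v x"
    and flow: "\<And>t x. t \<ge> 0 \<Longrightarrow> v (mexp A t x) \<le> exp (a * t) * v x"
begin

lemma pos: "x \<noteq> 0 \<Longrightarrow> v x > 0"
  by (rule order_less_le_trans[OF _ norm_le]) simp

lemma v_nonneg: "v x \<ge> 0"
  using norm_le[of x] norm_ge_zero[of x] by linarith

lemma eigenvalue_bounds:
  assumes "u \<noteq> 0" "A *v u = \<mu> *\<^sub>R u"
  shows "- r \<le> \<mu>" "\<mu> \<le> a"
proof -
  show "- r \<le> \<mu>" using eigenvalue_le_spec_rad[OF real_ev assms] spec by simp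
  have "exp \<mu> * v u \<le> exp a * v u"
    using flow[of 1 u] mexp_eigenvector[OF real_ev assms(2), of 1] by (simp add: hom)
  then show "\<mu> \<le> a" using pos[OF assms(1)] by simp
qed

text \<open>The Euler step from \<open>x\<close> is a multiple of the Taylor polynomial of degree one, at
  \<open>\<tau> / (1 + \<alpha> * \<tau>)\<close>, of the rescaled trajectory \<open>exp (- \<alpha> * t) * exp (t A) x\<close>.\<close>
lemma euler_step:
  assumes "CARD('n) \<ge> 2" "a < \<alpha>" "\<tau> > 0" "1 + \<alpha> * \<tau> > 0"
  defines "d \<equiv> real CARD('n)"
  defines "K \<equiv> (16 * d\<^sup>2 - 24 * d + 11) / 3 * (r + \<alpha>)\<^sup>2"
  shows "v (x + \<tau> *\<^sub>R (A *v x)) \<le> (1 + \<alpha> * \<tau> + \<tau>\<^sup>2 / (2 * (1 + \<alpha> * \<tau>)) * K) * v x"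
proof (cases "x = 0")
  case True
  then show ?thesis using hom[of 0 0] by simp
next
  case False
  note vx = pos[OF False]
  let ?y = "x + \<tau> *\<^sub>R (A *v x)"
  define q where "q = 1 + \<alpha> * \<tau> + \<tau>\<^sup>2 / (2 * (1 + \<alpha> * \<tau>)) * K"
  have "16 * d\<^sup>2 - 24 * d + 11 = (4 * d - 3)\<^sup>2 + 2" by (simp add: power2_eq_square algebra_simps)
  then have "16 * d\<^sup>2 - 24 * d + 11 \<ge> 0" by (simp only:) simp
  then have "K \<ge> 0" unfolding K_def by (intro mult_nonneg_nonneg) auto
  then have q: "q > 0" unfolding q_def using assms(4)
    by (intro add_pos_nonneg[of "1 + \<alpha> * \<tau>"] mult_nonneg_nonneg divide_nonneg_nonneg) auto
  have "v ?y \<le> q * v x"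
  proof (rule ccontr)
    assume "\<not> ?thesis"
    then obtain w where w: "\<And>u. \<bar>w \<bullet> u\<bar> \<le> v u" "q * v x < w \<bullet> ?y"
      using norming_functional[OF norm_le tri hom, of "q * v x" ?y] q vx by auto
    obtain ls where ls: "length ls = CARD('n)" "\<And>\<mu>. \<mu> \<in> set ls \<Longrightarrow> \<exists>u. u \<noteq> 0 \<and> A *v u = \<mu> *\<^sub>R u"
      "\<And>b. lde ls (\<lambda>t. b \<bullet> mexp A t x) (\<lambda>_. 0)"
      by (rule mexp_lde[OF real_ev, of x]) (rule that)
    define g where "g t = ((1 / v x) *\<^sub>R w) \<bullet> mexp A t x" for t
    define \<psi> where "\<psi> t = exp (- \<alpha> * t) * g t" for t
    let ?us = "map (\<lambda>\<mu>. \<mu> + - \<alpha>) ls"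
    have \<psi>: "lde ?us \<psi> (\<lambda>_. 0)"
      using lde_exp_mult[OF ls(3)[of "(1 / v x) *\<^sub>R w"], of "- \<alpha>"] by (simp add: \<psi>_def[abs_def] g_def[abs_def])
    have us: "- (r + \<alpha>) \<le> \<mu> \<and> \<mu> < 0" if "\<mu> \<in> set ?us" for \<mu>
      using that ls(2) eigenvalue_bounds assms(2) by fastforce
    have bound: "\<bar>\<psi> t\<bar> \<le> 1" if "t \<ge> 0" for t
    proof -
      have "\<bar>\<psi> t\<bar> = exp (- \<alpha> * t) * (\<bar>w \<bullet> mexp A t x\<bar> / v x)"
        using vx by (simp add: \<psi>_def g_def abs_mult)
      also have "\<dots> \<le> exp (- \<alpha> * t) * (exp (a * t) * v x / v x)"
        using w(1)[of "mexp A t x"] flow[OF that, of x] vx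
        by (intro mult_left_mono divide_right_mono) auto
      also have "\<dots> = exp ((a - \<alpha>) * t)" using vx by (simp add: algebra_simps flip: exp_add)
      also have "\<dots> \<le> 1" using that assms(2) by (simp add: mult_nonpos_nonneg)
      finally show ?thesis .
    qed
    note d\<psi> = lde_smooth[OF \<psi>]
    \<comment> \<open>The Markov inequality speaks of 0 only; translating \<psi> keeps its exponents
      and its bound on the half-line, which carries the estimate to every \<xi>.\<close>
    have second: "\<bar>deriv (deriv \<psi>) \<xi>\<bar> \<le> K" if "\<xi> \<ge> 0" for \<xi>
    proof -
      let ?h = "\<lambda>t. \<psi> (t + \<xi>)"
      have h: "lde ?us ?h (\<lambda>_. 0)" using lde_shift[OF \<psi>, of \<xi>] by simp
      have "(?h has_real_derivative deriv \<psi> (t + \<xi>)) (at t)" for t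
        using d\<psi>(1)[of "t + \<xi>"] DERIV_shift by blast
      then have 1: "deriv ?h = (\<lambda>t. deriv \<psi> (t + \<xi>))" using DERIV_imp_deriv by blast
      have "((\<lambda>t. deriv \<psi> (t + \<xi>)) has_real_derivative deriv (deriv \<psi>) (0 + \<xi>)) (at 0)"
        using d\<psi>(2)[of "0 + \<xi>"] DERIV_shift by blast
      then have 2: "deriv (deriv ?h) 0 = deriv (deriv \<psi>) \<xi>" unfolding 1 by (simp add: DERIV_imp_deriv)
      have "\<bar>deriv (deriv ?h) 0\<bar> \<le> (16 * (real (length ?us))\<^sup>2 - 24 * real (length ?us) + 11) / 3 * (r + \<alpha>)\<^sup>2"
      proof (rule markov_exponential_sum[OF h])
        show "\<bar>\<psi> (t + \<xi>)\<bar> \<le> 1" if "t \<ge> 0" for t using bound[of "t + \<xi>"] that \<open>\<xi> \<ge> 0\<close> by simp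
      qed (use assms(1) ls(1) us in auto)
      then show ?thesis unfolding 2 by (simp add: K_def d_def ls(1))
    qed
    define s where "s = \<tau> / (1 + \<alpha> * \<tau>)"
    have s: "s > 0" using assms(3,4) by (simp add: s_def)
    have "\<exists>t>0. t < s \<and> \<psi> s = (\<Sum>m<2. ((deriv ^^ m) \<psi> 0 / fact m) * s ^ m) + ((deriv ^^ 2) \<psi> t / fact 2) * s ^ 2"
    proof (rule Maclaurin[OF s])
      show "\<forall>m t. m < 2 \<and> 0 \<le> t \<and> t \<le> s \<longrightarrow> ((deriv ^^ m) \<psi> has_real_derivative (deriv ^^ Suc m) \<psi> t) (at t)"
        using d\<psi>(1,2) by (auto simp: less_2_cases_iff)
    qed auto
    then obtain t where t: "t > 0" "\<psi> s = \<psi> 0 + deriv \<psi> 0 * s + deriv (deriv \<psi>) t / 2 * s\<^sup>2"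
      by (auto simp: numeral_2_eq_2)
    have "deriv (deriv \<psi>) t / 2 * s\<^sup>2 \<ge> - (K / 2 * s\<^sup>2)"
      using mult_right_mono[of "- K / 2" "deriv (deriv \<psi>) t / 2" "s\<^sup>2"] second[of t] t(1) by (simp add: abs_le_iff)
    then have taylor: "\<psi> 0 + deriv \<psi> 0 * s \<le> 1 + K / 2 * s\<^sup>2"
      using t(2) bound[of s] s by (simp add: abs_le_iff)
    have "(g has_real_derivative ((1 / v x) *\<^sub>R w) \<bullet> (A *v x)) (at 0)"
      using bounded_linear.has_vector_derivative[OF bounded_linear_inner_right mexp_deriv[OF real_ev, of x 0], of "(1 / v x) *\<^sub>R w"]
      by (simp only: g_def[abs_def] has_real_derivative_iff_has_vector_derivative mexp_0[OF real_ev])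
    then have "(\<psi> has_real_derivative - \<alpha> * g 0 + ((1 / v x) *\<^sub>R w) \<bullet> (A *v x)) (at 0)"
      unfolding \<psi>_def[abs_def] by (auto intro!: derivative_eq_intros)
    then have d0: "deriv \<psi> 0 = - \<alpha> * g 0 + ((1 / v x) *\<^sub>R w) \<bullet> (A *v x)" by (rule DERIV_imp_deriv)
    have p0: "\<psi> 0 = g 0" by (simp add: \<psi>_def)
    have g0: "g 0 = ((1 / v x) *\<^sub>R w) \<bullet> x" by (simp add: g_def mexp_0[OF real_ev])
    have \<tau>: "(1 + \<alpha> * \<tau>) * s = \<tau>" using assms(4) by (simp add: s_def)
    have "(w \<bullet> ?y) / v x = g 0 + \<tau> * (deriv \<psi> 0 + \<alpha> * g 0)"
      by (simp add: d0 g0 inner_add_right add_divide_distrib)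
    also have "\<dots> = (1 + \<alpha> * \<tau>) * g 0 + ((1 + \<alpha> * \<tau>) * s) * deriv \<psi> 0"
      unfolding \<tau> by (simp add: algebra_simps)
    also have "\<dots> = (1 + \<alpha> * \<tau>) * (\<psi> 0 + deriv \<psi> 0 * s)" by (simp add: p0 algebra_simps)
    also have "\<dots> \<le> (1 + \<alpha> * \<tau>) * (1 + K / 2 * s\<^sup>2)" using taylor assms(4) by (intro mult_left_mono) auto
    also have "\<dots> = q"
    proof -
      have "B * (1 + K / 2 * (\<tau> / B)\<^sup>2) = B + \<tau>\<^sup>2 / (2 * B) * K" if "B > 0" for B
        using that by (simp add: field_simps power2_eq_square)
      from this[OF assms(4)] show ?thesis by (simp only: q_def s_def)
    qed
    finally show False using w(2) vx by (simp add: field_simps)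
  qed
  then show ?thesis by (simp add: q_def)
qed

text \<open>The step is multiplication by \<open>1 + \<tau> * c\<close> with \<open>c\<close>
  between \<open>- r\<close> and \<open>a\<close>; the two arguments of \<open>max\<close> bound
  this factor and its negative.\<close>

lemma euler_step_scalar:
  assumes "CARD('n) = 1" "\<tau> > 0"
  shows "v (x + \<tau> *\<^sub>R (A *v x)) \<le> max (1 + \<tau> * a) (\<tau> * r - 1) * v x"
proof (cases "x = 0")
  case True
  then show ?thesis using hom[of 0 0] by simp
next
  case False
  obtain i :: 'n where i: "UNIV = {i}" using assms(1) by (auto simp: card_1_singleton_iff)
  define c where "c = A $ i $ i"
  have all: "j = i" for j using i by auto
  have Ax: "A *v x = c *\<^sub>R x" unfolding vec_eq_iff
  proof
    fix j show "(A *v x) $ j = (c *\<^sub>R x) $ j"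
      unfolding matrix_vector_mult_def i by (simp add: all[of j] c_def)
  qed
  then have c: "- r \<le> c" "c \<le> a" using eigenvalue_bounds[OF False] by auto
  have "\<tau> * c \<le> \<tau> * a" using c assms(2) by simp
  moreover have "\<tau> * (- r) \<le> \<tau> * c" using c assms(2) by (intro mult_left_mono) auto
  ultimately have "\<bar>1 + \<tau> * c\<bar> \<le> max (1 + \<tau> * a) (\<tau> * r - 1)" by (auto simp: abs_if max_def)
  moreover have "x + \<tau> *\<^sub>R (A *v x) = (1 + \<tau> * c) *\<^sub>R x" by (simp add: Ax algebra_simps)
  ultimately show ?thesis using v_nonneg by (simp add: hom mult_right_mono)
qed

end

section \<open>From contraction to the joint spectral radius\<close>

lemma matrix_norm_le_sum:
  fixes P :: "real^'n^'m"
  assumes "\<And>x. norm (P *v x) \<le> c * norm x"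
  shows "norm P \<le> real CARD('m) * real CARD('n) * c"
proof -
  have "\<bar>P $ i $ j\<bar> \<le> c" for i j
  proof -
    have "\<bar>P $ i $ j\<bar> = \<bar>(P *v axis j 1) $ i\<bar>"
      by (simp add: matrix_vector_mult_basis column_def)
    also have "\<dots> \<le> norm (P *v axis j 1)" by (rule component_le_norm_cart)
    also have "\<dots> \<le> c" using assms[of "axis j 1"] by simp
    finally show ?thesis .
  qed
  then have row: "norm (P $ i) \<le> real CARD('n) * c" for i
    using order_trans[OF norm_le_l1_cart[of "P $ i"] sum_bounded_above[of UNIV "\<lambda>j. \<bar>P $ i $ j\<bar>" c]]
    by simp
  have "norm P \<le> (\<Sum>i\<in>UNIV. norm (P $ i))" unfolding norm_vec_def[of P] by (rule L2_set_le_sum) simp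
  also have "\<dots> \<le> real CARD('m) * (real CARD('n) * c)" using sum_bounded_above[of UNIV "\<lambda>i. norm (P $ i)"] row by fastforce
  finally show ?thesis by (simp add: mult.assoc)
qed

lemma jsr_le_contraction:
  fixes v :: "real^'n \<Rightarrow> real"
  assumes "bounded \<M>" "\<M> \<noteq> {}" "\<And>x. norm x \<le> v x" "\<And>x. v x \<le> K * norm x" "K > 0" "q > 0"
    and step: "\<And>M x. M \<in> \<M> \<Longrightarrow> v (M *v x) \<le> q * v x"
  shows "jsr \<M> \<le> q"
proof (rule jsr_le)
  fix ps assume ps: "set ps \<subseteq> \<M>"
  have "v (foldr (**) ps (mat 1) *v x) \<le> q ^ length ps * v x" for x
    using ps
  proof (induction ps)
    case (Cons M ps)
    then have "v (foldr (**) (M # ps) (mat 1) *v x) \<le> q * v (foldr (**) ps (mat 1) *v x)"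
      using step[of M "foldr (**) ps (mat 1) *v x"] by (simp add: matrix_vector_mul_assoc)
    also have "\<dots> \<le> q * (q ^ length ps * v x)" using Cons assms(6) by (intro mult_left_mono) auto
    finally show ?case by simp
  qed simp
  note iter = this
  have "norm (foldr (**) ps (mat 1) *v x) \<le> (K * q ^ length ps) * norm x" for x
  proof -
    have "norm (foldr (**) ps (mat 1) *v x) \<le> q ^ length ps * v x"
      using iter assms(3) order_trans by blast
    also have "\<dots> \<le> q ^ length ps * (K * norm x)" using assms(4,6) by (intro mult_left_mono) auto
    finally show ?thesis by (simp add: mult_ac)
  qed
  \<comment> \<open>\<open>norm\<close> of a matrix is the Euclidean norm of its entries; passing to
    it from the operator bound costs a factor depending on the dimension alone.\<close>
  from matrix_norm_le_sum[OF this]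
  show "norm (foldr (**) ps (mat 1)) \<le> (real CARD('n) * real CARD('n) * K) * q ^ length ps"
    by (simp add: mult.assoc)
qed (use assms in auto)

text \<open>The second claim means \<open>\<tau> * C * (r - \<delta>)^2 < 2 * \<delta> * (1 -
  \<delta> * \<tau>)\<close>. It follows from \<open>\<tau> * C * r^2 < 2 * \<epsilon>\<close> once
  \<open>(r - \<delta>)^2\<close> is bounded by \<open>r^2 * (1 - \<delta> * \<tau>)\<close>, which
  uses \<open>\<tau> * r < 1\<close>. The latter comes from \<open>C \<ge> 9\<close>, valid from
  dimension two on.\<close>

lemma contraction_factor_less_1:
  fixes \<delta> \<epsilon> \<tau> r C :: real
  assumes "0 < \<epsilon>" "\<epsilon> < \<delta>" "\<delta> \<le> r" "0 < \<tau>" "\<tau> * (C * r\<^sup>2) < 2 * \<epsilon>" "C \<ge> 9"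
  shows "0 < 1 - \<delta> * \<tau>" "1 - \<delta> * \<tau> + \<tau>\<^sup>2 / (2 * (1 - \<delta> * \<tau>)) * (C * (r - \<delta>)\<^sup>2) < 1"
proof -
  have r: "r > 0" using assms by simp
  have "\<tau> * (9 * r\<^sup>2) \<le> \<tau> * (C * r\<^sup>2)" using assms by (intro mult_left_mono mult_right_mono) auto
  moreover have "(9 * (\<tau> * r)) * r = \<tau> * (9 * r\<^sup>2)" by (simp add: power2_eq_square)
  ultimately have "(9 * (\<tau> * r)) * r < 2 * r" using assms by linarith
  then have "9 * (\<tau> * r) < 2" using r by (rule mult_right_less_imp_less[OF _ less_imp_le])
  then have \<tau>r: "\<tau> * r < 1" by simp
  have "\<delta> * \<tau> \<le> r * \<tau>" using assms by (intro mult_right_mono) auto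
  then show pos: "0 < 1 - \<delta> * \<tau>" using \<tau>r by (simp add: mult.commute)
  have "\<delta> * \<delta> \<le> r * \<delta>" using assms by (intro mult_right_mono) auto
  moreover have "(\<tau> * r) * (r * \<delta>) \<le> 1 * (r * \<delta>)" using \<tau>r assms r by (intro mult_right_mono) auto
  ultimately have "(r - \<delta>)\<^sup>2 \<le> r\<^sup>2 * (1 - \<delta> * \<tau>)" by (simp add: power2_eq_square algebra_simps)
  then have "\<tau> * (C * (r - \<delta>)\<^sup>2) \<le> \<tau> * (C * (r\<^sup>2 * (1 - \<delta> * \<tau>)))" using assms by (intro mult_left_mono) auto
  also have "\<dots> = (\<tau> * (C * r\<^sup>2)) * (1 - \<delta> * \<tau>)" by simp
  also have "\<dots> < (2 * \<delta>) * (1 - \<delta> * \<tau>)" using assms pos by (intro mult_strict_right_mono) auto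
  finally have "\<tau> * (\<tau> * (C * (r - \<delta>)\<^sup>2)) < \<tau> * ((2 * \<delta>) * (1 - \<delta> * \<tau>))" using assms(4) by simp
  then have "\<tau>\<^sup>2 * (C * (r - \<delta>)\<^sup>2) < (\<delta> * \<tau>) * (2 * (1 - \<delta> * \<tau>))" by (simp add: power2_eq_square algebra_simps)
  then have "\<tau>\<^sup>2 * (C * (r - \<delta>)\<^sup>2) / (2 * (1 - \<delta> * \<tau>)) < \<delta> * \<tau>" using pos by (subst pos_divide_less_eq) auto
  then show "1 - \<delta> * \<tau> + \<tau>\<^sup>2 / (2 * (1 - \<delta> * \<tau>)) * (C * (r - \<delta>)\<^sup>2) < 1" by simp
qed

theorem theorem4:
  fixes \<A> :: "(real^'n^'n) set" and r \<epsilon> \<tau> :: real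
  defines "d \<equiv> real CARD('n)"
  assumes "r > 0" and "\<epsilon> > 0"
    and "0 < \<tau>" and "\<tau> < 6 * \<epsilon> / ((16 * d^2 - 24 * d + 11) * r^2)"
    and "compact \<A>" and "\<A> \<noteq> {}"
    and "\<forall>A\<in>\<A>. only_real_eigenvalues A"
    and "\<forall>A\<in>\<A>. spec_rad A \<le> r"
    and "jsr ((\<lambda>A. mat 1 + \<tau> *\<^sub>R A) ` \<A>) \<ge> 1"
  shows "lyap_exp \<A> \<ge> ereal (- \<epsilon>)"
proof (rule ccontr)
  assume "\<not> ?thesis"
  then obtain a where a: "a < - \<epsilon>"
    "\<And>x. trajectory \<A> x \<Longrightarrow> \<exists>C. \<forall>t\<ge>0. norm (x t) \<le> C * exp (a * t)"
    by (auto simp: lyap_exp_def not_le Inf_less_iff)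
  let ?M = "(\<lambda>A. mat 1 + \<tau> *\<^sub>R A) ` \<A>"
  define C where "C = (16 * d\<^sup>2 - 24 * d + 11) / 3"
  have real_ev: "only_real_eigenvalues A" if "A \<in> \<A>" for A using that assms by blast
  obtain v K where v: "\<And>x. norm x \<le> v x" "\<And>x y. v (x + y) \<le> v x + v y"
    "\<And>c x. v (c *\<^sub>R x) = \<bar>c\<bar> * v x" "\<And>x. v x \<le> K * norm x" "K > 0"
    "\<And>A t x. A \<in> \<A> \<Longrightarrow> t \<ge> 0 \<Longrightarrow> v (mexp A t x) \<le> exp (a * t) * v x"
    using extremal_norm_exists[OF real_ev \<open>\<A> \<noteq> {}\<close> a(2)] by metis
  have ext: "extremal_norm A v a r" if "A \<in> \<A>" for A
    using that real_ev v assms by unfold_locales auto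
  obtain A0 where "A0 \<in> \<A>" using \<open>\<A> \<noteq> {}\<close> by blast
  obtain u \<mu> where "u \<noteq> 0" "A0 *v u = \<mu> *\<^sub>R u" using eigenvalue_exists[OF real_ev[OF \<open>A0 \<in> \<A>\<close>]] by blast
  \<comment> \<open>The eigenvalue \<mu> lies between \<open>- r\<close> and \<open>a\<close>.
    Consequently \<epsilon> and the \<delta> chosen below do not exceed \<open>r\<close>.\<close>
  then have ra: "- r \<le> a" using extremal_norm.eigenvalue_bounds[OF ext[OF \<open>A0 \<in> \<A>\<close>]] by fastforce
  have d1: "d \<ge> 1" unfolding d_def using zero_less_card_finite[where ?'a = 'n] by linarith
  have "3 * C = (4 * d - 3)\<^sup>2 + 2" by (simp add: C_def power2_eq_square field_simps)
  then have Cpos: "C > 0" using zero_le_power2[of "4 * d - 3"] by linarith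
  have "\<tau> < 2 * \<epsilon> / (C * r\<^sup>2)" using assms by (simp add: C_def field_simps)
  then have \<tau>: "\<tau> * (C * r\<^sup>2) < 2 * \<epsilon>" using Cpos \<open>r > 0\<close> by (simp add: pos_less_divide_eq)
  have "\<exists>q<1. \<forall>A\<in>\<A>. \<forall>x. v (x + \<tau> *\<^sub>R (A *v x)) \<le> q * v x"
  proof (cases "CARD('n) = 1")
    case True
    then have "C = 1" by (simp add: C_def d_def)
    then have "(\<tau> * r) * r < 2 * r" using \<tau> a(1) ra by (simp add: power2_eq_square algebra_simps)
    then have "\<tau> * r < 2" using \<open>r > 0\<close> by simp
    moreover have "\<tau> * a < 0" using a(1) \<open>\<epsilon> > 0\<close> \<open>0 < \<tau>\<close> by (simp add: mult_pos_neg)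
    ultimately have "max (1 + \<tau> * a) (\<tau> * r - 1) < 1" by simp
    then show ?thesis
      using extremal_norm.euler_step_scalar[OF ext True \<open>0 < \<tau>\<close>] by blast
  next
    case False
    then have card: "CARD('n) \<ge> 2" using zero_less_card_finite[where ?'a = 'n] by linarith
    then have "d \<ge> 2" by (simp add: d_def)
    then have "(4 * d - 3)\<^sup>2 \<ge> 5\<^sup>2" by (intro power_mono) auto
    then have C: "C \<ge> 9" using \<open>3 * C = _\<close> by simp
    \<comment> \<open>The midpoint of \<epsilon> and \<open>- a\<close>: being above \<epsilon> it
      gives a factor below one, and \<open>- \<delta>\<close> being above \<open>a\<close> it makes
      all shifted exponents strictly negative.\<close>
    define \<delta> where "\<delta> = (\<epsilon> - a) / 2"
    have \<delta>: "\<epsilon> < \<delta>" "\<delta> \<le> r" "a < - \<delta>" using a(1) ra by (auto simp: \<delta>_def field_simps)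
    note f = contraction_factor_less_1[OF \<open>\<epsilon> > 0\<close> \<delta>(1,2) \<open>0 < \<tau>\<close> \<tau> C]
    have "0 < 1 + - \<delta> * \<tau>" using f(1) by simp
    from extremal_norm.euler_step[OF ext card \<delta>(3) \<open>0 < \<tau>\<close> this]
    have "v (x + \<tau> *\<^sub>R (A *v x)) \<le> (1 - \<delta> * \<tau> + \<tau>\<^sup>2 / (2 * (1 - \<delta> * \<tau>)) * (C * (r - \<delta>)\<^sup>2)) * v x"
      if "A \<in> \<A>" for A x using that by (simp add: C_def d_def)
    then show ?thesis using f(2) by blast
  qed
  then obtain q where q: "q < 1" "\<And>A x. A \<in> \<A> \<Longrightarrow> v (x + \<tau> *\<^sub>R (A *v x)) \<le> q * v x" by blast
  have vnn: "v x \<ge> 0" for x using v(1)[of x] norm_ge_zero[of x] by linarith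
  \<comment> \<open>The maximum with \<open>1 / 2\<close> ensures a positive contraction factor, as
    \<open>jsr_le_contraction\<close> requires.\<close>
  have "jsr ?M \<le> max q (1 / 2)"
  proof (rule jsr_le_contraction[OF _ _ v(1) v(4,5)])
    have "compact ?M" using \<open>compact \<A>\<close> by (intro compact_continuous_image continuous_intros)
    then show "bounded ?M" by (rule compact_imp_bounded)
    fix M x assume "M \<in> ?M"
    then obtain A where A: "A \<in> \<A>" "M = mat 1 + \<tau> *\<^sub>R A" by blast
    have "v (M *v x) \<le> q * v x"
      using q(2)[OF A(1), of x] by (simp add: A(2) matrix_vector_mult_add_rdistrib scaleR_matrix_vector_assoc)
    also have "\<dots> \<le> max q (1 / 2) * v x" using vnn by (intro mult_right_mono) auto
    finally show "v (M *v x) \<le> max q (1 / 2) * v x" .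
  qed (use \<open>\<A> \<noteq> {}\<close> in auto)
  then show False using q(1) assms by simp
qed

end
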